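(* Suppose that there is a finite constant $r_1$ such that $\mathbb{P}[W_n\le r_1]=1$ for all $n$, and that $\mathbb{P}[W_n\ge 3]=1$ for all sufficiently large $n$. Then $\alpha^*_\rho\le\underline{\alpha}_\rho\le 1$, and for any $\varepsilon>0$, $$\lim_{n\to\infty}\mathbb{P}\left[(\alpha^*_\rho-\varepsilon)n\le T_n\le(\underline{\alpha}_\rho+\varepsilon)n\right]=1.$$
   Context: Convention: $0^0:=1$. Let $W$ be an $\mathbb{N}$-valued random variable with $\rho(s):=\mathbb{E}[s^W]$. For each $n\in\mathbb{N}$ let $W_n$ be a random variable with values in $\{1,\ldots,n\}$, such that $W_n\to W$ in distribution as $n\to\infty$. For each $n$, let $X_1,X_2,\ldots$ be i.i.d. random vectors in $\{0,1\}^n$, each having weight (number of ones) distributed as $W_n$ and, conditionally on its weight being $k$, uniformly distributed over the vectors in $\{0,1\}^n$ of weight $k$. Define $$T_n:=\min\{m\in\mathbb{N}: X_m\in\mathrm{span}\{X_1,\ldots,X_{m-1}\}\},$$ where span is the linear span over the field with two elements. Thresholds: for $\alpha\ge 0$ let $$F_\rho(\alpha):=\log\sup_{\gamma\in[0,1/2]}\left(\frac{(1+\rho(1-2\gamma))^\alpha}{2\gamma^\gamma(1-\gamma)^{1-\gamma}}\right),\qquad \alpha^*_\rho:=\inf\{\alpha\ge 0: F_\rho(\alpha)>0\}.$$ For $x\in(0,1)$ let $$\psi(x):=x+\left(1+\frac{\rho(x)}{\rho'(x)}-x\right)\log(1-x),\qquad h(x):=-\frac{\log(1-x)}{\rho'(x)}.$$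 Let $\alpha^\sharp_\rho:=\inf_{x\in(0,1)}h(x)$; for $\alpha\ge 0$ let $g^*(\alpha):=\sup\{x\in(0,1):h(x)\le\alpha\}$ with $\sup\emptyset:=0$; and let $\underline{\alpha}_\rho:=\inf\{\alpha>\alpha^\sharp_\rho:\psi(g^*(\alpha))<0\}$. *)

theory Defs
  imports "HOL-Probability.Probability" "HOL-Library.Z2" "HOL-Library.Function_Algebras"
begin

section \<open>Vectors over the field with two elements\<close>

text \<open>
  The dimension \<open>n\<close> varies, so a vector in \<open>{0,1}\<^sup>n\<close> is a sequence over the two-element field
  \<^typ>\<open>bit\<close> that vanishes from index \<open>n\<close> on. All of these live in the single vector space of
  sequences, and linear spans are the same whether computed there or in \<open>{0,1}\<^sup>n\<close>.
\<close>

definition bit_scale :: "bit \<Rightarrow> (nat \<Rightarrow> bit) \<Rightarrow> (nat \<Rightarrow> bit)" where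
  "bit_scale c v = (\<lambda>i. c * v i)"

interpretation F2: vector_space bit_scale
  by unfold_locales (auto simp: bit_scale_def fun_eq_iff algebra_simps)

definition cube :: "nat \<Rightarrow> (nat \<Rightarrow> bit) set" where
  "cube n = {v. \<forall>i\<ge>n. v i = 0}"

definition weight :: "(nat \<Rightarrow> bit) \<Rightarrow> nat" where
  "weight v = card {i. v i = 1}"

definition first_dependence :: "(nat \<Rightarrow> nat \<Rightarrow> bit) \<Rightarrow> nat" where
  "first_dependence x = (LEAST m. 1 \<le> m \<and> x m \<in> F2.span (x ` {1..<m}))"

section \<open>The random vectors\<close>

text \<open>
  \<open>X 1, X 2, \<dots>\<close> (on the probability space \<open>M\<close>) are i.i.d. vectors in \<open>{0,1}\<^sup>n\<close> whose weight is
  distributed as the random variable \<open>w\<close> (on a possibly different space \<open>N\<close>), uniform given their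
  weight. That they are identically distributed follows from the last two assumptions, which
  determine the law of each \<open>X i\<close>. The value \<open>X 0\<close> is irrelevant.
\<close>

locale random_bit_vectors = prob_space M
  for M :: "'a measure" and N :: "'b measure" and n :: nat
    and w :: "'b \<Rightarrow> nat" and X :: "nat \<Rightarrow> 'a \<Rightarrow> nat \<Rightarrow> bit" +
  assumes indep: "indep_vars (\<lambda>_. count_space (cube n)) X {1..}"
    and weight_law: "\<And>i. 1 \<le> i \<Longrightarrow>
      distr M (count_space UNIV) (\<lambda>\<omega>. weight (X i \<omega>)) = distr N (count_space UNIV) w"
    and uniform_given_weight: "\<And>i k v. \<lbrakk>1 \<le> i; \<P>(\<omega> in M. weight (X i \<omega>) = k) > 0;
        v \<in> cube n; weight v = k\<rbrakk> \<Longrightarrow>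
      \<P>(\<omega> in M. X i \<omega> = v \<bar> weight (X i \<omega>) = k) = 1 / real (card {u \<in> cube n. weight u = k})"

section \<open>Generating function and thresholds\<close>

definition pgf :: "'c measure \<Rightarrow> ('c \<Rightarrow> nat) \<Rightarrow> real \<Rightarrow> real" where
  "pgf Q W s = (\<integral>\<omega>. s ^ W \<omega> \<partial>Q)"

text \<open>Real powers with \<open>0\<^sup>0 = 1\<close>, unlike \<^term>\<open>(0::real) powr 0\<close>, which is \<open>0\<close>.\<close>

definition rpow :: "real \<Rightarrow> real \<Rightarrow> real" where
  "rpow x a = (if a = 0 then 1 else x powr a)"

definition F_fun :: "(real \<Rightarrow> real) \<Rightarrow> real \<Rightarrow> real" where
  "F_fun \<rho> \<alpha> = ln (SUP \<gamma>\<in>{0..1/2}.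
     rpow (1 + \<rho> (1 - 2 * \<gamma>)) \<alpha> / (2 * rpow \<gamma> \<gamma> * rpow (1 - \<gamma>) (1 - \<gamma>)))"

text \<open>
  The infima below are taken in \<^typ>\<open>real\<close>; for generating functions \<open>\<rho>\<close> of bounded variables with
  values \<open>\<ge> 1\<close> all the sets are nonempty and bounded below. Only the supremum in \<open>g_star\<close> can be
  over the empty set.
\<close>

definition alpha_star :: "(real \<Rightarrow> real) \<Rightarrow> real" where
  "alpha_star \<rho> = Inf {\<alpha>. 0 \<le> \<alpha> \<and> F_fun \<rho> \<alpha> > 0}"

definition psi :: "(real \<Rightarrow> real) \<Rightarrow> real \<Rightarrow> real" where
  "psi \<rho> x = x + (1 + \<rho> x / deriv \<rho> x - x) * ln (1 - x)"

definition h_fun :: "(real \<Rightarrow> real) \<Rightarrow> real \<Rightarrow> real" where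
  "h_fun \<rho> x = - (ln (1 - x) / deriv \<rho> x)"

definition alpha_sharp :: "(real \<Rightarrow> real) \<Rightarrow> real" where
  "alpha_sharp \<rho> = (INF x\<in>{0<..<1}. h_fun \<rho> x)"

definition g_star :: "(real \<Rightarrow> real) \<Rightarrow> real \<Rightarrow> real" where
  "g_star \<rho> \<alpha> = (let S = {x \<in> {0<..<1}. h_fun \<rho> x \<le> \<alpha>} in if S = {} then 0 else Sup S)"

definition alpha_lower :: "(real \<Rightarrow> real) \<Rightarrow> real" where
  "alpha_lower \<rho> = Inf {\<alpha>. \<alpha> > alpha_sharp \<rho> \<and> psi \<rho> (g_star \<rho> \<alpha>) < 0}"

end

theory Submission
  imports Defs "HOL-Real_Asymp.Real_Asymp"
begin

text \<open>
  \<^bold>\<open>Upper bound.\<close> Let \<open>x\<close> be the fraction of unit vectors in the span of a set \<open>B\<close>. A new random vector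
  lies in that span with probability at least about \<open>\<rho>(x)\<close>, which by convexity is at least
  \<open>\<rho>(x\<^sub>0) + \<rho>'(x\<^sub>0)(x - x\<^sub>0)\<close>; and \<open>1 - x\<close> is exactly the expected rank increase due to a uniformly
  random unit vector. So each random vector may be exchanged for \<open>\<rho>'(x\<^sub>0)\<close> random unit vectors, at a
  constant cost; since insertions into a set commute, all of them may be exchanged, and the rank of
  random unit vectors is explicit. With \<open>x\<^sub>0 = g\<^sup>*(\<alpha>)\<close> this bounds the expected rank of \<open>\<alpha> n\<close> vectors by
  \<open>(\<alpha> + \<psi>(x\<^sub>0)) n + o(n)\<close>. As the rank has variance at most \<open>\<alpha> n\<close>, the vectors are dependent with
  high probability when \<open>\<psi>(x\<^sub>0) < 0\<close>.

  \<^bold>\<open>Lower bound.\<close> First moment of the number of nonempty subsets of \<open>{1..\<alpha> n}\<close> along which the vectors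
  sum to zero. Small subsets are rare because the supports of their vectors cover each point at least
  twice; subsets of linear size are counted with characters of the cube.

  The inequality of the thresholds follows, because both bounds hold with probability tending to one.
\<close>

section \<open>Linear algebra over the two-element field\<close>

text \<open>The exchange in the upper bound uses no information on the evolving set: the tangent is
  affine in the fraction of unit vectors in the span, and a unit insertion has exactly the matching
  affine gain, so the unknown fraction cancels for every set \<open>B\<close>.

  The lower bound is shaped by the point \<open>\<gamma> = 1/2\<close>, where the quotient in
  \<open>F_fun\<close> equals 1 for every \<alpha>. Near it the entropy estimate has no exponential
  slack, while the errors of finite \<open>n\<close> cost a factor \<open>(1 + o(1)) ^ m\<close>.
  Away from it slack comes from an exponent strictly between \<alpha> and \<open>alpha_star\<close>.
  Near it the character sums are at most a small constant \<tau>, and \<open>\<tau> ^ card S\<close>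
  beats the number \<open>2 ^ m\<close> of subsets only if \<open>card S\<close> is at least a fixed
  fraction of \<open>n\<close>.

  Smaller subsets therefore need another argument. There are about \<open>(n/s)^s\<close> of them of
  size \<open>s\<close>; double covering makes each vanish with probability about
  \<open>(s/n)^(3s/2)\<close> when all weights are at least 3. This leaves
  \<open>(s/n)^(s/2)\<close>, whose sum is of order \<open>1 / sqrt n\<close>; with weight 2 the
  same count would leave nothing.\<close>

definition ind :: "nat set \<Rightarrow> nat \<Rightarrow> bit" where
  "ind A i = (if i \<in> A then 1 else 0)"

lemma inj_ind: "inj ind"
  by (rule injI) (auto simp: ind_def fun_eq_iff split: if_splits)

lemma ind_Collect: "ind {i. v i = 1} = v"
  by (rule ext) (auto simp: ind_def)

lemma cube_eq: "cube n = ind ` Pow {..<n}"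
proof
  show "cube n \<subseteq> ind ` Pow {..<n}"
  proof
    fix v assume "v \<in> cube n"
    then have "{i. v i = 1} \<in> Pow {..<n}"
      by (auto simp: cube_def) (metis leI zero_neq_one)
    then show "v \<in> ind ` Pow {..<n}" by (metis ind_Collect imageI)
  qed
qed (auto simp: cube_def ind_def)

lemma finite_cube: "finite (cube n)"
  by (simp add: cube_eq)

lemma sum_cube: "(\<Sum>v\<in>cube n. f v) = (\<Sum>A\<in>Pow {..<n}. f (ind A))"
  unfolding cube_eq by (subst sum.reindex) (use inj_ind in \<open>auto intro: inj_on_subset\<close>)

lemma Collect_ind: "{i. ind A i = 1} = A"
  by (auto simp: ind_def)

lemma weight_ind: "weight (ind A) = card A"
  by (simp add: weight_def Collect_ind)

lemma card_weight: "card {u \<in> cube n. weight u = k} = n choose k"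
proof -
  have "{u \<in> cube n. weight u = k} = ind ` {A. A \<subseteq> {..<n} \<and> card A = k}"
    by (auto simp: cube_eq weight_ind)
  then show ?thesis
    using n_subsets[of "{..<n}" k] by (simp add: card_image inj_on_subset[OF inj_ind])
qed

lemma bit_add_self: "(a :: nat \<Rightarrow> bit) + a = 0"
  by (rule ext) simp

lemma ind_sum: "finite A \<Longrightarrow> ind A = (\<Sum>i\<in>A. ind {i})"
proof (induction A rule: finite_induct)
  case (insert x F)
  from \<open>x \<notin> F\<close> have "ind (insert x F) = ind {x} + ind F" by (auto simp: ind_def fun_eq_iff)
  with insert show ?case by simp
qed (simp add: ind_def fun_eq_iff)

lemma cube_subset_span: "cube n \<subseteq> F2.span ((\<lambda>i. ind {i}) ` {..<n})"
proof
  fix v assume "v \<in> cube n"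
  then obtain A where A: "A \<subseteq> {..<n}" "v = ind A" by (auto simp: cube_eq)
  then have "finite A" by (auto intro: finite_subset)
  with A(1) show "v \<in> F2.span ((\<lambda>i. ind {i}) ` {..<n})"
    unfolding A(2) ind_sum[OF \<open>finite A\<close>] by (intro F2.span_sum F2.span_base) auto
qed

text \<open>Finiteness of \<open>B\<close> stands in for finite dimension: the ambient space of all
  sequences is infinite-dimensional.\<close>

lemma dim_insert:
  assumes "finite B"
  shows "F2.dim (insert v B) = F2.dim B + (if v \<in> F2.span B then 0 else 1)"
proof -
  obtain b where b: "b \<subseteq> B" "F2.independent b" "B \<subseteq> F2.span b"
    using F2.maximal_independent_subset by metis
  have span: "F2.span b = F2.span B"
    using F2.span_mono[OF b(1)] F2.span_minimal[OF b(3) F2.subspace_span] by blast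
  have dB: "F2.dim B = card b" using F2.dim_eq_card[OF span b(2)] .
  show ?thesis
  proof (cases "v \<in> F2.span B")
    case True
    then have "F2.span (insert v B) = F2.span B" by (rule F2.span_redundant)
    then have "F2.span b = F2.span (insert v B)" using span by simp
    from F2.dim_eq_card[OF this b(2)] dB True show ?thesis by simp
  next
    case False
    then have "v \<notin> F2.span b" "v \<notin> b" using span F2.span_base by auto
    moreover have "F2.independent (insert v b)"
      using F2.independent_insertI[OF _ b(2)] \<open>v \<notin> F2.span b\<close> by blast
    moreover have "F2.span (insert v b) = F2.span (insert v B)"
      by (simp add: F2.span_insert span)
    ultimately show ?thesis
      using F2.dim_eq_card[of "insert v b" "insert v B"] dB False finite_subset[OF b(1) assms] by simp
  qed
qed

lemma dim_image_less:
  assumes "\<And>j. 1 \<le> j \<Longrightarrow> j \<le> m \<Longrightarrow> x j \<notin> F2.span (x ` {1..<j})"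
  shows "F2.dim (x ` {1..m}) = m"
  using assms
proof (induction m)
  case 0
  then show ?case using F2.dim_eq_card[of "{}" "{}"] F2.independent_empty by simp
next
  case (Suc m)
  have e: "x ` {1..Suc m} = insert (x (Suc m)) (x ` {1..m})" by (auto simp: atLeastAtMostSuc_conv)
  have "x (Suc m) \<notin> F2.span (x ` {1..m})"
    using Suc.prems[of "Suc m"] by (simp add: atLeastLessThanSuc_atLeastAtMost)
  then show ?case unfolding e using Suc by (simp add: dim_insert)
qed

lemma dim_le_cube:
  assumes "B \<subseteq> cube n"
  shows "F2.dim B \<le> n"
proof -
  have "F2.dim B \<le> card ((\<lambda>i. ind {i}) ` {..<n})"
    using assms cube_subset_span by (intro F2.dim_le_card) auto
  also have "\<dots> \<le> n" using card_image_le[of "{..<n}" "\<lambda>i. ind {i}"] by simp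
  finally show ?thesis .
qed

text \<open>Otherwise \<open>n + 1\<close> independent vectors would fit into the cube. This is what
  makes the \<open>LEAST\<close> in \<open>first_dependence\<close> attained.\<close>

lemma dependence_exists:
  fixes x :: "nat \<Rightarrow> nat \<Rightarrow> bit"
  assumes "\<And>i. 1 \<le> i \<Longrightarrow> x i \<in> cube n"
  shows "\<exists>m. 1 \<le> m \<and> x m \<in> F2.span (x ` {1..<m})"
proof (rule ccontr)
  assume "\<not> ?thesis"
  then have "F2.dim (x ` {1..Suc n}) = Suc n" by (intro dim_image_less) auto
  moreover have "F2.dim (x ` {1..Suc n}) \<le> n" using assms by (intro dim_le_cube) auto
  ultimately show False by simp
qed

lemma dim_before_first_dependence:
  assumes "m < first_dependence x"
  shows "F2.dim (x ` {1..m}) = m"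
proof (rule dim_image_less)
  fix j assume "1 \<le> j" "j \<le> m"
  then show "x j \<notin> F2.span (x ` {1..<j})"
    using assms not_less_Least[of j "\<lambda>m. 1 \<le> m \<and> x m \<in> F2.span (x ` {1..<m})"]
    unfolding first_dependence_def by auto
qed

text \<open>Over two elements a linear combination is a subset sum, and adding \<open>x l\<close> to
  itself gives zero; so a dependence becomes a vanishing sum over indices, the event counted by the
  first moment.\<close>

lemma vanishing_sum_of_first_dependence:
  assumes x: "\<And>i. 1 \<le> i \<Longrightarrow> x i \<in> cube n" and le: "first_dependence x \<le> m"
  shows "\<exists>S. S \<subseteq> {1..m} \<and> S \<noteq> {} \<and> (\<Sum>i\<in>S. x i) = 0"
proof -
  define l where "l = first_dependence x"
  have l: "1 \<le> l" "x l \<in> F2.span (x ` {1..<l})"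
    using LeastI_ex[OF dependence_exists[of x n]] x unfolding l_def first_dependence_def by auto
  obtain u where u: "x l = (\<Sum>v\<in>x ` {1..<l}. bit_scale (u v) v)"
    using l(2) by (subst (asm) F2.span_finite) auto
  define V where "V = {v \<in> x ` {1..<l}. u v = 1}"
  have "x l = (\<Sum>v\<in>V. v)"
    unfolding u V_def by (intro sum.mono_neutral_cong_right) auto
  \<comment> \<open>The span is generated by a set of vectors, in which equal ones coincide;
    choosing one index per vector turns the sum over vectors into a sum over indices.\<close>
  moreover obtain J where J: "J \<subseteq> {1..<l}" "inj_on x J" "V = x ` J"
    using subset_image_inj[of V x "{1..<l}"] V_def by auto
  ultimately have "x l = (\<Sum>i\<in>J. x i)" by (simp add: sum.reindex)
  moreover have "finite J" "l \<notin> J" using J(1) by (auto intro: finite_subset)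
  ultimately have "(\<Sum>i\<in>insert l J. x i) = 0" by (simp add: bit_add_self)
  then show ?thesis using J(1) l(1) le l_def by (intro exI[of _ "insert l J"]) auto
qed

section \<open>Commuting insertion operators\<close>

text \<open>Expected value of \<open>u\<close> after a lazy random insertion into \<open>B\<close>.
  Iterates give expectations after independent insertions without any probability space; the
  outermost application is the first insertion in time.\<close>

definition mstep :: "real \<Rightarrow> 'v set \<Rightarrow> ('v \<Rightarrow> real) \<Rightarrow> ('v set \<Rightarrow> real) \<Rightarrow> 'v set \<Rightarrow> real" where
  "mstep a C w u B = (1 - a) * u B + a * (\<Sum>v\<in>C. w v * u (insert v B))"

definition prob_weights :: "'v set \<Rightarrow> ('v \<Rightarrow> real) \<Rightarrow> bool" where
  "prob_weights C w \<longleftrightarrow> finite C \<and> (\<forall>v\<in>C. 0 \<le> w v) \<and> sum w C = 1"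

lemma mstep_mono:
  assumes "prob_weights C w" "0 \<le> a" "a \<le> 1" "B \<subseteq> C"
    and "\<And>B. B \<subseteq> C \<Longrightarrow> u B \<le> u' B"
  shows "mstep a C w u B \<le> mstep a C w u' B"
  unfolding mstep_def using assms
  by (intro add_mono mult_left_mono sum_mono) (auto simp: prob_weights_def)

lemma mstep_add_const:
  assumes "prob_weights C w"
  shows "mstep a C w (\<lambda>B. c + u B) B = c + mstep a C w u B"
  using assms
  by (simp add: mstep_def prob_weights_def algebra_simps sum.distrib flip: sum_distrib_left)

text \<open>Both orders average the same values, by \<open>insert_commute\<close> and a swap of
  finite sums. This is why states are sets, which forget the order of insertion.\<close>

lemma mstep_commute: "mstep a C w (mstep b D w' u) B = mstep b D w' (mstep a C w u) B"
proof -
  have s: "(\<Sum>v\<in>C. w v * (\<Sum>v'\<in>D. w' v' * u (insert v' (insert v B)))) =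
      (\<Sum>v'\<in>D. w' v' * (\<Sum>v\<in>C. w v * u (insert v (insert v' B))))"
    unfolding sum_distrib_left by (subst sum.swap) (simp add: mult_ac insert_commute)
  have p: "(\<Sum>v\<in>E. z v * (c * f v + d * g v)) = c * (\<Sum>v\<in>E. z v * f v) + d * (\<Sum>v\<in>E. z v * g v)"
    for c d :: real and E :: "'a set" and z f g :: "'a \<Rightarrow> real"
    unfolding sum_distrib_left sum.distrib[symmetric] by (intro sum.cong) (auto simp: algebra_simps)
  show ?thesis
    unfolding mstep_def p s by (simp only: algebra_simps)
qed

lemma mstep_sum:
  "mstep a C w (\<lambda>B. \<Sum>j\<in>J. b j * u j B) B = (\<Sum>j\<in>J. b j * mstep a C w (u j) B)"
proof -
  have "(\<Sum>v\<in>C. w v * (\<Sum>j\<in>J. b j * u j (insert v B))) =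
      (\<Sum>j\<in>J. b j * (\<Sum>v\<in>C. w v * u j (insert v B)))"
    unfolding sum_distrib_left by (subst sum.swap) (simp add: mult_ac)
  then show ?thesis
    unfolding mstep_def
    by (simp add: sum_distrib_left sum.distrib[symmetric] algebra_simps)
qed

lemma mstep_pow_commute:
  "mstep a C w ((mstep b D w' ^^ N) u) = (mstep b D w' ^^ N) (mstep a C w u)"
proof (induction N)
  case (Suc N)
  have "mstep a C w ((mstep b D w' ^^ Suc N) u) = mstep a C w (mstep b D w' ((mstep b D w' ^^ N) u))"
    by simp
  also have "\<dots> = mstep b D w' (mstep a C w ((mstep b D w' ^^ N) u))"
    by (rule ext) (rule mstep_commute)
  finally show ?case using Suc by simp
qed simp

lemma mstep_pow_mono:
  assumes "prob_weights C w" "0 \<le> a" "a \<le> 1"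
    and "\<And>B. B \<subseteq> C \<Longrightarrow> u B \<le> u' B"
  shows "B \<subseteq> C \<Longrightarrow> (mstep a C w ^^ N) u B \<le> (mstep a C w ^^ N) u' B"
proof (induction N arbitrary: B)
  case (Suc N)
  then show ?case using assms by (auto intro!: mstep_mono)
qed (use assms in auto)

lemma mstep_pow_add_const:
  assumes "prob_weights C w"
  shows "(mstep a C w ^^ N) (\<lambda>B. c + u B) B = c + (mstep a C w ^^ N) u B"
proof (induction N arbitrary: B)
  case (Suc N)
  have "(mstep a C w ^^ N) (\<lambda>B. c + u B) = (\<lambda>B. c + (mstep a C w ^^ N) u B)"
    using Suc by auto
  then show ?case by (simp add: mstep_add_const[OF assms])
qed simp

text \<open>The steps commute, so one step may be exchanged at a time without disturbing the others.\<close>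

lemma mstep_pow_exchange:
  assumes w: "prob_weights C w" "0 \<le> a" "a \<le> 1" and w': "prob_weights D w'" "0 \<le> b" "b \<le> 1"
    and DC: "C \<subseteq> D" "D \<subseteq> C"
    and le: "\<And>B. B \<subseteq> C \<Longrightarrow> mstep a C w u B \<le> c + mstep b D w' u B"
  shows "B \<subseteq> C \<Longrightarrow> (mstep a C w ^^ N) u B \<le> real N * c + (mstep b D w' ^^ N) u B"
proof (induction N arbitrary: B)
  case (Suc N)
  \<comment> \<open>The one-step inequality is known only for \<open>u\<close> itself, not for its
    iterates. So the innermost step, the last in time, is exchanged, and the new step is then
    commuted to the front, leaving another innermost step to exchange.\<close>
  have "(mstep a C w ^^ Suc N) u B = (mstep a C w ^^ N) (mstep a C w u) B"
    by (simp add: funpow_swap1)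
  also have "\<dots> \<le> (mstep a C w ^^ N) (\<lambda>B. c + mstep b D w' u B) B"
    using mstep_pow_mono[OF w, of "mstep a C w u"] le Suc.prems by auto
  also have "\<dots> = c + mstep b D w' ((mstep a C w ^^ N) u) B"
    by (simp add: mstep_pow_add_const[OF w(1)] mstep_pow_commute)
  also have "\<dots> \<le> c + mstep b D w' (\<lambda>B. real N * c + (mstep b D w' ^^ N) u B) B"
    using Suc DC by (intro add_left_mono mstep_mono[OF w']) auto
  also have "\<dots> = real (Suc N) * c + (mstep b D w' ^^ Suc N) u B"
    by (simp add: mstep_add_const[OF w'(1)] algebra_simps)
  finally show ?case .
qed simp

section \<open>Lazy insertions as a binomial mixture of proper ones\<close>

lemma Bernstein_Suc_Suc:
  "Bernstein (Suc N) (Suc j) a = a * Bernstein N j a + (1 - a) * Bernstein N (Suc j) a"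
proof (cases "j < N")
  case True
  then have "N - j = Suc (N - Suc j)" by simp
  then show ?thesis by (simp add: Bernstein_def algebra_simps)
next
  case False
  then show ?thesis by (simp add: Bernstein_def binomial_eq_0)
qed

text \<open>Of \<open>N\<close> lazy insertions, a binomial number takes place; the Bernstein
  polynomials are the binomial probabilities.\<close>

lemma mstep_pow_binomial:
  "(mstep a C w ^^ N) u B = (\<Sum>j\<le>N. Bernstein N j a * (mstep 1 C w ^^ j) u B)"
proof (induction N arbitrary: B)
  case 0
  show ?case by (simp add: Bernstein_def)
next
  case (Suc N)
  let ?F = "\<lambda>j. (mstep 1 C w ^^ j) u B"
  have IH: "(mstep a C w ^^ N) u = (\<lambda>B. \<Sum>j\<le>N. Bernstein N j a * (mstep 1 C w ^^ j) u B)"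
    using Suc by auto
  have one: "mstep a C w f B = (1 - a) * f B + a * mstep 1 C w f B" for f
    by (simp add: mstep_def)
  have z: "Bernstein N (Suc N) a = 0" "Bernstein (Suc N) 0 a = (1 - a) * Bernstein N 0 a"
    by (simp_all add: Bernstein_def)
  have "(mstep a C w ^^ Suc N) u B =
      (1 - a) * (\<Sum>j\<le>N. Bernstein N j a * ?F j) + a * (\<Sum>j\<le>N. Bernstein N j a * ?F (Suc j))"
    unfolding funpow.simps o_def IH by (subst one, subst mstep_sum) simp
  also have "(\<Sum>j\<le>N. Bernstein N j a * ?F j) = (\<Sum>j\<le>Suc N. Bernstein N j a * ?F j)"
    by (simp add: z)
  also have "\<dots> = Bernstein N 0 a * ?F 0 + (\<Sum>j\<le>N. Bernstein N (Suc j) a * ?F (Suc j))"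
    by (rule sum.atMost_Suc_shift)
  finally have *: "(mstep a C w ^^ Suc N) u B = (1 - a) * (Bernstein N 0 a * ?F 0)
      + (\<Sum>j\<le>N. (1 - a) * (Bernstein N (Suc j) a * ?F (Suc j)))
      + (\<Sum>j\<le>N. a * (Bernstein N j a * ?F (Suc j)))"
    by (simp only: distrib_left sum_distrib_left)
  have "(\<Sum>j\<le>Suc N. Bernstein (Suc N) j a * ?F j) =
      Bernstein (Suc N) 0 a * ?F 0 + (\<Sum>j\<le>N. Bernstein (Suc N) (Suc j) a * ?F (Suc j))"
    by (rule sum.atMost_Suc_shift)
  also have "\<dots> = (mstep a C w ^^ Suc N) u B"
    unfolding * z Bernstein_Suc_Suc by (simp add: sum.distrib[symmetric] algebra_simps)
  finally show ?case ..
qed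

lemma lipschitz_bounds:
  fixes f :: "nat \<Rightarrow> real"
  assumes "\<And>j. f j \<le> f (Suc j)" "\<And>j. f (Suc j) \<le> f j + 1"
  shows "f m \<le> f j + \<bar>real m - real j\<bar>"
proof (cases "m \<le> j")
  case True
  then have "f m \<le> f j" using lift_Suc_mono_le[of f] assms(1) by blast
  then show ?thesis by simp
next
  case False
  have "f (j + d) \<le> f j + real d" for d
  proof (induction d)
    case (Suc d)
    then show ?case using assms(2)[of "j + d"] by simp
  qed simp
  from this[of "m - j"] False show ?thesis by simp
qed

lemma sum_Bernstein_variance:
  "(\<Sum>j\<le>N. (real N * x - real j)\<^sup>2 * Bernstein N j x) = real N * x * (1 - x)"
proof -
  have "(\<Sum>j\<le>N. (real N * x - real j)\<^sup>2 * Bernstein N j x) =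
     (\<Sum>j\<le>N. (real N * x)\<^sup>2 * Bernstein N j x - (2 * real N * x - 1) * (real j * Bernstein N j x)
        + real j * (real j - 1) * Bernstein N j x)"
    by (intro sum.cong) (auto simp: power2_eq_square algebra_simps)
  also have "\<dots> = (real N * x)\<^sup>2 - (2 * real N * x - 1) * (real N * x) + real N * (real N - 1) * x\<^sup>2"
    unfolding sum.distrib sum_subtractf sum_distrib_left[symmetric] by simp
  also have "\<dots> = real N * x * (1 - x)" by (simp add: power2_eq_square algebra_simps)
  finally show ?thesis .
qed

text \<open>The only properties of the rank that the laziness and variance estimates use.\<close>

definition unit_increments :: "'v set \<Rightarrow> ('v set \<Rightarrow> real) \<Rightarrow> bool" where
  "unit_increments C u \<longleftrightarrow> (\<forall>B v. B \<subseteq> C \<longrightarrow> v \<in> C \<longrightarrow> u B \<le> u (insert v B) \<and> u (insert v B) \<le> u B + 1)"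

lemma unit_increments_mstep:
  assumes "prob_weights C w" "unit_increments C u"
  shows "unit_increments C (mstep 1 C w u)"
  unfolding unit_increments_def
proof (intro allI impI)
  fix B v assume B: "B \<subseteq> C" "v \<in> C"
  have m: "u (insert x B) \<le> u (insert x (insert v B)) \<and> u (insert x (insert v B)) \<le> u (insert x B) + 1"
    if "x \<in> C" for x
    using assms(2) B that unfolding unit_increments_def
    by (metis insert_commute insert_subset)
  have "(\<Sum>x\<in>C. w x * u (insert x (insert v B))) \<le> (\<Sum>x\<in>C. w x * (u (insert x B) + 1))"
    using m assms(1) by (intro sum_mono mult_left_mono) (auto simp: prob_weights_def)
  also have "\<dots> = (\<Sum>x\<in>C. w x * u (insert x B)) + 1"
    using assms(1) by (simp add: algebra_simps sum.distrib prob_weights_def)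
  finally show "mstep 1 C w u B \<le> mstep 1 C w u (insert v B) \<and>
      mstep 1 C w u (insert v B) \<le> mstep 1 C w u B + 1"
    using m assms(1) unfolding mstep_def
    by (auto intro!: sum_mono mult_left_mono simp: prob_weights_def)
qed

lemma unit_increments_mstep_pow:
  assumes "prob_weights C w" "unit_increments C u"
  shows "unit_increments C ((mstep 1 C w ^^ j) u)"
  by (induction j) (use assms unit_increments_mstep in auto)

lemma mstep_bounds:
  assumes "prob_weights C w" "unit_increments C u" "B \<subseteq> C"
  shows "u B \<le> mstep 1 C w u B" "mstep 1 C w u B \<le> u B + 1"
proof -
  have m: "u B \<le> u (insert x B) \<and> u (insert x B) \<le> u B + 1" if "x \<in> C" for x
    using assms(2,3) that unfolding unit_increments_def by blast
  have "(\<Sum>x\<in>C. w x * u B) \<le> (\<Sum>x\<in>C. w x * u (insert x B))"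
    using m assms(1) by (intro sum_mono mult_left_mono) (auto simp: prob_weights_def)
  then show "u B \<le> mstep 1 C w u B"
    using assms(1) by (simp add: mstep_def prob_weights_def flip: sum_distrib_right)
  have "(\<Sum>x\<in>C. w x * u (insert x B)) \<le> (\<Sum>x\<in>C. w x * (u B + 1))"
    using m assms(1) by (intro sum_mono mult_left_mono) (auto simp: prob_weights_def)
  then show "mstep 1 C w u B \<le> u B + 1"
    using assms(1) by (simp add: mstep_def prob_weights_def flip: sum_distrib_right)
qed

text \<open>The number of insertions that take place is binomial with mean \<open>m\<close>. As a
  function of that number the expectation is 1-Lipschitz, so the loss is at most the mean deviation,
  hence at most the standard deviation.\<close>

lemma mstep_pow_le_lazy:
  assumes w: "prob_weights C w" and u: "unit_increments C u" and B: "B \<subseteq> C"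
    and a: "0 \<le> a" "a \<le> 1" and m: "real N * a = real m"
  shows "(mstep 1 C w ^^ m) u B \<le> (mstep a C w ^^ N) u B + sqrt (real m)"
proof (cases "m = 0")
  case True
  have "mstep 0 C w = id" by (intro ext) (simp add: mstep_def)
  then have "(mstep a C w ^^ N) u B = u B" using True m by (cases "N = 0") auto
  then show ?thesis using True by simp
next
  case False
  define f where "f j = (mstep 1 C w ^^ j) u B" for j
  have f: "f j \<le> f (Suc j)" "f (Suc j) \<le> f j + 1" for j
    using mstep_bounds[OF w unit_increments_mstep_pow[OF w u] B] by (auto simp: f_def)
  define s where "s = sqrt (real m)"
  have s: "s > 0" "s * s = real m" using False by (auto simp: s_def)
  \<comment> \<open>For \<open>y = \<bar>real m - real j\<bar>\<close> this choice turns
    \<open>0 \<le> c * (y - s)^2\<close> into \<open>y \<le> c * y^2 + s / 2\<close>, which replaces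
    Cauchy-Schwarz: its binomial mean is at most \<open>s\<close>.\<close>
  define c where "c = 1 / (2 * s)"
  have c: "c * (s * s) = s / 2" "c > 0" using s(1) by (simp_all add: c_def)
  have b: "f m \<le> f j + (c * (real m - real j)\<^sup>2 + s / 2)" for j
  proof -
    define y where "y = \<bar>real m - real j\<bar>"
    have "0 \<le> c * (y - s)\<^sup>2" using c by simp
    also have "\<dots> = c * y\<^sup>2 - (2 * s * c) * y + c * (s * s)" by (simp add: power2_eq_square algebra_simps)
    also have "2 * s * c = 1" using s(1) by (simp add: c_def)
    finally have "y \<le> c * y\<^sup>2 + s / 2" using c by simp
    moreover have "y\<^sup>2 = (real m - real j)\<^sup>2" by (simp add: y_def)
    moreover have "f m \<le> f j + y" using lipschitz_bounds[of f m j, OF f] by (simp add: y_def)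
    ultimately show ?thesis by simp
  qed
  let ?b = "\<lambda>j. Bernstein N j a"
  have 1: "f m = (\<Sum>j\<le>N. ?b j * f m)" by (simp flip: sum_distrib_right)
  have 2: "(\<Sum>j\<le>N. ?b j * f m) \<le> (\<Sum>j\<le>N. ?b j * (f j + (c * (real m - real j)\<^sup>2 + s / 2)))"
    using b a by (intro sum_mono mult_left_mono Bernstein_nonneg) auto
  have 3: "x * (y + (c * z + s / 2)) = x * y + (c * (z * x) + s / 2 * x)" for x y z
    by (simp only: algebra_simps)
  have 4: "(\<Sum>j\<le>N. (real m - real j)\<^sup>2 * ?b j) = s * s * (1 - a)"
    using sum_Bernstein_variance[of N a] unfolding m s(2) .
  have 5: "(\<Sum>j\<le>N. ?b j * f j) = (mstep a C w ^^ N) u B"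
    by (subst mstep_pow_binomial) (simp add: f_def)
  have "f m \<le> (mstep a C w ^^ N) u B + (c * (s * s * (1 - a)) + s / 2 * 1)"
    using 1 2 unfolding 3 sum.distrib sum_distrib_left[symmetric] 4 5 sum_Bernstein by linarith
  moreover have "s * (1 - a) \<le> s * 1" using s(1) a by (intro mult_left_mono) auto
  moreover have "c * (s * s * (1 - a)) = s * (1 - a) / 2"
    using c(1) by (metis mult.assoc times_divide_eq_left)
  ultimately show ?thesis unfolding f_def[symmetric] s_def[symmetric] by linarith
qed

text \<open>Law of total variance with respect to the first insertion: the remaining ones contribute
  at most \<open>m\<close> by induction, and the conditional mean given the first lies in an
  interval of length 1, so its variance is at most 1.\<close>

lemma mstep_variance:
  assumes w: "prob_weights C w" and u: "unit_increments C u"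
  shows "B \<subseteq> C \<Longrightarrow>
    (mstep 1 C w ^^ m) (\<lambda>B. (u B)\<^sup>2) B \<le> ((mstep 1 C w ^^ m) u B)\<^sup>2 + real m"
proof (induction m arbitrary: B)
  case (Suc m)
  let ?g = "(mstep 1 C w ^^ m) u"
  have g: "unit_increments C ?g" by (rule unit_increments_mstep_pow[OF w u])
  have 1: "(mstep 1 C w ^^ Suc m) (\<lambda>B. (u B)\<^sup>2) B \<le> mstep 1 C w (\<lambda>B. real m + (?g B)\<^sup>2) B"
    unfolding funpow.simps o_def using Suc by (intro mstep_mono[OF w]) (simp_all add: add.commute)
  have 2: "mstep 1 C w (\<lambda>B. real m + (?g B)\<^sup>2) B = real m + mstep 1 C w (\<lambda>B. (?g B)\<^sup>2) B"
    by (rule mstep_add_const[OF w])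
  have 3: "mstep 1 C w (\<lambda>B. (?g B)\<^sup>2) B \<le> (mstep 1 C w ?g B)\<^sup>2 + 1"
  proof -
    define \<mu> where "\<mu> = mstep 1 C w ?g B"
    have mu: "?g B \<le> \<mu>" "\<mu> \<le> ?g B + 1"
      using mstep_bounds[OF w g Suc.prems] by (auto simp: \<mu>_def)
    have W: "\<forall>v\<in>C. 0 \<le> w v" "sum w C = 1" using w by (auto simp: prob_weights_def)
    have mu_eq: "(\<Sum>v\<in>C. w v * ?g (insert v B)) = \<mu>" by (simp add: \<mu>_def mstep_def)
    have "(\<Sum>v\<in>C. w v * (?g (insert v B) - \<mu>)\<^sup>2) \<le> (\<Sum>v\<in>C. w v * 1)"
    proof (intro sum_mono mult_left_mono)
      fix v assume "v \<in> C"
      then have "?g B \<le> ?g (insert v B)" "?g (insert v B) \<le> ?g B + 1"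
        using g Suc.prems unfolding unit_increments_def by blast+
      then have "\<bar>?g (insert v B) - \<mu>\<bar> \<le> 1" using mu by linarith
      then show "(?g (insert v B) - \<mu>)\<^sup>2 \<le> 1" by (simp add: abs_square_le_1)
    qed (use W in auto)
    also have "\<dots> = 1" using W by simp
    finally have "(\<Sum>v\<in>C. w v * (?g (insert v B) - \<mu>)\<^sup>2) \<le> 1" .
    moreover have "(\<Sum>v\<in>C. w v * (?g (insert v B) - \<mu>)\<^sup>2) =
        (\<Sum>v\<in>C. w v * (?g (insert v B))\<^sup>2 - 2 * \<mu> * (w v * ?g (insert v B)) + \<mu>\<^sup>2 * w v)"
      by (intro sum.cong) (auto simp: power2_eq_square algebra_simps)
    moreover have "\<dots> = (\<Sum>v\<in>C. w v * (?g (insert v B))\<^sup>2) - \<mu>\<^sup>2"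
      unfolding sum.distrib sum_subtractf sum_distrib_left[symmetric] mu_eq W(2)
      by (simp add: power2_eq_square)
    ultimately have "(\<Sum>v\<in>C. w v * (?g (insert v B))\<^sup>2) \<le> \<mu>\<^sup>2 + 1" by linarith
    moreover have "mstep 1 C w (\<lambda>B. (?g B)\<^sup>2) B = (\<Sum>v\<in>C. w v * (?g (insert v B))\<^sup>2)"
      by (simp add: mstep_def)
    ultimately show ?thesis unfolding \<mu>_def[symmetric] by simp
  qed
  show ?case using 1 3 unfolding 2 by simp
qed simp

section \<open>Sampling vectors of random weight\<close>

definition ksets :: "nat \<Rightarrow> nat \<Rightarrow> nat set set" where
  "ksets n k = {A. A \<subseteq> {..<n} \<and> card A = k}"

lemma finite_ksets: "finite (ksets n k)"
  by (rule finite_subset[of _ "Pow {..<n}"]) (auto simp: ksets_def)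

lemma card_ksets: "card (ksets n k) = n choose k"
  unfolding ksets_def using n_subsets[of "{..<n}" k] by simp

text \<open>The elementary symmetric polynomial of degree \<open>k\<close>; divided by
  \<open>n choose k\<close> it is the mean of the product of \<sigma> over a uniform
  \<open>k\<close>-subset.\<close>

definition esum :: "nat \<Rightarrow> nat \<Rightarrow> (nat \<Rightarrow> real) \<Rightarrow> real" where
  "esum n k \<sigma> = (\<Sum>A\<in>ksets n k. \<Prod>i\<in>A. \<sigma> i)"

lemma abs_prod_le_1:
  fixes \<sigma> :: "nat \<Rightarrow> real"
  assumes "\<And>i. i \<in> A \<Longrightarrow> \<bar>\<sigma> i\<bar> \<le> 1"
  shows "\<bar>\<Prod>i\<in>A. \<sigma> i\<bar> \<le> 1"
  unfolding abs_prod by (rule prod_le_1) (use assms in auto)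

lemma abs_esum_le:
  assumes "\<And>i. i < n \<Longrightarrow> \<bar>\<sigma> i\<bar> \<le> 1"
  shows "\<bar>esum n k \<sigma>\<bar> \<le> real (n choose k)"
proof -
  have "\<bar>esum n k \<sigma>\<bar> \<le> (\<Sum>A\<in>ksets n k. \<bar>\<Prod>i\<in>A. \<sigma> i\<bar>)" unfolding esum_def by (rule sum_abs)
  also have "\<dots> \<le> (\<Sum>A\<in>ksets n k. 1)"
    using assms by (intro sum_mono abs_prod_le_1) (auto simp: ksets_def)
  finally show ?thesis by (simp add: card_ksets)
qed

text \<open>Expand the product over pairs of a point \<open>i\<close> and a \<open>k\<close>-set
  \<open>A\<close>. The pairs with \<open>i\<close> outside \<open>A\<close> give each
  \<open>(k+1)\<close>-set \<open>k + 1\<close> times; those with \<open>i\<close> in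
  \<open>A\<close> are the error, at most \<open>k\<close> for each \<open>A\<close>.\<close>

lemma esum_Suc:
  assumes "\<And>i. i < n \<Longrightarrow> \<bar>\<sigma> i\<bar> \<le> 1"
  shows "\<bar>(\<Sum>i<n. \<sigma> i) * esum n k \<sigma> - real (Suc k) * esum n (Suc k) \<sigma>\<bar> \<le> real k * real (n choose k)"
proof -
  have finA: "finite A" if "A \<in> ksets n j" for A j
    using that by (auto simp: ksets_def intro: finite_subset)
  have 1: "(\<Sum>A\<in>ksets n k. \<Sum>i\<in>{..<n} - A. \<sigma> i * (\<Prod>j\<in>A. \<sigma> j)) = real (Suc k) * esum n (Suc k) \<sigma>"
  proof -
    have "(\<Sum>A\<in>ksets n k. \<Sum>i\<in>{..<n} - A. \<sigma> i * (\<Prod>j\<in>A. \<sigma> j)) =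
        (\<Sum>(A, i)\<in>(SIGMA A:ksets n k. {..<n} - A). \<sigma> i * (\<Prod>j\<in>A. \<sigma> j))"
      by (rule sum.Sigma) (auto simp: finite_ksets)
    also have "\<dots> = (\<Sum>(B, i)\<in>(SIGMA B:ksets n (Suc k). B). \<Prod>j\<in>B. \<sigma> j)"
    proof (rule sum.reindex_bij_witness[where i = "\<lambda>(B, i). (B - {i}, i)" and j = "\<lambda>(A, i). (insert i A, i)"], goal_cases)
      case (2 a)
      then obtain A i where a: "a = (A, i)" "A \<in> ksets n k" "i < n" "i \<notin> A" by auto
      from finA[OF a(2)] a show ?case by (auto simp: ksets_def)
    next
      case (4 b)
      then obtain B i where b: "b = (B, i)" "B \<in> ksets n (Suc k)" "i \<in> B" by auto
      from finA[OF b(2)] b show ?case by (auto simp: ksets_def)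
    next
      case (5 a)
      then obtain A i where a: "a = (A, i)" "A \<in> ksets n k" "i \<notin> A" by auto
      from finA[OF a(2)] a show ?case by simp
    qed (auto simp: insert_absorb)
    also have "\<dots> = (\<Sum>B\<in>ksets n (Suc k). \<Sum>i\<in>B. \<Prod>j\<in>B. \<sigma> j)"
      using finA[of _ "Suc k"] by (intro sum.Sigma[symmetric]) (auto simp: finite_ksets)
    also have "\<dots> = real (Suc k) * esum n (Suc k) \<sigma>"
      unfolding esum_def sum_distrib_left by (intro sum.cong) (auto simp: ksets_def)
    finally show ?thesis .
  qed
  have "(\<Sum>i<n. \<sigma> i) * esum n k \<sigma> = (\<Sum>A\<in>ksets n k. \<Sum>i<n. \<sigma> i * (\<Prod>j\<in>A. \<sigma> j))"
    unfolding esum_def by (simp add: sum_distrib_left sum_distrib_right sum.swap[of _ "{..<n}"])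
  also have "\<dots> = (\<Sum>A\<in>ksets n k. (\<Sum>i\<in>{..<n} - A. \<sigma> i * (\<Prod>j\<in>A. \<sigma> j)) + (\<Sum>i\<in>A. \<sigma> i * (\<Prod>j\<in>A. \<sigma> j)))"
    by (intro sum.cong refl sum.subset_diff) (auto simp: ksets_def)
  also have "\<dots> = real (Suc k) * esum n (Suc k) \<sigma> + (\<Sum>A\<in>ksets n k. \<Sum>i\<in>A. \<sigma> i * (\<Prod>j\<in>A. \<sigma> j))"
    by (simp add: sum.distrib 1)
  finally have 2: "(\<Sum>i<n. \<sigma> i) * esum n k \<sigma> - real (Suc k) * esum n (Suc k) \<sigma> =
      (\<Sum>A\<in>ksets n k. \<Sum>i\<in>A. \<sigma> i * (\<Prod>j\<in>A. \<sigma> j))" by simp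
  have "\<bar>\<Sum>i\<in>A. \<sigma> i * (\<Prod>j\<in>A. \<sigma> j)\<bar> \<le> real k" if A: "A \<in> ksets n k" for A
  proof -
    have "\<bar>\<Sum>i\<in>A. \<sigma> i * (\<Prod>j\<in>A. \<sigma> j)\<bar> \<le> (\<Sum>i\<in>A. \<bar>\<sigma> i * (\<Prod>j\<in>A. \<sigma> j)\<bar>)" by (rule sum_abs)
    also have "\<dots> \<le> (\<Sum>i\<in>A. 1 * 1)"
      unfolding abs_mult using A assms
      by (intro sum_mono mult_mono abs_prod_le_1) (auto simp: ksets_def)
    also have "\<dots> = real k" using A by (simp add: ksets_def)
    finally show ?thesis .
  qed
  then have "(\<Sum>A\<in>ksets n k. \<bar>\<Sum>i\<in>A. \<sigma> i * (\<Prod>j\<in>A. \<sigma> j)\<bar>) \<le> (\<Sum>A\<in>ksets n k. real k)"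
    by (intro sum_mono)
  then have "(\<Sum>A\<in>ksets n k. \<bar>\<Sum>i\<in>A. \<sigma> i * (\<Prod>j\<in>A. \<sigma> j)\<bar>) \<le> real k * real (n choose k)"
    by (simp add: card_ksets mult.commute)
  then show ?thesis unfolding 2 by (rule order_trans[OF sum_abs])
qed

text \<open>Sampling without replacement is close to sampling with replacement.\<close>

lemma esum_approx:
  assumes \<sigma>: "\<And>i. i < n \<Longrightarrow> \<bar>\<sigma> i\<bar> \<le> 1" and n: "0 < n"
  shows "k \<le> n \<Longrightarrow> \<bar>esum n k \<sigma> / real (n choose k) - ((\<Sum>i<n. \<sigma> i) / n) ^ k\<bar> \<le> (real k)\<^sup>2 / n"
proof (induction k)
  case 0
  have "ksets n 0 = {{}}" by (auto simp: ksets_def dest!: finite_subset[OF _ finite_lessThan])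
  then show ?case by (simp add: esum_def)
next
  case (Suc k)
  define \<kappa> where "\<kappa> k = esum n k \<sigma> / real (n choose k)" for k
  define u where "u = (\<Sum>i<n. \<sigma> i) / n"
  have pos: "real (n choose k) > 0" "real (n choose Suc k) > 0" using Suc.prems by (auto simp: zero_less_binomial)
  have "\<bar>\<Sum>i<n. \<sigma> i\<bar> \<le> (\<Sum>i<n. 1)" using \<sigma> by (intro order_trans[OF sum_abs] sum_mono) auto
  then have u: "\<bar>u\<bar> \<le> 1" using n by (simp add: u_def)
  have \<kappa>1: "\<bar>\<kappa> (Suc k)\<bar> \<le> 1"
    using abs_esum_le[of n \<sigma> "Suc k"] \<sigma> pos(2) by (simp add: \<kappa>_def)
  have e: "esum n j \<sigma> = \<kappa> j * real (n choose j)" if "j \<le> n" for j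
    using that by (simp add: \<kappa>_def binomial_eq_0_iff)
  have ch: "real (Suc k) * real (n choose Suc k) = real (n choose k) * (real n - real k)"
  proof -
    have "Suc k * (n choose Suc k) = (n choose k) * (n - k)"
      by (simp only: binomial_absorption binomial_absorb_comp mult.commute[of _ "n - k"])
    then have "real (Suc k * (n choose Suc k)) = real ((n choose k) * (n - k))" by presburger
    then show ?thesis using Suc.prems unfolding of_nat_mult by (simp only: of_nat_diff)
  qed
  have "(\<Sum>i<n. \<sigma> i) * esum n k \<sigma> - real (Suc k) * esum n (Suc k) \<sigma> =
      real n * u * (\<kappa> k * real (n choose k)) - \<kappa> (Suc k) * (real (Suc k) * real (n choose Suc k))"
    using n Suc.prems by (simp add: e u_def)
  also have "\<dots> = real (n choose k) * (real n * (u * \<kappa> k - \<kappa> (Suc k)) + real k * \<kappa> (Suc k))"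
    unfolding ch by (simp add: algebra_simps)
  finally have "real (n choose k) * \<bar>real n * (u * \<kappa> k - \<kappa> (Suc k)) + real k * \<kappa> (Suc k)\<bar> \<le> real k * real (n choose k)"
    using esum_Suc[of n \<sigma> k] \<sigma> by (simp add: abs_mult)
  then have "\<bar>real n * (u * \<kappa> k - \<kappa> (Suc k)) + real k * \<kappa> (Suc k)\<bar> \<le> real k"
    using pos(1) by (metis mult.commute mult_le_cancel_left_pos)
  moreover have "\<bar>real k * \<kappa> (Suc k)\<bar> \<le> real k"
    using \<kappa>1 mult_left_mono[of "\<bar>\<kappa> (Suc k)\<bar>" 1 "real k"] by (simp add: abs_mult)
  ultimately have "\<bar>real n * (u * \<kappa> k - \<kappa> (Suc k))\<bar> \<le> 2 * real k" by linarith
  then have 1: "real n * \<bar>\<kappa> (Suc k) - u * \<kappa> k\<bar> \<le> 2 * real k" by (simp add: abs_mult abs_minus_commute)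
  have "\<bar>u * \<kappa> k - u * u ^ k\<bar> \<le> 1 * ((real k)\<^sup>2 / n)"
    using Suc u unfolding right_diff_distrib[symmetric] abs_mult \<kappa>_def u_def
    by (intro mult_mono) auto
  then have "real n * \<bar>u * \<kappa> k - u * u ^ k\<bar> \<le> (real k)\<^sup>2" using n by (simp add: field_simps)
  \<comment> \<open>Replacing \<kappa> at \<open>Suc k\<close> by \<open>u\<close> times \<kappa> at
    \<open>k\<close> costs \<open>2k/n\<close>, and the induction hypothesis \<open>k^2/n\<close>;
    since \<open>2k + k^2 \<le> (k+1)^2\<close>, the bound propagates.\<close>
  with 1 have "real n * \<bar>\<kappa> (Suc k) - u * \<kappa> k\<bar> + real n * \<bar>u * \<kappa> k - u * u ^ k\<bar> \<le> (real (Suc k))\<^sup>2"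
    by (simp add: power2_eq_square algebra_simps)
  moreover have "real n * \<bar>\<kappa> (Suc k) - u * u ^ k\<bar> \<le> real n * \<bar>\<kappa> (Suc k) - u * \<kappa> k\<bar> + real n * \<bar>u * \<kappa> k - u * u ^ k\<bar>"
    unfolding distrib_left[symmetric] by (intro mult_left_mono) auto
  ultimately have "real n * \<bar>\<kappa> (Suc k) - u * u ^ k\<bar> \<le> (real (Suc k))\<^sup>2" by linarith
  then have "\<bar>\<kappa> (Suc k) - u * u ^ k\<bar> \<le> (real (Suc k))\<^sup>2 / real n"
    using n by (simp add: pos_le_divide_eq mult.commute)
  then show ?case unfolding \<kappa>_def u_def power_Suc .
qed

definition law :: "nat \<Rightarrow> (nat \<Rightarrow> real) \<Rightarrow> (nat \<Rightarrow> bit) \<Rightarrow> real" where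
  "law n p v = p (weight v) / real (n choose weight v)"

definition weight_probs :: "nat \<Rightarrow> (nat \<Rightarrow> real) \<Rightarrow> bool" where
  "weight_probs r p \<longleftrightarrow> (\<forall>k. 0 \<le> p k) \<and> (\<forall>k>r. p k = 0) \<and> (\<Sum>k\<le>r. p k) = 1"

definition gen :: "nat \<Rightarrow> (nat \<Rightarrow> real) \<Rightarrow> real \<Rightarrow> real" where
  "gen r p s = (\<Sum>k\<le>r. p k * s ^ k)"

lemma sum_law:
  assumes "weight_probs r p" "r \<le> n"
  shows "(\<Sum>v\<in>cube n. law n p v * f v) =
    (\<Sum>k\<le>r. p k * ((\<Sum>A\<in>ksets n k. f (ind A)) / real (n choose k)))"
proof -
  have "(\<Sum>v\<in>cube n. law n p v * f v) = (\<Sum>A\<in>Pow {..<n}. law n p (ind A) * f (ind A))"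
    using sum_cube[of "\<lambda>v. law n p v * f v" n] .
  also have "\<dots> = (\<Sum>k\<le>n. \<Sum>A\<in>{A \<in> Pow {..<n}. card A = k}. law n p (ind A) * f (ind A))"
  proof (rule sum.group[symmetric])
    show "card ` Pow {..<n} \<subseteq> {..n}"
      using card_mono[of "{..<n}"] by auto
  qed auto
  also have "\<dots> = (\<Sum>k\<le>n. p k * ((\<Sum>A\<in>ksets n k. f (ind A)) / real (n choose k)))"
    unfolding sum_divide_distrib sum_distrib_left
    by (intro sum.cong) (auto simp: ksets_def law_def weight_ind)
  also have "\<dots> = (\<Sum>k\<le>r. p k * ((\<Sum>A\<in>ksets n k. f (ind A)) / real (n choose k)))"
    using assms by (intro sum.mono_neutral_right) (auto simp: weight_probs_def)
  finally show ?thesis .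
qed

lemma prob_weights_law:
  assumes "weight_probs r p" "r \<le> n"
  shows "prob_weights (cube n) (law n p)"
proof -
  have "(\<Sum>v\<in>cube n. law n p v) = (\<Sum>k\<le>r. p k * 1)"
    using sum_law[OF assms, of "\<lambda>_. 1"] assms(2)
    by (simp add: card_ksets binomial_eq_0_iff cong: sum.cong_simp)
  then show ?thesis
    using assms by (auto simp: prob_weights_def finite_cube law_def weight_probs_def)
qed

text \<open>Serves both bounds: with \<sigma> the indicator of the unit vectors in a span it
  estimates the chance of falling into that span, with signs \<sigma> it estimates the characters of
  the law.\<close>

lemma law_prod_approx:
  assumes p: "weight_probs r p" and n: "r \<le> n" "0 < n" and \<sigma>: "\<And>i. i < n \<Longrightarrow> \<bar>\<sigma> i\<bar> \<le> 1"
  shows "\<bar>(\<Sum>v\<in>cube n. law n p v * (\<Prod>i\<in>{i. v i = 1}. \<sigma> i)) - gen r p ((\<Sum>i<n. \<sigma> i) / n)\<bar> \<le> (real r)\<^sup>2 / n"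
proof -
  let ?u = "(\<Sum>i<n. \<sigma> i) / n"
  have "(\<Sum>v\<in>cube n. law n p v * (\<Prod>i\<in>{i. v i = 1}. \<sigma> i)) - gen r p ?u =
      (\<Sum>k\<le>r. p k * (esum n k \<sigma> / real (n choose k) - ?u ^ k))"
    unfolding sum_law[OF p n(1)] gen_def Collect_ind esum_def
    by (simp add: algebra_simps sum_subtractf)
  also have "\<bar>\<dots>\<bar> \<le> (\<Sum>k\<le>r. p k * ((real r)\<^sup>2 / n))"
  proof (intro order_trans[OF sum_abs] sum_mono)
    fix k assume "k \<in> {..r}"
    then have k: "k \<le> r" by simp
    have "\<bar>esum n k \<sigma> / real (n choose k) - ?u ^ k\<bar> \<le> (real k)\<^sup>2 / n"
      using esum_approx[where k = k, OF \<sigma> n(2)] k n(1) by simp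
    also have "\<dots> \<le> (real r)\<^sup>2 / n" using k by (intro divide_right_mono power_mono) auto
    finally show "\<bar>p k * (esum n k \<sigma> / real (n choose k) - ?u ^ k)\<bar> \<le> p k * ((real r)\<^sup>2 / n)"
      using p unfolding abs_mult weight_probs_def by (simp only: abs_of_nonneg mult_left_mono)
  qed
  also have "\<dots> = (real r)\<^sup>2 / n"
    using p unfolding sum_distrib_right[symmetric] by (simp add: weight_probs_def)
  finally show ?thesis .
qed

lemma gen_diff_le:
  assumes "\<bar>s\<bar> \<le> 1"
  shows "\<bar>gen r p s - gen r q s\<bar> \<le> (\<Sum>k\<le>r. \<bar>p k - q k\<bar>)"
proof -
  have "gen r p s - gen r q s = (\<Sum>k\<le>r. (p k - q k) * s ^ k)"
    unfolding gen_def by (simp add: algebra_simps sum_subtractf)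
  also have "\<bar>\<dots>\<bar> \<le> (\<Sum>k\<le>r. \<bar>p k - q k\<bar> * 1)"
    using assms by (intro order_trans[OF sum_abs] sum_mono)
      (auto simp: abs_mult power_abs intro!: mult_left_le power_le_one)
  finally show ?thesis by simp
qed

section \<open>The expected rank\<close>

lemma support_subset: "v \<in> cube n \<Longrightarrow> {i. v i = 1} \<subseteq> {..<n}"
  by (auto simp: cube_def not_le[symmetric])

definition rk :: "(nat \<Rightarrow> bit) set \<Rightarrow> real" where
  "rk B = real (F2.dim B)"

lemma rk_insert: "B \<subseteq> cube n \<Longrightarrow> rk (insert v B) = rk B + (if v \<in> F2.span B then 0 else 1)"
  using dim_insert[of B v] finite_subset[OF _ finite_cube] by (auto simp: rk_def)

lemma unit_increments_rk: "unit_increments (cube n) rk"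
  by (auto simp: unit_increments_def rk_insert)

definition frozen :: "nat \<Rightarrow> (nat \<Rightarrow> bit) set \<Rightarrow> real" where
  "frozen n B = real (card {i. i < n \<and> ind {i} \<in> F2.span B}) / n"

lemma frozen_bounds: "0 \<le> frozen n B" "frozen n B \<le> 1"
proof -
  have "card {i. i < n \<and> ind {i} \<in> F2.span B} \<le> card {..<n}" by (intro card_mono) auto
  then show "frozen n B \<le> 1" by (cases "n = 0") (auto simp: frozen_def)
qed (simp add: frozen_def)

text \<open>A vector is a sum of the unit vectors of its support, so it lies in the span as soon as
  all of them do. This sufficient condition, of probability about
  \<open>gen r p (frozen n B)\<close>, is all that is used.\<close>

lemma mstep_rk_le:
  assumes p: "weight_probs r p" and n: "r \<le> n" "0 < n" and B: "B \<subseteq> cube n" and a: "0 \<le> a"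
  shows "mstep a (cube n) (law n p) rk B \<le> rk B + a * (1 - gen r p (frozen n B) + (real r)\<^sup>2 / n)"
proof -
  define \<sigma> where "\<sigma> i = (if ind {i} \<in> F2.span B then 1 else 0 :: real)" for i
  have pw: "prob_weights (cube n) (law n p)" by (rule prob_weights_law[OF p n(1)])
  have s: "(\<Sum>i<n. \<sigma> i) / n = frozen n B"
    by (auto simp: frozen_def \<sigma>_def sum.If_cases Int_def)
  have "(\<Sum>v\<in>cube n. law n p v * rk (insert v B)) \<le>
      (\<Sum>v\<in>cube n. law n p v * (rk B + 1 - (\<Prod>i\<in>{i. v i = 1}. \<sigma> i)))"
  proof (intro sum_mono mult_left_mono)
    fix v assume v: "v \<in> cube n"
    have fin: "finite {i. v i = 1}"
      using support_subset[OF v] by (rule finite_subset) simp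
    show "rk (insert v B) \<le> rk B + 1 - (\<Prod>i\<in>{i. v i = 1}. \<sigma> i)"
    proof (cases "\<forall>i\<in>{i. v i = 1}. \<sigma> i = 1")
      case True
      then have "\<forall>i\<in>{i. v i = 1}. ind {i} \<in> F2.span B" by (auto simp: \<sigma>_def split: if_splits)
      then have "(\<Sum>i\<in>{i. v i = 1}. ind {i}) \<in> F2.span B" by (intro F2.span_sum) auto
      then have "v \<in> F2.span B" unfolding ind_sum[OF fin, symmetric] ind_Collect .
      then show ?thesis using True by (simp add: rk_insert[OF B])
    next
      case False
      then obtain i where "v i = 1" "\<sigma> i \<noteq> 1" by auto
      then have "\<exists>i\<in>{i. v i = 1}. \<sigma> i = 0" by (auto simp: \<sigma>_def split: if_splits)
      then have "(\<Prod>i\<in>{i. v i = 1}. \<sigma> i) = 0" using fin by (rule prod_zero[rotated])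
      then show ?thesis by (simp add: rk_insert[OF B])
    qed
  qed (use pw in \<open>auto simp: prob_weights_def\<close>)
  also have "\<dots> = rk B + 1 - (\<Sum>v\<in>cube n. law n p v * (\<Prod>i\<in>{i. v i = 1}. \<sigma> i))"
    using pw unfolding right_diff_distrib sum_subtractf sum_distrib_right[symmetric] prob_weights_def
    by simp
  also have "\<dots> \<le> rk B + (1 - gen r p (frozen n B) + (real r)\<^sup>2 / n)"
  proof -
    have "\<bar>\<sigma> i\<bar> \<le> 1" for i by (simp add: \<sigma>_def)
    from law_prod_approx[where \<sigma> = \<sigma>, OF p n this] show ?thesis unfolding s by linarith
  qed
  finally have "a * (\<Sum>v\<in>cube n. law n p v * rk (insert v B)) \<le>
      a * (rk B + (1 - gen r p (frozen n B) + (real r)\<^sup>2 / n))"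
    using a by (rule mult_left_mono)
  then show ?thesis unfolding mstep_def by (simp add: algebra_simps)
qed

text \<open>Makes \<open>law n unit_weight\<close> the uniform law on the unit vectors, so that the
  general lemmas on \<open>law\<close> cover them as well.\<close>

definition unit_weight :: "nat \<Rightarrow> real" where
  "unit_weight k = (if k = 1 then 1 else 0)"

lemma weight_probs_single: "weight_probs 1 unit_weight"
  by (auto simp: weight_probs_def unit_weight_def)

lemma sum_law_single:
  assumes "0 < n"
  shows "(\<Sum>v\<in>cube n. law n unit_weight v * f v) = (\<Sum>i<n. f (ind {i})) / n"
proof -
  have k: "ksets n 1 = (\<lambda>i. {i}) ` {..<n}"
    by (auto simp: ksets_def card_1_singleton_iff)
  show ?thesis
    using assms unfolding sum_law[OF weight_probs_single, of n, OF Suc_leI[OF assms, folded One_nat_def]]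
    by (simp add: unit_weight_def k[simplified] sum.reindex inj_on_def)
qed

lemma mstep_rk_single:
  assumes n: "0 < n" and B: "B \<subseteq> cube n"
  shows "mstep q (cube n) (law n unit_weight) rk B = rk B + q * (1 - frozen n B)"
proof -
  have "(\<Sum>i<n. rk (insert (ind {i}) B)) = (\<Sum>i<n. rk B + 1 - (if ind {i} \<in> F2.span B then 1 else 0))"
    by (intro sum.cong) (auto simp: rk_insert[OF B])
  also have "\<dots> = n * (rk B + 1) - n * frozen n B"
    using n by (auto simp: frozen_def sum_subtractf sum.If_cases Int_def)
  finally have e: "(\<Sum>i<n. rk (insert (ind {i}) B)) / n = rk B + 1 - frozen n B"
    using n by (simp add: diff_divide_distrib)
  show ?thesis unfolding mstep_def sum_law_single[OF n] e by (simp add: algebra_simps)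
qed

lemma rk_units:
  assumes "A \<subseteq> {..<n}"
  shows "rk ((\<lambda>i. ind {i}) ` A) = real (card A)"
proof -
  have "finite A" using assms by (rule finite_subset) simp
  then show ?thesis
  proof (induction A rule: finite_induct)
    case empty
    have "F2.dim {} = 0" using F2.dim_eq_card[of "{}" "{}"] F2.independent_empty by simp
    then show ?case by (simp add: rk_def)
  next
    case (insert x A)
    have "F2.subspace {v. v x = 0}"
      by (auto simp: F2.subspace_def bit_scale_def)
    then have "F2.span ((\<lambda>i. ind {i}) ` A) \<subseteq> {v. v x = 0}"
      using insert.hyps by (intro F2.span_minimal) (auto simp: ind_def)
    then have "ind {x} \<notin> F2.span ((\<lambda>i. ind {i}) ` A)" by (auto simp: ind_def)
    then show ?case using insert dim_insert[of "(\<lambda>i. ind {i}) ` A" "ind {x}"] by (simp add: rk_def)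
  qed
qed

text \<open>Coupon collecting: a unit vector missing from \<open>A\<close> is hit in each step with
  probability \<open>q / n\<close>, so the expected number still missing decays
  geometrically.\<close>

lemma mstep_pow_rk_units:
  assumes n: "0 < n"
  shows "A \<subseteq> {..<n} \<Longrightarrow> (mstep q (cube n) (law n unit_weight) ^^ N) rk ((\<lambda>i. ind {i}) ` A) =
    n - (real n - real (card A)) * (1 - q / n) ^ N"
proof (induction N arbitrary: A)
  case 0
  then show ?case by (simp add: rk_units)
next
  case (Suc N)
  let ?\<theta> = "(1 - q / n) ^ N" and ?c = "real (card A)"
  have fin: "finite A" using Suc.prems by (rule finite_subset) simp
  have "(\<Sum>i<n. (mstep q (cube n) (law n unit_weight) ^^ N) rk (insert (ind {i}) ((\<lambda>i. ind {i}) ` A)))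
      = (\<Sum>i<n. n - (real n - ?c - (if i \<in> A then 0 else 1)) * ?\<theta>)"
  proof (intro sum.cong refl)
    fix i assume "i \<in> {..<n}"
    then have "insert i A \<subseteq> {..<n}" using Suc.prems by auto
    from Suc.IH[OF this] show "(mstep q (cube n) (law n unit_weight) ^^ N) rk (insert (ind {i}) ((\<lambda>i. ind {i}) ` A))
        = n - (real n - ?c - (if i \<in> A then 0 else 1)) * ?\<theta>"
      using fin by (auto simp: insert_absorb)
  qed
  also have "\<dots> = (\<Sum>i<n. n - (real n - ?c) * ?\<theta>) + (\<Sum>i<n. if i \<in> A then 0 else 1) * ?\<theta>"
    unfolding sum_distrib_right sum.distrib[symmetric] by (intro sum.cong) (auto simp: algebra_simps)
  also have "(\<Sum>i<n. if i \<in> A then 0 else (1::real)) = real n - ?c"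
  proof -
    have "(\<Sum>i<n. if i \<in> A then 0 else (1::real)) = real (card ({..<n} - A))"
      by (simp add: sum.If_cases Diff_eq)
    also have "\<dots> = real n - ?c"
      using Suc.prems fin card_mono[OF _ Suc.prems] by (simp add: card_Diff_subset of_nat_diff)
    finally show ?thesis .
  qed
  finally have e: "(\<Sum>i<n. (mstep q (cube n) (law n unit_weight) ^^ N) rk (insert (ind {i}) ((\<lambda>i. ind {i}) ` A))) / n
      = n - (real n - ?c) * ?\<theta> + (real n - ?c) * ?\<theta> / n"
    using n by (simp add: add_divide_distrib)
  have "(mstep q (cube n) (law n unit_weight) ^^ Suc N) rk ((\<lambda>i. ind {i}) ` A) =
      (1 - q) * (n - (real n - ?c) * ?\<theta>) + q * (n - (real n - ?c) * ?\<theta> + (real n - ?c) * ?\<theta> / n)"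
    unfolding funpow.simps o_def
    by (subst mstep_def) (simp only: sum_law_single[OF n] e Suc.IH[OF Suc.prems])
  also have "\<dots> = n - (real n - ?c) * (1 - q / n) ^ Suc N"
    by (simp add: algebra_simps)
  finally show ?case .
qed

text \<open>One vector is worth \<open>d\<close> unit vectors. As \<open>d\<close> may exceed 1, the exchange is carried out between lazy
  insertions, of a vector with probability \<open>1 / K\<close> against a unit vector with probability \<open>d / K\<close>.\<close>

lemma expected_rk_le:
  assumes p: "weight_probs r p" and n: "r \<le> n" "0 < n"
    and d: "0 \<le> d" "d \<le> real K" "0 < K"
    and tangent: "\<And>x. 0 \<le> x \<Longrightarrow> x \<le> 1 \<Longrightarrow> g + d * x \<le> gen r p x"
  shows "(mstep 1 (cube n) (law n p) ^^ m) rk {} \<le>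
    real m * (1 - g - d + (real r)\<^sup>2 / n) + n * (1 - (1 - d / K / n) ^ (K * m)) + sqrt m"
proof -
  have pw: "prob_weights (cube n) (law n p)" by (rule prob_weights_law[OF p n(1)])
  have pw': "prob_weights (cube n) (law n unit_weight)"
    using prob_weights_law[OF weight_probs_single] n(2) by simp
  let ?c = "(1 - g - d + (real r)\<^sup>2 / n) / K"
  have le: "mstep (1 / K) (cube n) (law n p) rk B \<le> ?c + mstep (d / K) (cube n) (law n unit_weight) rk B"
    if B: "B \<subseteq> cube n" for B
  proof -
    have "mstep (1 / K) (cube n) (law n p) rk B \<le> rk B + 1 / K * (1 - gen r p (frozen n B) + (real r)\<^sup>2 / n)"
      using mstep_rk_le[OF p n B, of "1 / K"] by simp
    also have "\<dots> \<le> rk B + 1 / K * (1 - (g + d * frozen n B) + (real r)\<^sup>2 / n)"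
      using tangent[OF frozen_bounds, of n B] d by (intro add_left_mono mult_left_mono) auto
    also have "\<dots> = ?c + (rk B + d / K * (1 - frozen n B))"
      using d(3) by (simp add: field_simps)
    finally show ?thesis by (simp add: mstep_rk_single[OF n(2) B])
  qed
  have "(mstep 1 (cube n) (law n p) ^^ m) rk {} \<le>
      (mstep (1 / K) (cube n) (law n p) ^^ (K * m)) rk {} + sqrt m"
    using d by (intro mstep_pow_le_lazy[OF pw unit_increments_rk]) auto
  also have "(mstep (1 / K) (cube n) (law n p) ^^ (K * m)) rk {} \<le>
      real (K * m) * ?c + (mstep (d / K) (cube n) (law n unit_weight) ^^ (K * m)) rk {}"
    using d le by (intro mstep_pow_exchange[OF pw _ _ pw']) auto
  also have "(mstep (d / K) (cube n) (law n unit_weight) ^^ (K * m)) rk {} = n - n * (1 - d / K / n) ^ (K * m)"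
    using mstep_pow_rk_units[OF n(2), of "{}"] by simp
  also have "real (K * m) * ?c = real m * (1 - g - d + (real r)\<^sup>2 / n)"
    using d(3) by simp
  finally show ?thesis by (simp add: algebra_simps)
qed

section \<open>Random bit vectors\<close>

lemma sum_PiE_insert:
  fixes F :: "('i \<Rightarrow> 'v) \<Rightarrow> real"
  assumes "x \<notin> S"
  shows "(\<Sum>f\<in>PiE (insert x S) (\<lambda>_. C). F f) = (\<Sum>y\<in>C. \<Sum>g\<in>PiE S (\<lambda>_. C). F (g(x := y)))"
proof -
  have "(\<Sum>f\<in>PiE (insert x S) (\<lambda>_. C). F f) =
      (\<Sum>z\<in>C \<times> PiE S (\<lambda>_. C). F ((\<lambda>(y, g). g(x := y)) z))"
    unfolding PiE_insert_eq using inj_combinator[OF assms, of "\<lambda>_. C"]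
    by (subst sum.reindex) (simp_all add: o_def)
  then show ?thesis unfolding sum.cartesian_product by (simp add: case_prod_beta)
qed

text \<open>Links the operators to the product law of \<open>m\<close> independent vectors. The set
  \<open>B\<close> is general for the sake of the induction, in which the vector of index
  \<open>Suc m\<close> is inserted first.\<close>

lemma sum_PiE_mstep:
  "(\<Sum>f\<in>PiE {1..m::nat} (\<lambda>_. C). (\<Prod>i\<in>{1..m}. w (f i)) * u (f ` {1..m} \<union> B)) = (mstep 1 C w ^^ m) u B"
proof (induction m arbitrary: B)
  case 0
  then show ?case by (simp add: PiE_empty_domain)
next
  case (Suc m)
  have e: "{1..Suc m} = insert (Suc m) {1..m}" by auto
  have s: "(\<Prod>i\<in>insert (Suc m) {1..m}. w ((g(Suc m := y)) i)) * u ((g(Suc m := y)) ` insert (Suc m) {1..m} \<union> B) =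
      w y * ((\<Prod>i\<in>{1..m}. w (g i)) * u (g ` {1..m} \<union> insert y B))" for g y
  proof -
    have g: "(g(Suc m := y)) ` {1..m} = g ` {1..m}" by (intro image_cong) auto
    have "(g(Suc m := y)) ` insert (Suc m) {1..m} \<union> B = g ` {1..m} \<union> insert y B"
      unfolding image_insert g by simp
    moreover have "(\<Prod>i\<in>{1..m}. w ((g(Suc m := y)) i)) = (\<Prod>i\<in>{1..m}. w (g i))"
      by (intro prod.cong) auto
    moreover have "(\<Prod>i\<in>insert (Suc m) {1..m}. w ((g(Suc m := y)) i)) =
        w ((g(Suc m := y)) (Suc m)) * (\<Prod>i\<in>{1..m}. w ((g(Suc m := y)) i))"
      by (rule prod.insert) auto
    ultimately show ?thesis by (simp only: fun_upd_same mult.assoc)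
  qed
  show ?case
    unfolding e by (subst sum_PiE_insert, simp) (simp only: s sum_distrib_left[symmetric] Suc, simp add: mstep_def[of _ _ _ "(mstep 1 C w ^^ m) u"])
qed

context random_bit_vectors
begin

abbreviation "weight_prob k \<equiv> \<P>(\<omega> in N. w \<omega> = k)"

lemma X_measurable: "1 \<le> i \<Longrightarrow> X i \<in> measurable M (count_space (cube n))"
  using indep by (auto simp: indep_vars_def)

lemma X_in_cube: "1 \<le> i \<Longrightarrow> \<omega> \<in> space M \<Longrightarrow> X i \<omega> \<in> cube n"
  using measurable_space[OF X_measurable] by simp

lemma X_events: "1 \<le> i \<Longrightarrow> {\<omega> \<in> space M. P (X i \<omega>)} \<in> events"
  using measurable_sets[OF X_measurable, of i "{v \<in> cube n. P v}"] X_in_cube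
  by (auto simp: vimage_def Int_def conj_commute cong: conj_cong)

lemma prob_X:
  assumes i: "1 \<le> i" and v: "v \<in> cube n" and w: "w \<in> measurable N (count_space UNIV)"
  shows "\<P>(\<omega> in M. X i \<omega> = v) = law n weight_prob v"
proof -
  define k where "k = weight v"
  have m: "(\<lambda>\<omega>. weight (X i \<omega>)) \<in> measurable M (count_space UNIV)"
    using X_measurable[OF i] by (rule measurable_compose) simp
  have "\<P>(\<omega> in M. weight (X i \<omega>) = k) = measure (distr M (count_space UNIV) (\<lambda>\<omega>. weight (X i \<omega>))) {k}"
    using m by (simp add: measure_distr vimage_def Int_def conj_commute)
  also have "\<dots> = weight_prob k"
    unfolding weight_law[OF i] using w by (simp add: measure_distr vimage_def Int_def conj_commute)
  finally have pk: "\<P>(\<omega> in M. weight (X i \<omega>) = k) = weight_prob k" .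
  have eq: "{\<omega> \<in> space M. X i \<omega> = v \<and> weight (X i \<omega>) = k} = {\<omega> \<in> space M. X i \<omega> = v}"
    by (auto simp: k_def)
  show ?thesis
  proof (cases "weight_prob k > 0")
    case True
    have "\<P>(\<omega> in M. X i \<omega> = v \<bar> weight (X i \<omega>) = k) = 1 / real (n choose k)"
      using uniform_given_weight[OF i _ v k_def[symmetric]] True by (simp add: pk card_weight)
    then have "\<P>(\<omega> in M. X i \<omega> = v) / weight_prob k = 1 / real (n choose k)"
      unfolding cond_prob_def pk eq .
    moreover have "\<P>(\<omega> in M. X i \<omega> = v) = \<P>(\<omega> in M. X i \<omega> = v) / weight_prob k * weight_prob k"
      using True by simp
    ultimately show ?thesis by (simp add: law_def k_def[symmetric])
  next
    case False
    then have z: "weight_prob k = 0" using measure_nonneg[of N "{\<omega> \<in> space N. w \<omega> = k}"] by linarith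
    have "\<P>(\<omega> in M. X i \<omega> = v) \<le> \<P>(\<omega> in M. weight (X i \<omega>) = k)"
      using i by (intro finite_measure_mono X_events) (auto simp: k_def)
    then have "\<P>(\<omega> in M. X i \<omega> = v) = 0" using z pk measure_nonneg[of M] by (metis antisym)
    then show ?thesis using z by (simp add: law_def k_def[symmetric])
  qed
qed

lemma prob_joint:
  assumes J: "finite J" "J \<subseteq> {1..}" and f: "f \<in> PiE J (\<lambda>_. cube n)"
    and w: "w \<in> measurable N (count_space UNIV)"
  shows "{\<omega> \<in> space M. \<forall>i\<in>J. X i \<omega> = f i} \<in> events"
    and "\<P>(\<omega> in M. \<forall>i\<in>J. X i \<omega> = f i) = (\<Prod>i\<in>J. law n weight_prob (f i))"
proof -
  show "{\<omega> \<in> space M. \<forall>i\<in>J. X i \<omega> = f i} \<in> events"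
    using J by (intro sets.sets_Collect_finite_All X_events) auto
  show "\<P>(\<omega> in M. \<forall>i\<in>J. X i \<omega> = f i) = (\<Prod>i\<in>J. law n weight_prob (f i))"
  proof (cases "J = {}")
    case True
    then show ?thesis by (simp add: prob_space)
  next
    case False
    have "prob (\<Inter>i\<in>J. X i -` {f i} \<inter> space M) = (\<Prod>i\<in>J. prob (X i -` {f i} \<inter> space M))"
      using f by (intro indep_varsD[OF indep False J]) auto
    moreover have "(\<Inter>i\<in>J. X i -` {f i} \<inter> space M) = {\<omega> \<in> space M. \<forall>i\<in>J. X i \<omega> = f i}"
      using False by auto
    moreover have "prob (X i -` {f i} \<inter> space M) = law n weight_prob (f i)" if "i \<in> J" for i
      using prob_X[of i "f i"] that J f w by (auto simp: vimage_def Int_def conj_commute)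
    ultimately show ?thesis by simp
  qed
qed

text \<open>The passage from measure theory to finite sums: any predicate of finitely many of the
  vectors defines an event, and its probability is computed under the product law.\<close>

lemma prob_event:
  assumes J: "finite J" "J \<subseteq> {1..}" and w: "w \<in> measurable N (count_space UNIV)"
  shows "{\<omega> \<in> space M. \<Phi> (restrict (\<lambda>i. X i \<omega>) J)} \<in> events"
    and "\<P>(\<omega> in M. \<Phi> (restrict (\<lambda>i. X i \<omega>) J)) =
      (\<Sum>f\<in>PiE J (\<lambda>_. cube n). (\<Prod>i\<in>J. law n weight_prob (f i)) * (if \<Phi> f then 1 else 0))"
proof -
  let ?P = "PiE J (\<lambda>_. cube n)"
  let ?E = "\<lambda>f. {\<omega> \<in> space M. \<forall>i\<in>J. X i \<omega> = f i}"
  have fin: "finite ?P" using J finite_cube by (intro finite_PiE)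
  have eq: "{\<omega> \<in> space M. \<Phi> (restrict (\<lambda>i. X i \<omega>) J)} = (\<Union>f\<in>{f \<in> ?P. \<Phi> f}. ?E f)"
  proof (intro set_eqI iffI)
    fix \<omega> assume \<omega>: "\<omega> \<in> {\<omega> \<in> space M. \<Phi> (restrict (\<lambda>i. X i \<omega>) J)}"
    then have "restrict (\<lambda>i. X i \<omega>) J \<in> ?P" using J X_in_cube by auto
    with \<omega> show "\<omega> \<in> (\<Union>f\<in>{f \<in> ?P. \<Phi> f}. ?E f)"
      by (intro UN_I[of "restrict (\<lambda>i. X i \<omega>) J"]) auto
  next
    fix \<omega> assume "\<omega> \<in> (\<Union>f\<in>{f \<in> ?P. \<Phi> f}. ?E f)"
    then obtain f where f: "f \<in> ?P" "\<Phi> f" "\<omega> \<in> ?E f" by auto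
    then have "restrict (\<lambda>i. X i \<omega>) J = f"
      by (intro ext) (auto simp: restrict_def PiE_def extensional_def)
    with f show "\<omega> \<in> {\<omega> \<in> space M. \<Phi> (restrict (\<lambda>i. X i \<omega>) J)}" by auto
  qed
  show "{\<omega> \<in> space M. \<Phi> (restrict (\<lambda>i. X i \<omega>) J)} \<in> events"
    unfolding eq using fin prob_joint(1)[OF J _ w] by (intro sets.finite_UN) auto
  have "prob (\<Union>f\<in>{f \<in> ?P. \<Phi> f}. ?E f) = (\<Sum>f\<in>{f \<in> ?P. \<Phi> f}. prob (?E f))"
  proof (rule finite_measure_finite_Union)
    show "disjoint_family_on ?E {f \<in> ?P. \<Phi> f}"
      unfolding disjoint_family_on_def
    proof (intro ballI impI)
      fix f g assume fg: "f \<in> {f \<in> ?P. \<Phi> f}" "g \<in> {f \<in> ?P. \<Phi> f}" "f \<noteq> g"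
      then obtain i where "i \<in> J" "f i \<noteq> g i" by (metis (mono_tags, lifting) PiE_ext mem_Collect_eq)
      then show "?E f \<inter> ?E g = {}" by auto
    qed
  qed (use fin prob_joint(1)[OF J _ w] in auto)
  also have "\<dots> = (\<Sum>f\<in>{f \<in> ?P. \<Phi> f}. \<Prod>i\<in>J. law n weight_prob (f i))"
    using prob_joint(2)[OF J _ w] by (intro sum.cong) auto
  also have "\<dots> = (\<Sum>f\<in>?P. (\<Prod>i\<in>J. law n weight_prob (f i)) * (if \<Phi> f then 1 else 0))"
    using fin by (intro sum.mono_neutral_cong_left) auto
  finally show "\<P>(\<omega> in M. \<Phi> (restrict (\<lambda>i. X i \<omega>) J)) =
      (\<Sum>f\<in>PiE J (\<lambda>_. cube n). (\<Prod>i\<in>J. law n weight_prob (f i)) * (if \<Phi> f then 1 else 0))"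
    unfolding eq .
qed

text \<open>The value \<open>j\<close> is decided by the first \<open>j\<close> vectors, so its
  preimage is an event by \<open>prob_event\<close>.\<close>

lemma first_dependence_measurable:
  assumes w: "w \<in> measurable N (count_space UNIV)"
  shows "(\<lambda>\<omega>. first_dependence (\<lambda>m. X m \<omega>)) \<in> measurable M (count_space UNIV)"
proof (rule measurable_count_space_eq_countable[THEN iffD2, OF countableI_type], intro conjI ballI)
  fix j :: nat
  define \<Phi> where "\<Phi> x \<longleftrightarrow> 1 \<le> j \<and> x j \<in> F2.span (x ` {1..<j}) \<and>
      (\<forall>l. 1 \<le> l \<and> l < j \<longrightarrow> x l \<notin> F2.span (x ` {1..<l}))" for x :: "nat \<Rightarrow> nat \<Rightarrow> bit"
  have restr: "\<Phi> (restrict x {1..j}) \<longleftrightarrow> \<Phi> x" for x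
  proof -
    have "restrict x {1..j} ` {1..<l} = x ` {1..<l}" if "l \<le> j" for l
      using that by (intro image_cong) auto
    then show ?thesis unfolding \<Phi>_def by auto
  qed
  have iff: "first_dependence (\<lambda>m. X m \<omega>) = j \<longleftrightarrow> \<Phi> (\<lambda>m. X m \<omega>)" if \<omega>: "\<omega> \<in> space M" for \<omega>
  proof -
    define A where "A m \<longleftrightarrow> 1 \<le> m \<and> X m \<omega> \<in> F2.span ((\<lambda>m. X m \<omega>) ` {1..<m})" for m
    have ex: "\<exists>m. A m" using dependence_exists[of "\<lambda>m. X m \<omega>" n] X_in_cube \<omega> by (auto simp: A_def)
    have "first_dependence (\<lambda>m. X m \<omega>) = (LEAST m. A m)" by (simp add: first_dependence_def A_def)
    moreover have "(LEAST m. A m) = j \<longleftrightarrow> A j \<and> (\<forall>l<j. \<not> A l)"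
      using LeastI_ex[OF ex] not_less_Least[of _ A] Least_equality[of A j] by (metis not_le_imp_less)
    ultimately show ?thesis by (auto simp: \<Phi>_def A_def)
  qed
  have "{\<omega> \<in> space M. \<Phi> (restrict (\<lambda>i. X i \<omega>) {1..j})} \<in> events"
    by (rule prob_event(1)) (use w in auto)
  moreover have "(\<lambda>\<omega>. first_dependence (\<lambda>m. X m \<omega>)) -` {j} \<inter> space M =
      {\<omega> \<in> space M. \<Phi> (restrict (\<lambda>i. X i \<omega>) {1..j})}"
    unfolding restr using iff by auto
  ultimately show "(\<lambda>\<omega>. first_dependence (\<lambda>m. X m \<omega>)) -` {j} \<inter> space M \<in> events" by simp
qed simp

text \<open>Chebyshev's inequality: the rank of \<open>m\<close> vectors has variance at most \<open>m\<close>.\<close>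

lemma prob_late_dependence_le:
  assumes w: "w \<in> measurable N (count_space UNIV)"
    and p: "weight_probs r weight_prob" "r \<le> n"
    and \<mu>: "\<mu> = (mstep 1 (cube n) (law n weight_prob) ^^ m) rk {}" "\<mu> < real m"
  shows "\<P>(\<omega> in M. m < first_dependence (\<lambda>i. X i \<omega>)) \<le> real m / (real m - \<mu>)\<^sup>2"
proof -
  let ?P = "PiE {1..m} (\<lambda>_. cube n)" and ?\<nu> = "law n weight_prob"
  let ?w = "\<lambda>f. \<Prod>i\<in>{1..m}. ?\<nu> (f i)"
  have pw: "prob_weights (cube n) ?\<nu>" by (rule prob_weights_law[OF p])
  have E: "(\<Sum>f\<in>?P. ?w f * u (f ` {1..m})) = (mstep 1 (cube n) ?\<nu> ^^ m) u {}" for u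
    using sum_PiE_mstep[where m = m and C = "cube n" and w = ?\<nu> and u = u and B = "{}"]
    unfolding Un_empty_right .
  have w0: "0 \<le> ?w f" if "f \<in> ?P" for f
    using that pw by (intro prod_nonneg) (auto simp: prob_weights_def)
  have one: "(\<Sum>f\<in>?P. ?w f) = 1"
    using pw prod_sum_PiE[of "{1..m}" "\<lambda>_. cube n" "\<lambda>_. ?\<nu>"] by (simp add: prob_weights_def)
  have d: "0 < (real m - \<mu>)\<^sup>2" using \<mu>(2) by simp
  have "\<P>(\<omega> in M. m < first_dependence (\<lambda>i. X i \<omega>)) \<le>
      \<P>(\<omega> in M. rk (restrict (\<lambda>i. X i \<omega>) {1..m} ` {1..m}) = real m)"
    using prob_event(1)[of "{1..m}" "\<lambda>f. rk (f ` {1..m}) = real m"] w dim_before_first_dependence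
    by (intro finite_measure_mono) (auto simp: rk_def)
  also have "\<dots> = (\<Sum>f\<in>?P. ?w f * (if rk (f ` {1..m}) = real m then 1 else 0))"
    by (rule prob_event(2)) (use w in auto)
  also have "\<dots> \<le> (\<Sum>f\<in>?P. ?w f * ((rk (f ` {1..m}) - \<mu>)\<^sup>2 / (real m - \<mu>)\<^sup>2))"
    using d w0 by (intro sum_mono mult_left_mono) auto
  also have "\<dots> = (\<Sum>f\<in>?P. ?w f * (rk (f ` {1..m}))\<^sup>2 - 2 * \<mu> * (?w f * rk (f ` {1..m})) + \<mu>\<^sup>2 * ?w f) / (real m - \<mu>)\<^sup>2"
    unfolding sum_divide_distrib by (intro sum.cong refl) (simp add: power2_diff algebra_simps)
  also have "(\<Sum>f\<in>?P. ?w f * (rk (f ` {1..m}))\<^sup>2 - 2 * \<mu> * (?w f * rk (f ` {1..m})) + \<mu>\<^sup>2 * ?w f) =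
      (mstep 1 (cube n) ?\<nu> ^^ m) (\<lambda>B. (rk B)\<^sup>2) {} - \<mu>\<^sup>2"
    unfolding sum.distrib sum_subtractf sum_distrib_left[symmetric] one E E[of "\<lambda>B. (rk B)\<^sup>2"] \<mu>(1)[symmetric]
    by (simp add: power2_eq_square)
  also have "\<dots> \<le> real m"
    using mstep_variance[OF pw unit_increments_rk, of "{}" m] by (simp add: \<mu>(1))
  finally show ?thesis using d by (simp add: divide_right_mono)
qed

end

section \<open>The thresholds\<close>

lemma power_above_tangent:
  fixes x y :: real
  assumes "0 \<le> x" "0 \<le> y"
  shows "y ^ k + real k * y ^ (k - 1) * (x - y) \<le> x ^ k"
proof (induction k)
  case (Suc k)
  have "y ^ Suc k + real (Suc k) * y ^ k * (x - y) \<le> x * (y ^ k + real k * y ^ (k - 1) * (x - y))"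
  proof (cases k)
    case (Suc j)
    have "0 \<le> real k * y ^ j * (x - y)\<^sup>2" using assms by simp
    then show ?thesis by (simp add: Suc power2_eq_square algebra_simps)
  qed simp
  also have "\<dots> \<le> x * x ^ k" using Suc assms by (intro mult_left_mono) auto
  finally show ?case by simp
qed simp

definition dgen :: "nat \<Rightarrow> (nat \<Rightarrow> real) \<Rightarrow> real \<Rightarrow> real" where
  "dgen r p s = (\<Sum>k\<le>r. p k * (real k * s ^ (k - 1)))"

definition ddgen :: "nat \<Rightarrow> (nat \<Rightarrow> real) \<Rightarrow> real \<Rightarrow> real" where
  "ddgen r p s = (\<Sum>k\<le>r. p k * (real k * (real (k - 1) * s ^ (k - 1 - 1))))"

lemma DERIV_gen: "(gen r p has_real_derivative dgen r p s) (at s)"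
  unfolding gen_def dgen_def by (auto intro!: derivative_eq_intros simp: mult_ac)

lemma DERIV_dgen: "(dgen r p has_real_derivative ddgen r p s) (at s)"
  unfolding dgen_def ddgen_def by (auto intro!: derivative_eq_intros simp: mult_ac)

lemma deriv_gen: "deriv (gen r p) = dgen r p"
  using DERIV_imp_deriv[OF DERIV_gen] by blast

lemma gen_1: "weight_probs r p \<Longrightarrow> gen r p 1 = 1"
  by (simp add: gen_def weight_probs_def)

lemma gen_mono:
  assumes "weight_probs r p" "0 \<le> s" "s \<le> t"
  shows "gen r p s \<le> gen r p t"
  unfolding gen_def using assms
  by (intro sum_mono mult_left_mono power_mono) (auto simp: weight_probs_def)

lemma gen_nonneg: "weight_probs r p \<Longrightarrow> 0 \<le> s \<Longrightarrow> 0 \<le> gen r p s"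
  unfolding gen_def by (intro sum_nonneg mult_nonneg_nonneg) (auto simp: weight_probs_def)

lemma gen_above_tangent:
  assumes "weight_probs r p" "0 \<le> x" "0 \<le> y"
  shows "gen r p y + dgen r p y * (x - y) \<le> gen r p x"
proof -
  have "gen r p y + dgen r p y * (x - y) = (\<Sum>k\<le>r. p k * (y ^ k + real k * y ^ (k - 1) * (x - y)))"
    unfolding gen_def dgen_def sum_distrib_right sum.distrib[symmetric]
    by (intro sum.cong refl) (simp add: algebra_simps)
  also have "\<dots> \<le> gen r p x"
    unfolding gen_def using assms power_above_tangent
    by (intro sum_mono mult_left_mono) (auto simp: weight_probs_def)
  finally show ?thesis .
qed

text \<open>Here \<open>p\<close> is the limit law of the weights; the laws at finite
  \<open>n\<close> appear later as sequences \<open>pn\<close> converging to it.\<close>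

locale heavy_weights =
  fixes r :: nat and p :: "nat \<Rightarrow> real"
  assumes p: "weight_probs r p" and p_small: "\<And>k. k < 3 \<Longrightarrow> p k = 0"
begin

abbreviation "\<rho> \<equiv> gen r p"
abbreviation "\<rho>' \<equiv> dgen r p"

lemma p_nonneg: "0 \<le> p k" using p by (simp add: weight_probs_def)

lemma gen_0: "\<rho> 0 = 0"
  unfolding gen_def by (intro sum.neutral) (use p_small[of 0] in \<open>auto simp: power_0_left\<close>)

lemma gen_le_cube:
  assumes "0 \<le> s" "s \<le> 1"
  shows "\<rho> s \<le> s ^ 3"
proof -
  have "p k * s ^ k \<le> p k * s ^ 3" for k
  proof (cases "k < 3")
    case False
    then show ?thesis using assms p_nonneg by (intro mult_left_mono power_decreasing) auto
  qed (simp add: p_small)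
  then have "\<rho> s \<le> (\<Sum>k\<le>r. p k * s ^ 3)" unfolding gen_def by (intro sum_mono)
  also have "\<dots> = s ^ 3" unfolding sum_distrib_right[symmetric] using p by (simp add: weight_probs_def)
  finally show ?thesis .
qed

lemma ex_weight: "\<exists>k\<le>r. 0 < p k \<and> 3 \<le> k"
proof (rule ccontr)
  assume "\<not> ?thesis"
  then have "p k = 0" if "k \<le> r" for k
    using that p_nonneg[of k] p_small[of k] by (metis less_eq_real_def not_le)
  then have "(\<Sum>k\<le>r. p k) = 0" by simp
  then show False using p by (simp add: weight_probs_def)
qed

lemma gen_pos:
  assumes "0 < s"
  shows "0 < \<rho> s"
proof -
  obtain k where "k \<le> r" "0 < p k" using ex_weight by auto
  then show ?thesis unfolding gen_def using assms p_nonneg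
    by (intro sum_pos2[of _ k]) auto
qed

lemma dgen_pos:
  assumes "0 < s"
  shows "0 < \<rho>' s"
proof -
  obtain k where "k \<le> r" "0 < p k" "3 \<le> k" using ex_weight by auto
  then show ?thesis unfolding dgen_def using assms p_nonneg
    by (intro sum_pos2[of _ k]) auto
qed

lemma dgen_le:
  assumes "0 \<le> s" "s \<le> 1"
  shows "\<rho>' s \<le> real r"
proof -
  have "\<rho>' s \<le> (\<Sum>k\<le>r. p k * (real r * 1))"
    unfolding dgen_def using assms p_nonneg
    by (intro sum_mono mult_left_mono mult_mono power_le_one) auto
  also have "\<dots> = real r" unfolding sum_distrib_right[symmetric] using p by (simp add: weight_probs_def)
  finally show ?thesis .
qed

lemma ddgen_nonneg: "0 \<le> s \<Longrightarrow> 0 \<le> ddgen r p s"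
  unfolding ddgen_def using p_nonneg by (intro sum_nonneg mult_nonneg_nonneg) auto

section \<open>The function \<open>h\<close> and the upper threshold\<close>

lemma h_eq: "h_fun \<rho> x = - ln (1 - x) / \<rho>' x"
  by (simp add: h_fun_def deriv_gen)

lemma h_le_iff:
  assumes "0 < x" "x < 1"
  shows "h_fun \<rho> x \<le> \<alpha> \<longleftrightarrow> - ln (1 - x) \<le> \<alpha> * \<rho>' x"
  unfolding h_eq by (rule pos_divide_le_eq) (use dgen_pos assms in auto)

lemma le_h_iff:
  assumes "0 < x" "x < 1"
  shows "\<alpha> \<le> h_fun \<rho> x \<longleftrightarrow> \<alpha> * \<rho>' x \<le> - ln (1 - x)"
  unfolding h_eq by (rule pos_le_divide_eq) (use dgen_pos assms in auto)

lemma h_pos: "0 < x \<Longrightarrow> x < 1 \<Longrightarrow> 0 < h_fun \<rho> x"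
  unfolding h_eq using dgen_pos[of x] by (intro divide_pos_pos) auto

lemma isCont_h: "0 < x \<Longrightarrow> x < 1 \<Longrightarrow> isCont (h_fun \<rho>) x"
  unfolding h_eq[abs_def] using dgen_pos[of x]
  by (intro continuous_intros DERIV_isCont[OF DERIV_dgen]) auto

text \<open>The hypothesis makes the level set nonempty. Since \<open>\<rho>'\<close> is at most
  \<open>r\<close>, the logarithm in \<open>h\<close> keeps the set away from 1, so its supremum is
  an interior point; continuity of \<open>h\<close> there gives the value \<alpha> exactly.\<close>

lemma g_star_props:
  assumes "alpha_sharp \<rho> < \<alpha>"
  shows "0 < g_star \<rho> \<alpha>" "g_star \<rho> \<alpha> < 1" "h_fun \<rho> (g_star \<rho> \<alpha>) = \<alpha>" "0 < \<alpha>"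
    and "\<And>x. g_star \<rho> \<alpha> < x \<Longrightarrow> x < 1 \<Longrightarrow> \<alpha> < h_fun \<rho> x"
proof -
  define S where "S = {x \<in> {0<..<1}. h_fun \<rho> x \<le> \<alpha>}"
  define x0 where "x0 = Sup S"
  obtain x1 where x1: "0 < x1" "x1 < 1" "h_fun \<rho> x1 < \<alpha>"
    using cInf_lessD[of "h_fun \<rho> ` {0<..<1}" \<alpha>] assms unfolding alpha_sharp_def by auto
  then have x1S: "x1 \<in> S" by (simp add: S_def)
  have x0: "g_star \<rho> \<alpha> = x0" using x1S unfolding g_star_def Let_def S_def[symmetric] x0_def by auto
  show \<alpha>: "0 < \<alpha>" using h_pos[OF x1(1,2)] x1(3) by linarith
  have bdd: "bdd_above S" by (intro bdd_aboveI[of _ 1]) (auto simp: S_def)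
  have up: "x \<le> 1 - exp (- (\<alpha> * r))" if "x \<in> S" for x
  proof -
    have x: "0 < x" "x < 1" "- ln (1 - x) \<le> \<alpha> * \<rho>' x" using that h_le_iff by (auto simp: S_def)
    have "\<alpha> * \<rho>' x \<le> \<alpha> * r" using \<alpha> x dgen_le[of x] by (intro mult_left_mono) auto
    with x(3) have "exp (- (\<alpha> * r)) \<le> exp (ln (1 - x))" by simp
    then show ?thesis using x by simp
  qed
  have "x1 \<le> x0" unfolding x0_def using x1S bdd by (rule cSup_upper)
  then have pos: "0 < x0" using x1 by linarith
  have "x0 \<le> 1 - exp (- (\<alpha> * r))" unfolding x0_def using x1S up by (intro cSup_least) auto
  then have lt: "x0 < 1" by (smt (verit) exp_gt_zero)
  have above: "\<alpha> < h_fun \<rho> x" if "x0 < x" "x < 1" for x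
  proof (rule ccontr)
    assume "\<not> ?thesis"
    then have "x \<in> S" using that pos by (auto simp: S_def)
    then have "x \<le> x0" unfolding x0_def using bdd by (rule cSup_upper)
    then show False using that by simp
  qed
  have cont: "isCont (h_fun \<rho>) x0" by (rule isCont_h[OF pos lt])
  have ge: "\<alpha> \<le> h_fun \<rho> x0"
  proof (rule tendsto_lowerbound[of "h_fun \<rho>" _ "at_right x0"])
    show "(h_fun \<rho> \<longlongrightarrow> h_fun \<rho> x0) (at_right x0)"
      using cont unfolding isCont_def by (rule filterlim_mono[OF _ order_refl at_le]) simp
    show "\<forall>\<^sub>F x in at_right x0. \<alpha> \<le> h_fun \<rho> x"
      using eventually_at_right_less[of x0] eventually_at_right_real[OF lt]
      by eventually_elim (use above in \<open>auto intro: less_imp_le\<close>)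
  qed simp
  have le: "h_fun \<rho> x0 \<le> \<alpha>"
  proof (rule ccontr)
    assume "\<not> ?thesis"
    then have "\<forall>\<^sub>F x in at x0. \<alpha> < h_fun \<rho> x"
      using cont unfolding isCont_def by (intro order_tendstoD(1)) auto
    then obtain d where d: "d > 0" "\<And>x. x \<noteq> x0 \<Longrightarrow> dist x x0 < d \<Longrightarrow> \<alpha> < h_fun \<rho> x"
      by (auto simp: eventually_at)
    obtain x where x: "x \<in> S" "x0 - d < x"
      using less_cSup_iff[of S "x0 - d"] x1S bdd d(1) unfolding x0_def by auto
    have "x \<le> x0" unfolding x0_def using x(1) bdd by (rule cSup_upper)
    then show False using d(2)[of x] x \<open>\<not> h_fun \<rho> x0 \<le> \<alpha>\<close> by (auto simp: S_def dist_real_def)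
  qed
  show "0 < g_star \<rho> \<alpha>" "g_star \<rho> \<alpha> < 1" "h_fun \<rho> (g_star \<rho> \<alpha>) = \<alpha>"
    unfolding x0 using pos lt ge le by linarith+
  show "\<And>x. g_star \<rho> \<alpha> < x \<Longrightarrow> x < 1 \<Longrightarrow> \<alpha> < h_fun \<rho> x" using above by (simp add: x0)
qed

text \<open>\<open>bethe \<alpha> x\<close> is the bound on the asymptotic nullity (number of vectors minus rank, per dimension)
  that the tangent of \<open>\<rho>\<close> at \<open>x\<close> yields; it equals \<open>- \<psi>(x)\<close> at \<open>x = g\<^sup>*(\<alpha>)\<close>.\<close>

definition bethe :: "real \<Rightarrow> real \<Rightarrow> real" where
  "bethe \<alpha> x = \<alpha> * \<rho> x + \<alpha> * \<rho>' x * (1 - x) - 1 + exp (- (\<alpha> * \<rho>' x))"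

text \<open>The condition on \<open>h\<close> is the fixed-point equation
  \<open>1 - x = exp (- (\<alpha> * \<rho>' x))\<close>: asymptotically, \<open>x\<close> is the
  fraction of coordinates hit by \<open>\<alpha> * \<rho>' x * n\<close> random unit
  vectors.\<close>

lemma psi_eq_bethe:
  assumes "0 < x" "x < 1" "h_fun \<rho> x = \<alpha>"
  shows "psi \<rho> x = - bethe \<alpha> x"
proof -
  have d: "\<rho>' x > 0" using dgen_pos assms by simp
  have l: "ln (1 - x) = - (\<alpha> * \<rho>' x)" using assms(3) d unfolding h_eq by (auto simp: field_simps)
  then have "exp (- (\<alpha> * \<rho>' x)) = 1 - x" using assms by (metis diff_gt_0_iff_gt exp_ln)
  moreover have "\<rho> x / \<rho>' x * (\<alpha> * \<rho>' x) = \<alpha> * \<rho> x" using d by simp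
  ultimately show ?thesis unfolding psi_def deriv_gen l bethe_def by (simp add: algebra_simps)
qed

text \<open>To the right of \<open>g_star \<rho> \<alpha>\<close>, \<open>h\<close> exceeds
  \<alpha>, which makes the derivative of \<open>bethe \<alpha>\<close> nonpositive. Hence its value
  at \<open>g_star \<rho> \<alpha>\<close> is at least the one at 1, which is
  \<open>\<alpha> - 1\<close> plus a positive exponential.\<close>

lemma psi_g_star_neg:
  assumes \<alpha>: "1 \<le> \<alpha>" "alpha_sharp \<rho> < \<alpha>"
  shows "psi \<rho> (g_star \<rho> \<alpha>) < 0"
proof -
  define x0 where "x0 = g_star \<rho> \<alpha>"
  note g = g_star_props[OF \<alpha>(2), folded x0_def]
  have "bethe \<alpha> x0 \<ge> bethe \<alpha> 1"
  proof (rule DERIV_nonpos_imp_nonincreasing[where f = "bethe \<alpha>"])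
    show "x0 \<le> 1" using g by simp
    fix x assume x: "x0 \<le> x" "x \<le> 1"
    have D: "(bethe \<alpha> has_real_derivative
        \<alpha> * ddgen r p x * ((1 - x) - exp (- (\<alpha> * \<rho>' x)))) (at x)"
      unfolding bethe_def[abs_def]
      by (auto intro!: derivative_eq_intros DERIV_gen DERIV_dgen simp: algebra_simps)
    have "1 - x \<le> exp (- (\<alpha> * \<rho>' x))"
    proof (cases "x < 1")
      case True
      then have "\<alpha> \<le> h_fun \<rho> x" using g(3,5) x by (cases "x = x0") (auto intro: less_imp_le)
      then have "\<alpha> * \<rho>' x \<le> - ln (1 - x)"
        using le_h_iff[of x] g(1) x True by simp
      then have "exp (ln (1 - x)) \<le> exp (- (\<alpha> * \<rho>' x))" by simp
      then show ?thesis using True by simp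
    qed (use x in auto)
    then have "\<alpha> * ddgen r p x * ((1 - x) - exp (- (\<alpha> * \<rho>' x))) \<le> 0"
      using \<alpha> ddgen_nonneg[of x] g x by (intro mult_nonneg_nonpos) auto
    with D show "\<exists>y. (bethe \<alpha> has_real_derivative y) (at x) \<and> y \<le> 0" by blast
  qed
  moreover have "bethe \<alpha> 1 > 0" using \<alpha> by (simp add: bethe_def gen_1[OF p] add_nonneg_pos)
  ultimately show ?thesis
    using psi_eq_bethe[OF g(1,2,3)] by (simp add: x0_def)
qed

text \<open>Integrate \<open>a * \<rho>' \<le> - ln (1 - x)\<close> from 0 to \<open>x\<close>, drop
  a nonpositive term to get \<open>a * \<rho> x \<le> x\<close>, and let \<open>x\<close> tend to 1,
  where \<rho> is 1.\<close>

lemma alpha_sharp_le_1: "alpha_sharp \<rho> \<le> 1"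
proof (rule ccontr)
  define a where "a = alpha_sharp \<rho>"
  assume "\<not> ?thesis"
  then have a: "1 < a" by (simp add: a_def)
  have bdd: "bdd_below (h_fun \<rho> ` {0<..<1})"
    by (intro bdd_belowI[of _ 0]) (use h_pos in \<open>force intro: less_imp_le\<close>)
  have h: "a * \<rho>' x \<le> - ln (1 - x)" if "0 < x" "x < 1" for x
  proof -
    have "a \<le> h_fun \<rho> x" unfolding a_def alpha_sharp_def using bdd that by (intro cINF_lower) auto
    then show ?thesis using le_h_iff that by simp
  qed
  \<comment> \<open>The antiderivative, up to a constant, of the difference
    \<open>- ln (1 - x) - a * \<rho>' x\<close>.\<close>
  define G where "G x = x + (1 - x) * ln (1 - x) - a * \<rho> x" for x
  have G: "0 \<le> G x" if x: "0 < x" "x < 1" for x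
  proof -
    have "G 0 \<le> G x"
    proof (rule DERIV_nonneg_imp_nondecreasing[where f = G])
      show "0 \<le> x" using x by simp
      fix y assume y: "0 \<le> y" "y \<le> x"
      have "(G has_real_derivative 1 + (- 1 * ln (1 - y) + (1 - y) * (- 1 / (1 - y))) - a * \<rho>' y) (at y)"
        unfolding G_def[abs_def] using y x
        by (auto intro!: derivative_eq_intros DERIV_gen)
      moreover have "1 + (- 1 * ln (1 - y) + (1 - y) * (- 1 / (1 - y))) - a * \<rho>' y = - ln (1 - y) - a * \<rho>' y"
        using y x by simp
      ultimately have "(G has_real_derivative - ln (1 - y) - a * \<rho>' y) (at y)" by simp
      moreover have "a * \<rho>' y \<le> - ln (1 - y)"
      proof (cases "y = 0")
        case True
        have "\<rho>' 0 = 0" unfolding dgen_def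
        proof (intro sum.neutral ballI)
          fix k show "p k * (real k * 0 ^ (k - 1)) = 0"
            using p_small[of k] by (cases "k < 3") (auto simp: power_0_left)
        qed
        then show ?thesis using True by simp
      qed (use h y x in auto)
      ultimately show "\<exists>z. (G has_real_derivative z) (at y) \<and> 0 \<le> z" by (metis diff_ge_0_iff_ge)
    qed
    then show ?thesis by (simp add: G_def gen_0)
  qed
  have le: "a * \<rho> x \<le> x" if "0 < x" "x < 1" for x
  proof -
    have "(1 - x) * ln (1 - x) \<le> 0" using that by (intro mult_nonneg_nonpos) auto
    then show ?thesis using G[OF that] by (simp add: G_def)
  qed
  have "a * \<rho> 1 \<le> 1"
  proof (rule tendsto_le[of "at_left 1" "\<lambda>x. x" _ "\<lambda>x. a * \<rho> x"])
    have "isCont \<rho> 1" by (rule DERIV_isCont[OF DERIV_gen])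
    then have "(\<rho> \<longlongrightarrow> \<rho> 1) (at_left 1)"
      unfolding isCont_def by (rule filterlim_mono[OF _ order_refl at_le]) simp
    then show "((\<lambda>x. a * \<rho> x) \<longlongrightarrow> a * \<rho> 1) (at_left 1)" by (intro tendsto_intros)
    show "\<forall>\<^sub>F x in at_left 1. a * \<rho> x \<le> x"
      using eventually_at_left_real[of 0 1, simplified] by eventually_elim (use le in auto)
  qed auto
  then show False using a by (simp add: gen_1[OF p])
qed

text \<open>The detour through \<open>1 + e\<close> meets the strict inequality
  \<open>\<alpha> > alpha_sharp \<rho>\<close>, as only \<open>alpha_sharp \<rho> \<le> 1\<close> is
  available.\<close>

lemma alpha_lower_le_1: "alpha_lower \<rho> \<le> 1"
proof (rule field_le_epsilon)
  fix e :: real assume "0 < e"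
  have "bdd_below {\<alpha>. \<alpha> > alpha_sharp \<rho> \<and> psi \<rho> (g_star \<rho> \<alpha>) < 0}"
    by (intro bdd_belowI[of _ "alpha_sharp \<rho>"]) auto
  then show "alpha_lower \<rho> \<le> 1 + e"
    unfolding alpha_lower_def using \<open>0 < e\<close> psi_g_star_neg[of "1 + e"] alpha_sharp_le_1
    by (intro cInf_lower) auto
qed

lemma ex_positive_bethe:
  assumes "0 < \<epsilon>"
  shows "\<exists>\<alpha> x. 0 < \<alpha> \<and> \<alpha> < alpha_lower \<rho> + \<epsilon> \<and> 0 < x \<and> x < 1 \<and> 0 < bethe \<alpha> x"
proof -
  let ?A = "{\<alpha>. \<alpha> > alpha_sharp \<rho> \<and> psi \<rho> (g_star \<rho> \<alpha>) < 0}"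
  \<comment> \<open>A witness that the infimum defining \<open>alpha_lower\<close> is over a
    nonempty set, hence approached by members.\<close>
  have "2 \<in> ?A" using psi_g_star_neg[of 2] alpha_sharp_le_1 by auto
  then obtain \<alpha> where \<alpha>: "\<alpha> \<in> ?A" "\<alpha> < alpha_lower \<rho> + \<epsilon>"
    using cInf_lessD[of ?A "alpha_lower \<rho> + \<epsilon>"] assms unfolding alpha_lower_def by auto
  then have s: "alpha_sharp \<rho> < \<alpha>" by simp
  note g = g_star_props[OF s]
  show ?thesis
    using g(1,2,4) \<alpha> psi_eq_bethe[OF g(1,2,3)] by (intro exI[of _ \<alpha>] exI[of _ "g_star \<rho> \<alpha>"]) auto
qed

end

section \<open>First moment of vanishing sums\<close>

definition zprob :: "nat \<Rightarrow> (nat \<Rightarrow> real) \<Rightarrow> nat set \<Rightarrow> real" where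
  "zprob n p S = (\<Sum>f\<in>PiE S (\<lambda>_. cube n). (\<Prod>i\<in>S. law n p (f i)) * (if (\<Sum>i\<in>S. f i) = 0 then 1 else 0))"

text \<open>The character given by the parity of the number of ones of \<open>v\<close> in
  \<open>Y\<close>, written as a product so that it can be compared coordinate by
  coordinate.\<close>

definition chi :: "nat \<Rightarrow> nat set \<Rightarrow> (nat \<Rightarrow> bit) \<Rightarrow> real" where
  "chi n Y v = (\<Prod>i<n. if i \<in> Y \<and> v i = 1 then -1 else 1)"

definition fourier :: "nat \<Rightarrow> (nat \<Rightarrow> real) \<Rightarrow> nat set \<Rightarrow> real" where
  "fourier n p Y = (\<Sum>v\<in>cube n. law n p v * chi n Y v)"

lemma chi_add: "chi n Y (v + w) = chi n Y v * chi n Y w"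
proof -
  have "(if i \<in> Y \<and> (v + w) i = 1 then -1 else 1) =
      (if i \<in> Y \<and> v i = 1 then -1 else 1) * (if i \<in> Y \<and> w i = 1 then -1 else (1::real))" for i
    by (cases "v i = 1"; cases "w i = 1") auto
  then show ?thesis unfolding chi_def by (simp flip: prod.distrib)
qed

lemma chi_0: "chi n Y 0 = 1"
  by (simp add: chi_def)

lemma chi_sum: "finite S \<Longrightarrow> chi n Y (\<Sum>i\<in>S. f i) = (\<Prod>i\<in>S. chi n Y (f i))"
proof (induction S rule: finite_induct)
  case empty
  show ?case unfolding sum.empty prod.empty by (rule chi_0)
next
  case (insert i S)
  then show ?case unfolding sum.insert[OF insert.hyps] prod.insert[OF insert.hyps] chi_add by simp
qed

lemma chi_eq:
  assumes "v \<in> cube n"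
  shows "chi n Y v = (\<Prod>i\<in>{i. v i = 1}. if i \<in> Y then -1 else 1)"
proof -
  have "chi n Y v = (\<Prod>i\<in>{i. v i = 1}. if i \<in> Y \<and> v i = 1 then -1 else 1)"
    unfolding chi_def by (rule prod.mono_neutral_right) (use support_subset[OF assms] in auto)
  also have "\<dots> = (\<Prod>i\<in>{i. v i = 1}. if i \<in> Y then -1 else 1)"
    by (intro prod.cong) auto
  finally show ?thesis .
qed

text \<open>Orthogonality of characters: the sum over \<open>Y\<close> is the expansion of a product
  whose factor at \<open>i\<close> is 2 if \<open>v i = 0\<close> and 0 if
  \<open>v i = 1\<close>.\<close>

lemma sum_chi:
  assumes v: "v \<in> cube n"
  shows "(\<Sum>Y\<in>Pow {..<n}. chi n Y v) = (if v = 0 then 2 ^ n else 0)"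
proof -
  have "chi n Y v = (\<Prod>i\<in>Y. if v i = 1 then -1 else 1) * (\<Prod>i\<in>{..<n} - Y. 1)" if "Y \<subseteq> {..<n}" for Y
  proof -
    have "chi n Y v = (\<Prod>i\<in>Y. if i \<in> Y \<and> v i = 1 then -1 else 1)"
      unfolding chi_def by (rule prod.mono_neutral_right) (use that in auto)
    then show ?thesis by (simp cong: prod.cong_simp)
  qed
  then have "(\<Sum>Y\<in>Pow {..<n}. chi n Y v) = (\<Prod>i<n. (if v i = 1 then -1 else 1) + 1)"
    by (subst prod_add) auto
  also have "\<dots> = (if v = 0 then 2 ^ n else 0)"
  proof (cases "v = 0")
    case False
    then obtain i where "v i \<noteq> 0" by (auto simp: fun_eq_iff)
    then have "v i = 1" by simp
    moreover have "i < n" using support_subset[OF v] \<open>v i = 1\<close> by auto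
    ultimately have "\<exists>i\<in>{..<n}. (if v i = 1 then -1 else 1) + 1 = (0::real)" by force
    then have "(\<Prod>i<n. (if v i = 1 then -1 else 1) + 1) = (0::real)" by (intro prod_zero) auto
    then show ?thesis using False by simp
  qed simp
  finally show ?thesis .
qed

lemma sum_in_cube: "(\<And>i. i \<in> S \<Longrightarrow> f i \<in> cube n) \<Longrightarrow> (\<Sum>i\<in>S. f i) \<in> cube n"
  by (induction S rule: infinite_finite_induct) (auto simp: cube_def)

text \<open>Orthogonality expresses the indicator of a zero sum through characters; these are
  multiplicative, so independence factors each term into equal factors, one for each index in
  \<open>S\<close>.\<close>

lemma zprob_fourier:
  assumes S: "finite S"
  shows "zprob n p S = (\<Sum>Y\<in>Pow {..<n}. fourier n p Y ^ card S) / 2 ^ n"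
proof -
  let ?P = "PiE S (\<lambda>_. cube n)"
  have "zprob n p S = (\<Sum>f\<in>?P. \<Sum>Y\<in>Pow {..<n}. (\<Prod>i\<in>S. law n p (f i) * chi n Y (f i)) / 2 ^ n)"
    unfolding zprob_def
  proof (intro sum.cong refl)
    fix f assume f: "f \<in> ?P"
    have "(\<Sum>i\<in>S. f i) \<in> cube n" using f by (intro sum_in_cube) auto
    from sum_chi[OF this]
    have "(if (\<Sum>i\<in>S. f i) = 0 then 1 else 0) = (\<Sum>Y\<in>Pow {..<n}. \<Prod>i\<in>S. chi n Y (f i)) / 2 ^ n"
      unfolding chi_sum[OF S] by auto
    then show "(\<Prod>i\<in>S. law n p (f i)) * (if (\<Sum>i\<in>S. f i) = 0 then 1 else 0) =
        (\<Sum>Y\<in>Pow {..<n}. (\<Prod>i\<in>S. law n p (f i) * chi n Y (f i)) / 2 ^ n)"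
      by (simp only: prod.distrib sum_divide_distrib[symmetric] sum_distrib_left[symmetric] times_divide_eq_right)
  qed
  also have "\<dots> = (\<Sum>Y\<in>Pow {..<n}. (\<Sum>f\<in>?P. \<Prod>i\<in>S. law n p (f i) * chi n Y (f i)) / 2 ^ n)"
    unfolding sum_divide_distrib by (rule sum.swap)
  also have "\<dots> = (\<Sum>Y\<in>Pow {..<n}. fourier n p Y ^ card S / 2 ^ n)"
  proof (intro sum.cong refl)
    fix Y
    have "(\<Sum>f\<in>?P. \<Prod>i\<in>S. law n p (f i) * chi n Y (f i)) = (\<Prod>i\<in>S. fourier n p Y)"
      unfolding fourier_def using S finite_cube by (intro prod_sum_PiE[symmetric]) auto
    then show "(\<Sum>f\<in>?P. \<Prod>i\<in>S. law n p (f i) * chi n Y (f i)) / 2 ^ n = fourier n p Y ^ card S / 2 ^ n"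
      by simp
  qed
  finally show ?thesis by (simp add: sum_divide_distrib)
qed

text \<open>The absolute mean of \<open>n\<close> signs of which \<open>j\<close> are negative. The
  absolute value identifies \<open>j\<close> with \<open>n - j\<close>, which brings \<gamma> into
  the range of \<open>F_fun\<close>.\<close>

definition bias :: "nat \<Rightarrow> nat \<Rightarrow> real" where
  "bias n j = \<bar>1 - 2 * real j / real n\<bar>"

lemma abs_gen_le:
  assumes "weight_probs r p"
  shows "\<bar>gen r p s\<bar> \<le> gen r p \<bar>s\<bar>"
  unfolding gen_def using assms
  by (intro order_trans[OF sum_abs] sum_mono) (auto simp: abs_mult power_abs weight_probs_def)

lemma fourier_le:
  assumes p: "weight_probs r p" and n: "r \<le> n" "0 < n" and Y: "Y \<subseteq> {..<n}"
  shows "\<bar>fourier n p Y\<bar> \<le> gen r p (bias n (card Y)) + (real r)\<^sup>2 / n"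
proof -
  define \<sigma> where "\<sigma> i = (if i \<in> Y then -1 else 1 :: real)" for i
  have f: "fourier n p Y = (\<Sum>v\<in>cube n. law n p v * (\<Prod>i\<in>{i. v i = 1}. \<sigma> i))"
    unfolding fourier_def \<sigma>_def by (intro sum.cong) (auto simp: chi_eq)
  have "(\<Sum>i<n. \<sigma> i) = (\<Sum>i<n. 1 - 2 * (if i \<in> Y then 1 else 0))"
    by (intro sum.cong) (auto simp: \<sigma>_def)
  also have "\<dots> = real n - 2 * real (card Y)"
    using Y by (simp add: sum_subtractf sum.If_cases Int_absorb1 flip: sum_distrib_left)
  finally have u: "(\<Sum>i<n. \<sigma> i) / n = 1 - 2 * real (card Y) / n"
    using n by (simp add: diff_divide_distrib)
  have s1: "\<bar>\<sigma> i\<bar> \<le> 1" for i by (simp add: \<sigma>_def)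
  have "\<bar>fourier n p Y - gen r p (1 - 2 * real (card Y) / n)\<bar> \<le> (real r)\<^sup>2 / n"
    using law_prod_approx[where \<sigma> = \<sigma>, OF p n s1] unfolding f u .
  then show ?thesis using abs_gen_le[OF p, of "1 - 2 * real (card Y) / n"]
    unfolding bias_def by linarith
qed

lemma fourier_le_1:
  assumes p: "weight_probs r p" and n: "r \<le> n"
  shows "\<bar>fourier n p Y\<bar> \<le> 1"
proof -
  have pw: "prob_weights (cube n) (law n p)" by (rule prob_weights_law[OF p n])
  have c: "\<bar>chi n Y v\<bar> = 1" for v unfolding chi_def abs_prod by (intro prod.neutral) auto
  have "\<bar>fourier n p Y\<bar> \<le> (\<Sum>v\<in>cube n. \<bar>law n p v * chi n Y v\<bar>)"
    unfolding fourier_def by (rule sum_abs)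
  also have "\<dots> = (\<Sum>v\<in>cube n. law n p v)"
    using pw by (intro sum.cong) (auto simp: abs_mult c prob_weights_def)
  finally show ?thesis using pw by (simp add: prob_weights_def)
qed

text \<open>A single term of the binomial expansion of 1. At \<open>\<gamma> = j / n\<close> it is
  the entropy bound for binomial coefficients.\<close>

lemma binomial_entropy_le:
  assumes "j \<le> n" "0 \<le> \<gamma>" "\<gamma> \<le> 1"
  shows "real (n choose j) * \<gamma> ^ j * (1 - \<gamma>) ^ (n - j) \<le> 1"
proof -
  have "real (n choose j) * \<gamma> ^ j * (1 - \<gamma>) ^ (n - j) \<le> (\<Sum>k\<le>n. real (n choose k) * \<gamma> ^ k * (1 - \<gamma>) ^ (n - k))"
    using assms by (intro member_le_sum[of j "{..n}" "\<lambda>k. real (n choose k) * \<gamma> ^ k * (1 - \<gamma>) ^ (n - k)"]) auto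
  also have "\<dots> = (\<gamma> + (1 - \<gamma>)) ^ n" by (subst binomial_ring) simp
  finally show ?thesis by simp
qed

lemma sum_subsets_by_card:
  fixes f :: "nat \<Rightarrow> real"
  assumes "finite T"
  shows "(\<Sum>S\<in>{S. S \<subseteq> T \<and> P (card S)}. f (card S)) =
    (\<Sum>s\<in>{s. s \<le> card T \<and> P s}. real (card T choose s) * f s)"
proof -
  let ?A = "{S. S \<subseteq> T \<and> P (card S)}" and ?B = "{s. s \<le> card T \<and> P s}"
  have fin: "finite ?A" using assms by (intro finite_subset[of ?A "Pow T"]) auto
  have "(\<Sum>S\<in>?A. f (card S)) = (\<Sum>s\<in>?B. \<Sum>S\<in>{S \<in> ?A. card S = s}. f (card S))"
  proof (rule sum.group[symmetric])
    show "card ` ?A \<subseteq> ?B" using assms card_mono by auto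
  qed (use fin in auto)
  also have "\<dots> = (\<Sum>s\<in>?B. real (card T choose s) * f s)"
  proof (intro sum.cong refl)
    fix s assume s: "s \<in> ?B"
    then have "{S \<in> ?A. card S = s} = {S. S \<subseteq> T \<and> card S = s}" by auto
    then have "card {S \<in> ?A. card S = s} = card T choose s" using n_subsets[OF assms, of s] by simp
    then show "(\<Sum>S\<in>{S \<in> ?A. card S = s}. f (card S)) = real (card T choose s) * f s" by simp
  qed
  finally show ?thesis .
qed

section \<open>Small subsets: doubly covered supports\<close>

lemma sum_fun_at: "(\<Sum>i\<in>S. f i) x = (\<Sum>i\<in>S. (f i x :: 'b :: comm_monoid_add))"
  by (induction S rule: infinite_finite_induct) auto

text \<open>A uniform \<open>k\<close>-subset of \<open>n\<close> points lies in a given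
  \<open>b\<close>-subset with probability at most \<open>(b / n) ^ k\<close>; multiplied out to
  stay in the natural numbers.\<close>

lemma binomial_ratio_le:
  assumes "b \<le> n"
  shows "(b choose k) * n ^ k \<le> (n choose k) * b ^ k"
proof (induction k)
  case (Suc k)
  have "(b - k) * n \<le> (n - k) * b"
    unfolding diff_mult_distrib mult.commute[of n b] using assms
    by (intro diff_le_mono2 mult_le_mono2)
  then have "((b - k) * n) * ((b choose k) * n ^ k) \<le> ((n - k) * b) * ((n choose k) * b ^ k)"
    using Suc by (rule mult_le_mono)
  moreover have "Suc k * (c choose Suc k) = (c - k) * (c choose k)" for c
    by (simp only: binomial_absorption binomial_absorb_comp)
  ultimately have "(Suc k * (b choose Suc k)) * n ^ Suc k \<le> (Suc k * (n choose Suc k)) * b ^ Suc k"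
    by (simp add: mult_ac)
  then show ?case by (simp only: mult.assoc mult_le_cancel1)
qed simp

lemma power_self_le_fact: "real b ^ b \<le> exp (real b) * fact b"
proof -
  have "(\<Sum>k\<in>{b}. inverse (fact k) * real b ^ k) \<le> (\<Sum>k. inverse (fact k) * real b ^ k)"
    using summable_exp[of "real b"] by (intro sum_le_suminf) auto
  also have "\<dots> = exp (real b)" by (simp add: exp_def)
  finally have "real b ^ b / fact b \<le> exp (real b)" by (simp add: field_simps)
  then show ?thesis by (simp add: pos_divide_le_eq)
qed

text \<open>The bound \<open>(e m / s)^s\<close> for \<open>m choose s\<close>, stated without
  division.\<close>

lemma binomial_mult_power_le: "real (m choose s) * real s ^ s \<le> (exp 1 * real m) ^ s"
proof -
  have "real (m choose s) * real s ^ s \<le> real (m choose s) * (exp (real s) * fact s)"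
    using power_self_le_fact by (intro mult_left_mono) auto
  also have "\<dots> = exp (real s) * real ((m choose s) * fact s)" by simp
  also have "\<dots> \<le> exp (real s) * real (m ^ s)"
    using binomial_fact_pow[of m s] by (intro mult_left_mono) (simp_all only: of_nat_le_iff exp_ge_zero)
  also have "\<dots> = (exp 1 * real m) ^ s"
    by (simp add: power_mult_distrib exp_of_nat_mult[of s 1, simplified])
  finally show ?thesis .
qed

text \<open>At a point of the union a single one cannot cancel, so at least two vectors have a one
  there; then count incidences in two ways.\<close>

lemma twice_union_le_sum_weights:
  fixes f :: "nat \<Rightarrow> nat \<Rightarrow> bit"
  assumes S: "finite S" and f: "\<And>i. i \<in> S \<Longrightarrow> f i \<in> cube n" and z: "(\<Sum>i\<in>S. f i) = 0"
  shows "2 * card (\<Union>i\<in>S. {x. f i x = 1}) \<le> (\<Sum>i\<in>S. weight (f i))"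
proof -
  let ?U = "\<Union>i\<in>S. {x. f i x = 1}"
  have U: "finite ?U"
    using S support_subset[OF f] by (auto intro: finite_subset[OF _ finite_lessThan])
  have two: "2 \<le> card {i \<in> S. f i x = 1}" if x: "x \<in> ?U" for x
  proof -
    have "{i \<in> S. f i x = 1} \<noteq> {}" using x by auto
    then have "card {i \<in> S. f i x = 1} \<noteq> 0" using S by simp
    moreover have "card {i \<in> S. f i x = 1} \<noteq> 1"
    proof
      assume "card {i \<in> S. f i x = 1} = 1"
      then obtain j where j: "{i \<in> S. f i x = 1} = {j}" by (rule card_1_singletonE)
      have "(\<Sum>i\<in>S. f i x) = (\<Sum>i\<in>{i \<in> S. f i x = 1}. f i x)"
        using S by (intro sum.mono_neutral_right) auto
      also have "\<dots> = 1" using j by auto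
      finally show False using z by (metis sum_fun_at zero_fun_apply zero_neq_one)
    qed
    ultimately show ?thesis by linarith
  qed
  have "2 * card ?U = (\<Sum>x\<in>?U. 2)" by simp
  also have "\<dots> \<le> (\<Sum>x\<in>?U. \<Sum>i\<in>S. if f i x = 1 then 1 else 0)"
  proof (rule sum_mono)
    fix x assume "x \<in> ?U"
    from two[OF this] show "2 \<le> (\<Sum>i\<in>S. if f i x = 1 then 1 else (0::nat))"
      using S by (simp add: sum.If_cases Int_def)
  qed
  also have "\<dots> = (\<Sum>i\<in>S. \<Sum>x\<in>?U. if f i x = 1 then 1 else 0)" by (rule sum.swap)
  also have "\<dots> = (\<Sum>i\<in>S. weight (f i))"
  proof (intro sum.cong refl)
    fix i assume "i \<in> S"
    then have "?U \<inter> {x. f i x = 1} = {x. f i x = 1}" by auto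
    then show "(\<Sum>x\<in>?U. if f i x = 1 then 1 else 0) = weight (f i)"
      using U by (simp add: sum.If_cases weight_def)
  qed
  finally show ?thesis .
qed

definition covered :: "nat \<Rightarrow> nat set \<Rightarrow> (nat \<Rightarrow> bit) \<Rightarrow> real" where
  "covered n U v = (if {x. v x = 1} \<subseteq> U then (real n / real (card U)) ^ weight v else 0)"

text \<open>A uniform vector of weight \<open>k\<close> is supported in \<open>U\<close> with
  probability at most \<open>(card U / n) ^ k\<close>, which the power in \<open>covered\<close>
  just compensates.\<close>

lemma sum_law_covered_le:
  assumes p: "weight_probs r p" and n: "r \<le> n" and U: "U \<subseteq> {..<n}" "U \<noteq> {}"
  shows "(\<Sum>v\<in>cube n. law n p v * covered n U v) \<le> 1"
proof -
  have fin: "finite U" using U by (auto intro: finite_subset)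
  have b: "0 < card U" "card U \<le> n" using fin U card_mono[of "{..<n}" U] by auto
  have "(\<Sum>A\<in>ksets n k. covered n U (ind A)) / real (n choose k) \<le> 1" if k: "k \<le> n" for k
  proof -
    have "(\<Sum>A\<in>ksets n k. covered n U (ind A)) = (\<Sum>A\<in>ksets n k. if A \<subseteq> U then (real n / real (card U)) ^ k else 0)"
      by (intro sum.cong refl) (auto simp: covered_def Collect_ind weight_ind ksets_def)
    also have "\<dots> = real (card {A. A \<subseteq> U \<and> card A = k}) * (real n / real (card U)) ^ k"
    proof -
      have "ksets n k \<inter> {A. A \<subseteq> U} = {A. A \<subseteq> U \<and> card A = k}" using U by (auto simp: ksets_def)
      then show ?thesis by (simp add: sum.If_cases finite_ksets)
    qed
    also have "\<dots> = real ((card U choose k) * n ^ k) / real (card U) ^ k"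
      by (simp add: n_subsets[OF fin] power_divide)
    also have "\<dots> \<le> real ((n choose k) * card U ^ k) / real (card U) ^ k"
      using binomial_ratio_le[OF b(2)] by (intro divide_right_mono) (simp_all only: of_nat_le_iff zero_le_power of_nat_0_le_iff)
    also have "\<dots> = real (n choose k)" using b by simp
    finally show ?thesis using k by (simp add: divide_le_eq_1 zero_less_binomial)
  qed
  then have "(\<Sum>v\<in>cube n. law n p v * covered n U v) \<le> (\<Sum>k\<le>r. p k * 1)"
    unfolding sum_law[OF p n] using p n
    by (intro sum_mono mult_left_mono) (auto simp: weight_probs_def)
  also have "\<dots> = 1" using p by (simp add: weight_probs_def)
  finally show ?thesis .
qed

text \<open>Vectors with vanishing sum cover every point of the union of their supports at least twice, so
  this union is small; the first moment over the possible unions \<open>U\<close> bounds the probability. The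
  factor \<^term>\<open>covered\<close> tilts the law so that the total weight need not be conditioned on.\<close>

lemma zprob_le_cover_sum:
  assumes p: "weight_probs r p" and p3: "\<And>k. k < 3 \<Longrightarrow> p k = 0" and n: "r \<le> n"
    and S: "finite S" "S \<noteq> {}"
  shows "zprob n p S \<le> (\<Sum>b\<in>{b. b \<le> n \<and> 1 \<le> b \<and> b \<le> r * card S}.
    real (n choose b) * (real b / n) ^ max (2 * b) (3 * card S))"
proof -
  let ?P = "PiE S (\<lambda>_. cube n)"
  define s where "s = card S"
  define \<U> where "\<U> = {U. U \<subseteq> {..<n} \<and> (1 \<le> card U \<and> card U \<le> r * s)}"
  have fin: "finite \<U>" by (rule finite_subset[of _ "Pow {..<n}"]) (auto simp: \<U>_def)
  \<comment> \<open>Two lower bounds for the total weight: \<open>2 * card U\<close> by double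
    covering, and \<open>3 * s\<close> because each vector has weight at least 3.\<close>
  define e where "e U = max (2 * card U) (3 * s)" for U :: "nat set"
  have law0: "0 \<le> law n p v" for v using p by (simp add: law_def weight_probs_def)
  have cov0: "0 \<le> covered n U v" for U v by (simp add: covered_def)
  have le: "(\<Prod>i\<in>S. law n p (f i)) * (if (\<Sum>i\<in>S. f i) = 0 then 1 else 0) \<le>
      (\<Sum>U\<in>\<U>. (real (card U) / n) ^ e U * (\<Prod>i\<in>S. law n p (f i) * covered n U (f i)))"
    (is "?l \<le> (\<Sum>U\<in>\<U>. ?t U)") if f: "f \<in> ?P" for f
  proof (cases "(\<Sum>i\<in>S. f i) = 0 \<and> (\<Prod>i\<in>S. law n p (f i)) \<noteq> 0")
    case True
    define U where "U = (\<Union>i\<in>S. {x. f i x = 1})"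
    have fc: "f i \<in> cube n" if "i \<in> S" for i using f that by auto
    have w: "3 \<le> weight (f i)" "weight (f i) \<le> r" if "i \<in> S" for i
    proof -
      have "law n p (f i) \<noteq> 0" using True S that by auto
      then have "p (weight (f i)) \<noteq> 0" by (auto simp: law_def)
      then show "3 \<le> weight (f i)" "weight (f i) \<le> r"
        using p3 p by (auto simp: weight_probs_def not_le[symmetric])
    qed
    have Un: "U \<subseteq> {..<n}" using support_subset[OF fc] by (auto simp: U_def)
    then have Ufin: "finite U" by (auto intro: finite_subset)
    obtain i where "i \<in> S" using S by auto
    then have "3 \<le> card {x. f i x = 1}" using w by (simp add: weight_def)
    also have "\<dots> \<le> card U" using Ufin \<open>i \<in> S\<close> by (intro card_mono) (auto simp: U_def)
    finally have U3: "3 \<le> card U" .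
    have "card U \<le> (\<Sum>i\<in>S. card {x. f i x = 1})" unfolding U_def using S by (intro card_UN_le)
    also have "\<dots> \<le> (\<Sum>i\<in>S. r)" using w by (intro sum_mono) (auto simp: weight_def)
    finally have "card U \<le> r * s" by (simp add: s_def mult.commute)
    then have UU: "U \<in> \<U>" using Un U3 by (simp add: \<U>_def)
    have "card U \<le> n" using card_mono[OF _ Un] by simp
    then have \<beta>: "0 < real (card U) / n" "real (card U) / n \<le> 1" using U3 by auto
    define t where "t = (\<Sum>i\<in>S. weight (f i))"
    have "(\<Sum>i\<in>S. 3) \<le> t" unfolding t_def using w by (intro sum_mono)
    then have et: "e U \<le> t"
      using twice_union_le_sum_weights[OF S(1) fc] True
      by (simp add: e_def s_def t_def U_def mult.commute)
    have "covered n U (f i) = (real n / card U) ^ weight (f i)" if "i \<in> S" for i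
      using that by (auto simp: covered_def U_def)
    \<comment> \<open>The factors \<open>covered\<close> are the inverse of
      \<open>card U / n\<close> to the power of the total weight \<open>t\<close>. As
      \<open>card U / n\<close> is at most 1, the exponent may be lowered from the random
      \<open>t\<close> to \<open>e U\<close>, which leaves a product of at least 1.\<close>
    then have "(\<Prod>i\<in>S. covered n U (f i)) = (real n / card U) ^ t"
      unfolding t_def power_sum by (intro prod.cong) auto
    moreover have "(real (card U) / n) ^ t * (real n / card U) ^ t = 1"
      using \<beta> U3 unfolding power_mult_distrib[symmetric] by (auto simp: field_simps)
    moreover have "(real (card U) / n) ^ t * (real n / card U) ^ t \<le> (real (card U) / n) ^ e U * (real n / card U) ^ t"
      using et \<beta> by (intro mult_right_mono power_decreasing) auto
    ultimately have "1 \<le> (real (card U) / n) ^ e U * (\<Prod>i\<in>S. covered n U (f i))" by simp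
    then have "(\<Prod>i\<in>S. law n p (f i)) * 1 \<le> (\<Prod>i\<in>S. law n p (f i)) * ((real (card U) / n) ^ e U * (\<Prod>i\<in>S. covered n U (f i)))"
      using law0 by (intro mult_left_mono prod_nonneg) auto
    then have "?l \<le> ?t U" using True by (simp add: prod.distrib mult_ac)
    also have "?t U \<le> (\<Sum>U\<in>\<U>. ?t U)"
      using UU fin law0 cov0 by (intro member_le_sum mult_nonneg_nonneg prod_nonneg) auto
    finally show ?thesis .
  next
    case False
    then have "?l = 0" by auto
    also have "0 \<le> (\<Sum>U\<in>\<U>. ?t U)"
      using law0 cov0 by (intro sum_nonneg mult_nonneg_nonneg prod_nonneg) auto
    finally show ?thesis .
  qed
  have "zprob n p S \<le> (\<Sum>f\<in>?P. \<Sum>U\<in>\<U>. (real (card U) / n) ^ e U * (\<Prod>i\<in>S. law n p (f i) * covered n U (f i)))"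
    unfolding zprob_def by (intro sum_mono le)
  also have "\<dots> = (\<Sum>U\<in>\<U>. (real (card U) / n) ^ e U * (\<Sum>f\<in>?P. \<Prod>i\<in>S. law n p (f i) * covered n U (f i)))"
    unfolding sum_distrib_left by (rule sum.swap)
  also have "\<dots> \<le> (\<Sum>U\<in>\<U>. (real (card U) / n) ^ e U * 1)"
  proof (intro sum_mono mult_left_mono)
    fix U assume "U \<in> \<U>"
    then have U: "U \<subseteq> {..<n}" "U \<noteq> {}" by (auto simp: \<U>_def)
    have "(\<Sum>f\<in>?P. \<Prod>i\<in>S. law n p (f i) * covered n U (f i)) =
        (\<Prod>i\<in>S. \<Sum>v\<in>cube n. law n p v * covered n U v)"
      using S finite_cube by (intro prod_sum_PiE[symmetric]) auto
    also have "\<dots> \<le> 1"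
      using sum_law_covered_le[OF p n U] law0 cov0
      by (intro prod_le_1 conjI sum_nonneg mult_nonneg_nonneg) auto
    finally show "(\<Sum>f\<in>?P. \<Prod>i\<in>S. law n p (f i) * covered n U (f i)) \<le> 1" .
  qed auto
  also have "\<dots> = (\<Sum>b\<in>{b. b \<le> n \<and> 1 \<le> b \<and> b \<le> r * s}. real (n choose b) * (real b / n) ^ max (2 * b) (3 * s))"
    unfolding \<U>_def e_def
    using sum_subsets_by_card[where T = "{..<n}" and P = "\<lambda>b. 1 \<le> b \<and> b \<le> r * s" and f = "\<lambda>b. (real b / n) ^ max (2 * b) (3 * s)"]
    by simp
  finally show ?thesis by (simp add: s_def)
qed

text \<open>Of the exponent \<open>max (2 * b) (3 * s)\<close>, a part \<open>b\<close> cancels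
  \<open>n choose b\<close> up to \<open>exp b\<close>, and what remains is at least
  \<open>3s/2\<close>, whence the square root. The number of values of \<open>b\<close> is at most
  \<open>r * s\<close>, absorbed into a second exponential.\<close>

lemma zprob_le:
  assumes p: "weight_probs r p" and p3: "\<And>k. k < 3 \<Longrightarrow> p k = 0" and n: "r \<le> n" "0 < n"
    and S: "finite S" "S \<noteq> {}"
  defines "s \<equiv> card S"
  shows "zprob n p S \<le> exp (2 * real (r * s)) * sqrt (real (r * s) / n) ^ (3 * s)"
proof -
  let ?B = "{b. b \<le> n \<and> 1 \<le> b \<and> b \<le> r * s}"
  let ?c = "exp (real (r * s)) * sqrt (real (r * s) / n) ^ (3 * s)"
  have "real (n choose b) * (real b / n) ^ max (2 * b) (3 * s) \<le> ?c" if b: "b \<in> ?B" for b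
  proof -
    define M where "M = max (2 * b) (3 * s)"
    define z where "z = sqrt (real b / n)"
    have z: "0 \<le> z" "z \<le> 1" "real b / n = z ^ 2" "z \<le> sqrt (real (r * s) / n)"
    proof -
      have "real b \<le> real (r * s)" using b by (simp del: of_nat_mult)
      then have "real b / n \<le> real (r * s) / n" by (rule divide_right_mono) simp
      then show "z \<le> sqrt (real (r * s) / n)" unfolding z_def by (rule real_sqrt_le_mono)
    qed (use b n in \<open>auto simp: z_def\<close>)
    have M: "M = b + (M - b)" "3 * s \<le> 2 * (M - b)" by (auto simp: M_def)
    have "real (n choose b) * (real b / n) ^ M = real (n choose b) * (real b / n) ^ b * (real b / n) ^ (M - b)"
      by (subst M(1)) (simp only: power_add mult.assoc)
    also have "\<dots> \<le> exp (real b) * sqrt (real (r * s) / n) ^ (3 * s)"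
    proof (intro mult_mono)
      have "real (n choose b) * real b ^ b \<le> exp (real b) * real n ^ b"
        using binomial_mult_power_le[of n b]
        by (simp add: power_mult_distrib exp_of_nat_mult[of b 1, simplified])
      then show "real (n choose b) * (real b / n) ^ b \<le> exp (real b)"
        using n by (simp add: power_divide pos_divide_le_eq)
      have "(real b / n) ^ (M - b) = z ^ (2 * (M - b))" by (simp only: z(3) power_mult)
      also have "\<dots> \<le> z ^ (3 * s)" using z M by (intro power_decreasing) auto
      also have "\<dots> \<le> sqrt (real (r * s) / n) ^ (3 * s)" using z by (intro power_mono) auto
      finally show "(real b / n) ^ (M - b) \<le> sqrt (real (r * s) / n) ^ (3 * s)" .
    qed auto
    also have "\<dots> \<le> ?c"
    proof (intro mult_right_mono)
      have "real b \<le> real (r * s)" using b by (simp del: of_nat_mult)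
      then show "exp (real b) \<le> exp (real (r * s))" by (simp del: of_nat_mult)
    qed simp
    finally show ?thesis by (simp only: M_def)
  qed
  then have "zprob n p S \<le> (\<Sum>b\<in>?B. ?c)"
    using zprob_le_cover_sum[OF p p3 n(1) S] unfolding s_def[symmetric]
    by (meson order_trans sum_mono)
  also have "\<dots> = real (card ?B) * ?c" by simp
  also have "\<dots> \<le> exp (real (r * s)) * ?c"
  proof (intro mult_right_mono)
    have "card ?B \<le> card {1..r * s}" by (intro card_mono) auto
    then have "real (card ?B) \<le> real (r * s)" by (simp only: card_atLeastAtMost diff_Suc_1 of_nat_le_iff)
    also have "\<dots> \<le> exp (real (r * s))" using exp_ge_add_one_self[of "real (r * s)"] by linarith
    finally show "real (card ?B) \<le> exp (real (r * s))" .
  qed simp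
  also have "\<dots> = exp (2 * real (r * s)) * sqrt (real (r * s) / n) ^ (3 * s)"
    by (simp add: mult.assoc[symmetric] exp_add[symmetric])
  finally show ?thesis .
qed

text \<open>Collected factors per vector: \<open>exp 1 * A\<close> from \<open>m choose s\<close>,
  \<open>exp (2 * r)\<close> from \<open>zprob_le\<close>, and \<open>r\<close> to the power 3/2
  from its cubed square root.\<close>

definition small_const :: "nat \<Rightarrow> real \<Rightarrow> real" where
  "small_const r A = exp 1 * A * exp (2 * real r) * (real r * sqrt (real r))"

text \<open>The count of subsets contributes \<open>n / s\<close> per vector, the double covering
  \<open>(s / n)\<close> to the power 3/2; their product leaves the square root.\<close>

lemma binomial_zprob_le:
  assumes p: "weight_probs r p" and p3: "\<And>k. k < 3 \<Longrightarrow> p k = 0" and n: "r \<le> n" "0 < n"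
    and S: "finite S" "S \<noteq> {}" and m: "real m \<le> A * real n"
  defines "s \<equiv> card S"
  shows "real (m choose s) * zprob n p S \<le> (small_const r A * sqrt (real s / n)) ^ s"
proof -
  have s: "0 < real s" using S by (simp add: s_def card_gt_0_iff)
  have c: "real (m choose s) \<le> (exp 1 * (A * n) / s) ^ s"
  proof -
    have "real (m choose s) * real s ^ s \<le> (exp 1 * real m) ^ s" by (rule binomial_mult_power_le)
    also have "\<dots> \<le> (exp 1 * (A * n)) ^ s" using m by (intro power_mono mult_left_mono) auto
    finally show ?thesis using s by (simp add: power_divide pos_le_divide_eq)
  qed
  have e: "exp (2 * real (r * s)) = exp (2 * real r) ^ s"
    using exp_of_nat_mult[of s "2 * real r"] by (simp add: mult_ac)
  have "sqrt (real (r * s) / n) ^ 3 = real (r * s) / n * sqrt (real (r * s) / n)"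
    by (simp add: power3_eq_cube)
  also have "\<dots> = (s / n) * (real r * sqrt r) * sqrt (real s / n)"
    by (simp add: real_sqrt_mult real_sqrt_divide)
  finally have q: "sqrt (real (r * s) / n) ^ (3 * s) = ((s / n) * (real r * sqrt r) * sqrt (real s / n)) ^ s"
    by (simp add: power_mult)
  have "real (m choose s) * zprob n p S \<le>
      (exp 1 * (A * n) / s) ^ s * (exp (2 * real r) ^ s * ((s / n) * (real r * sqrt r) * sqrt (real s / n)) ^ s)"
    using c zprob_le[OF p p3 n S] unfolding s_def[symmetric] e q
    by (intro mult_mono) (auto simp: zprob_def intro!: sum_nonneg mult_nonneg_nonneg prod_nonneg
        divide_nonneg_nonneg simp: law_def p[unfolded weight_probs_def])
  also have "\<dots> = (small_const r A * sqrt (real s / n)) ^ s"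
    unfolding power_mult_distrib[symmetric] small_const_def using s n(2) by (intro arg_cong[of _ _ "\<lambda>x. x ^ s"]) simp
  finally show ?thesis .
qed

lemma sum_arith_geo: "(\<Sum>s=1..L. real s * (1 / 2) ^ (s - 1)) = 4 - 2 * (real L + 2) * (1 / 2) ^ L"
proof (induction L)
  case (Suc L)
  show ?case unfolding sum.cl_ivl_Suc Suc by (simp add: field_simps)
qed simp

text \<open>The terms are \<open>y ^ s\<close> with \<open>y \<le> 1/2\<close>. One factor is
  bounded by \<open>small_const r A * s / sqrt n\<close> instead, which yields the decay in
  \<open>n\<close>; the others make an arithmetic-geometric series of sum at most 4.\<close>

lemma small_dependencies_le:
  assumes p: "weight_probs r p" and p3: "\<And>k. k < 3 \<Longrightarrow> p k = 0" and n: "r \<le> n" "0 < n"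
    and m: "real m \<le> A * real n" and A: "0 \<le> A"
    and L: "small_const r A * sqrt (real L / n) \<le> 1 / 2"
  shows "(\<Sum>S\<in>{S. S \<subseteq> {1..m} \<and> (1 \<le> card S \<and> card S \<le> L)}. zprob n p S) \<le> 4 * small_const r A / sqrt n"
proof -
  let ?K = "small_const r A"
  have K: "0 \<le> ?K" using A by (simp add: small_const_def)
  \<comment> \<open>Divided by the binomial coefficient, which summation over the subsets of each
    size restores.\<close>
  define c where "c s = (?K * sqrt (real s / n)) ^ s / real (m choose s)" for s
  have "(\<Sum>S\<in>{S. S \<subseteq> {1..m} \<and> (1 \<le> card S \<and> card S \<le> L)}. zprob n p S) \<le>
      (\<Sum>S\<in>{S. S \<subseteq> {1..m} \<and> (1 \<le> card S \<and> card S \<le> L)}. c (card S))"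
  proof (rule sum_mono)
    fix S assume "S \<in> {S. S \<subseteq> {1..m} \<and> (1 \<le> card S \<and> card S \<le> L)}"
    then have S: "S \<subseteq> {1..m}" "finite S" "S \<noteq> {}" by (auto intro: finite_subset)
    have "card S \<le> m" using card_mono[OF _ S(1)] by simp
    then show "zprob n p S \<le> c (card S)"
      using binomial_zprob_le[OF p p3 n S(2,3) m] by (simp add: c_def pos_le_divide_eq zero_less_binomial mult.commute)
  qed
  also have "\<dots> = (\<Sum>s\<in>{s. s \<le> m \<and> 1 \<le> s \<and> s \<le> L}. real (m choose s) * c s)"
    using sum_subsets_by_card[where T = "{1..m}" and P = "\<lambda>s. 1 \<le> s \<and> s \<le> L" and f = c] by simp
  also have "\<dots> \<le> (\<Sum>s\<in>{s. s \<le> m \<and> 1 \<le> s \<and> s \<le> L}. ?K / sqrt n * (real s * (1 / 2) ^ (s - 1)))"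
  proof (rule sum_mono)
    fix s assume s: "s \<in> {s. s \<le> m \<and> 1 \<le> s \<and> s \<le> L}"
    define y where "y = ?K * sqrt (real s / n)"
    have "y \<le> ?K * sqrt (real L / n)"
      unfolding y_def using s K by (intro mult_left_mono real_sqrt_le_mono divide_right_mono) auto
    then have y: "0 \<le> y" "y \<le> 1 / 2" using L K by (auto simp: y_def)
    have "sqrt (real s) \<le> real s" using s real_sqrt_le_mono[of "real s" "real s * real s"] by auto
    then have y2: "y \<le> ?K / sqrt n * real s"
      unfolding y_def using K by (auto simp: real_sqrt_divide intro!: divide_right_mono mult_left_mono)
    have "real (m choose s) * c s = y ^ s" using s by (auto simp: c_def y_def)
    also have "\<dots> = y * y ^ (s - 1)" using s by (cases s) auto
    also have "\<dots> \<le> ?K / sqrt n * real s * (1 / 2) ^ (s - 1)"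
      using y y2 K by (intro mult_mono power_mono) auto
    finally show "real (m choose s) * c s \<le> ?K / sqrt n * (real s * (1 / 2) ^ (s - 1))" by (simp only: mult.assoc)
  qed
  also have "\<dots> \<le> (\<Sum>s=1..L. ?K / sqrt n * (real s * (1 / 2) ^ (s - 1)))"
    using K by (intro sum_mono2) auto
  also have "\<dots> \<le> ?K / sqrt n * 4"
    unfolding sum_distrib_left[symmetric] sum_arith_geo using K by (intro mult_left_mono) auto
  finally show ?thesis by (simp add: mult.commute)
qed

section \<open>Asymptotics of the expected rank\<close>

lemma floor_linear_tendsto:
  assumes "0 < \<alpha>"
  shows "(\<lambda>n. real (nat \<lfloor>\<alpha> * real n\<rfloor>) / real n) \<longlonglongrightarrow> \<alpha>"
proof (rule tendsto_sandwich)
  show "\<forall>\<^sub>F n in sequentially. (\<alpha> * real n - 1) / real n \<le> real (nat \<lfloor>\<alpha> * real n\<rfloor>) / real n"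
    by (intro always_eventually allI divide_right_mono) linarith+
  show "\<forall>\<^sub>F n in sequentially. real (nat \<lfloor>\<alpha> * real n\<rfloor>) / real n \<le> \<alpha>"
    using eventually_gt_at_top[of 0]
  proof eventually_elim
    case (elim n)
    have "real (nat \<lfloor>\<alpha> * real n\<rfloor>) \<le> \<alpha> * real n" using assms by simp
    then show ?case using elim by (simp add: pos_divide_le_eq)
  qed
  show "(\<lambda>n. (\<alpha> * real n - 1) / real n) \<longlonglongrightarrow> \<alpha>" by real_asymp
qed simp

context heavy_weights
begin

text \<open>After division by \<open>n\<close>, the gap between \<open>m n\<close> and the expected
  rank is bounded below by a quantity tending to \<open>bethe \<alpha> x\<close>. A gap of linear
  size makes the Chebyshev bound of order \<open>1 / n\<close>.\<close>

lemma late_dependence_bound_tendsto: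
  fixes pn :: "nat \<Rightarrow> nat \<Rightarrow> real"
  assumes pn: "\<forall>\<^sub>F n in sequentially. weight_probs r (pn n)"
    and lim: "\<And>k. (\<lambda>n. pn n k) \<longlonglongrightarrow> p k"
    and \<alpha>: "0 < \<alpha>" and x: "0 < x" "x < 1" and \<beta>: "0 < bethe \<alpha> x"
  defines "m \<equiv> \<lambda>n. nat \<lfloor>\<alpha> * real n\<rfloor>"
  defines "\<mu> \<equiv> \<lambda>n. (mstep 1 (cube n) (law n (pn n)) ^^ m n) rk {}"
  shows "\<forall>\<^sub>F n in sequentially. \<mu> n < real (m n)"
    and "(\<lambda>n. real (m n) / (real (m n) - \<mu> n)\<^sup>2) \<longlonglongrightarrow> 0"
proof -
  define d where "d = \<rho>' x"
  have d: "0 < d" using dgen_pos x by (simp add: d_def)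
  \<comment> \<open>Any positive integer at least \<open>d\<close> will do, to make
    \<open>d / K\<close> a probability; it drops out of the limit, since
    \<open>K * q = d\<close>.\<close>
  define K where "K = nat \<lceil>d\<rceil>"
  have K: "d \<le> real K" "0 < K" using d by (auto simp: K_def)
  define q where "q = d / real K"
  have q: "0 < q" using d K by (simp add: q_def)
  define e where "e n = (\<Sum>k\<le>r. \<bar>pn n k - p k\<bar>)" for n
  have e: "e \<longlonglongrightarrow> 0"
    unfolding e_def[abs_def] using lim by (intro tendsto_null_sum tendsto_rabs_zero LIM_zero)
  \<comment> \<open>Intercept of the tangent of \<rho> at \<open>x\<close>, lowered by
    \<open>e n\<close> so that the line stays below the generating function of
    \<open>pn n\<close>.\<close>
  define g where "g n = \<rho> x - d * x - e n" for n
  define R where "R n = real (m n) * (1 - g n - d + (real r)\<^sup>2 / n)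
      + n * (1 - (1 - d / K / n) ^ (K * m n)) + sqrt (real (m n))" for n
  have a: "(\<lambda>n. real (m n) / real n) \<longlonglongrightarrow> \<alpha>"
    unfolding m_def using \<alpha> by (rule floor_linear_tendsto)
  have R: "\<forall>\<^sub>F n in sequentially. \<mu> n \<le> R n"
    using pn eventually_ge_at_top[of r] eventually_gt_at_top[of 0]
  proof eventually_elim
    case (elim n)
    have "g n + d * y \<le> gen r (pn n) y" if y: "0 \<le> y" "y \<le> 1" for y
    proof -
      have "\<rho> x + d * (y - x) \<le> \<rho> y" unfolding d_def using gen_above_tangent[OF p] x y by simp
      moreover have "\<bar>gen r (pn n) y - \<rho> y\<bar> \<le> e n" unfolding e_def using y by (intro gen_diff_le) auto
      ultimately show ?thesis by (simp add: g_def algebra_simps)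
    qed
    then show ?case
      unfolding \<mu>_def R_def using elim d K by (intro expected_rk_le) auto
  qed
  \<comment> \<open>This is \<open>(m n - R n) / n\<close>, rearranged into terms with evident
    limits.\<close>
  define L where "L n = real (m n) / n * (g n + d - (real r)\<^sup>2 / n) - 1 + (1 - q / n) ^ (K * m n)
      - sqrt (real (m n) / n * (1 / n))" for n
  have "(\<lambda>n. (1 - q / real n) ^ (K * m n)) \<longlonglongrightarrow> exp (real K * \<alpha> * (- q))"
  proof (rule Lim_transform_eventually)
    have "(\<lambda>n. real n * ln (1 - q / real n)) \<longlonglongrightarrow> - q" using q by real_asymp
    then show "(\<lambda>n. exp (real K * (real (m n) / n) * (n * ln (1 - q / n)))) \<longlonglongrightarrow> exp (real K * \<alpha> * (- q))"
      using a by (intro tendsto_intros)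
    obtain n0 :: nat where n0: "q < real n0" using reals_Archimedean2 by blast
    show "\<forall>\<^sub>F n in sequentially. exp (real K * (real (m n) / n) * (n * ln (1 - q / n))) = (1 - q / real n) ^ (K * m n)"
      using eventually_ge_at_top[of n0] eventually_gt_at_top[of 0]
    proof eventually_elim
      case (elim n)
      then have "q / n < 1" using n0 by simp
      then have "(1 - q / n) ^ (K * m n) = exp (real (K * m n) * ln (1 - q / n))"
        by (simp add: exp_of_nat_mult del: of_nat_mult)
      then show ?case using elim by simp
    qed
  qed
  also have "real K * \<alpha> * (- q) = - (\<alpha> * d)" using K by (simp add: q_def)
  finally have pow: "(\<lambda>n. (1 - q / real n) ^ (K * m n)) \<longlonglongrightarrow> exp (- (\<alpha> * d))" .
  have "(\<lambda>n. (real r)\<^sup>2 / real n) \<longlonglongrightarrow> 0" "(\<lambda>n. 1 / real n) \<longlonglongrightarrow> 0" by real_asymp+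
  then have "L \<longlonglongrightarrow> \<alpha> * ((\<rho> x - d * x - 0) + d - 0) - 1 + exp (- (\<alpha> * d)) - sqrt (\<alpha> * 0)"
    unfolding L_def[abs_def] g_def using a pow e by (intro tendsto_intros)
  also have "\<alpha> * ((\<rho> x - d * x - 0) + d - 0) - 1 + exp (- (\<alpha> * d)) - sqrt (\<alpha> * 0) = bethe \<alpha> x"
    by (simp add: bethe_def d_def algebra_simps)
  finally have "L \<longlonglongrightarrow> bethe \<alpha> x" .
  then have "\<forall>\<^sub>F n in sequentially. bethe \<alpha> x / 2 < L n"
    by (rule order_tendstoD(1)) (use \<beta> in simp)
  then have gap: "\<forall>\<^sub>F n in sequentially. 0 < real n \<and> bethe \<alpha> x / 2 * real n \<le> real (m n) - \<mu> n"
    using R eventually_gt_at_top[of 0]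
  proof eventually_elim
    case (elim n)
    have "real n * sqrt (real (m n) / n * (1 / n)) = sqrt (real (m n))"
      using elim by (simp add: real_sqrt_divide)
    moreover have "real n * L n = real n * (real (m n) / n) * (g n + d - (real r)\<^sup>2 / n) - real n
        + real n * (1 - q / n) ^ (K * m n) - real n * sqrt (real (m n) / n * (1 / n))"
      unfolding L_def by (simp only: algebra_simps)
    moreover have "real n * (real (m n) / n) = real (m n)" using elim by simp
    ultimately have "real n * L n = real (m n) - R n"
      unfolding R_def q_def by (simp only: algebra_simps)
    moreover have "bethe \<alpha> x / 2 * real n \<le> real n * L n" using elim by simp
    ultimately show ?case using elim by simp
  qed
  then show "\<forall>\<^sub>F n in sequentially. \<mu> n < real (m n)"
  proof eventually_elim
    case (elim n)
    have "0 < bethe \<alpha> x / 2 * real n" using \<beta> elim by simp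
    then show ?case using elim by linarith
  qed
  show "(\<lambda>n. real (m n) / (real (m n) - \<mu> n)\<^sup>2) \<longlonglongrightarrow> 0"
  proof (rule tendsto_sandwich)
    show "\<forall>\<^sub>F n in sequentially. 0 \<le> real (m n) / (real (m n) - \<mu> n)\<^sup>2" by simp
    show "\<forall>\<^sub>F n in sequentially. real (m n) / (real (m n) - \<mu> n)\<^sup>2 \<le> \<alpha> / (bethe \<alpha> x / 2)\<^sup>2 * (1 / real n)"
      using gap
    proof eventually_elim
      case (elim n)
      have "0 < bethe \<alpha> x / 2 * real n" using \<beta> elim by simp
      moreover have "real (m n) \<le> \<alpha> * real n" using \<alpha> by (simp add: m_def)
      ultimately have "real (m n) / (real (m n) - \<mu> n)\<^sup>2 \<le> (\<alpha> * real n) / (bethe \<alpha> x / 2 * real n)\<^sup>2"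
        using elim by (intro frac_le power_mono) auto
      also have "\<dots> = \<alpha> / (bethe \<alpha> x / 2)\<^sup>2 * (1 / real n)"
        using elim by (simp add: power2_eq_square)
      finally show ?case .
    qed
    show "(\<lambda>n. \<alpha> / (bethe \<alpha> x / 2)\<^sup>2 * (1 / real n)) \<longlonglongrightarrow> 0"
      by (intro tendsto_mult_right_zero lim_1_over_n)
  qed simp
qed

end

section \<open>The two tail bounds\<close>

lemma (in random_bit_vectors) prob_early_dependence_le:
  assumes w: "w \<in> measurable N (count_space UNIV)"
  shows "\<P>(\<omega> in M. first_dependence (\<lambda>i. X i \<omega>) \<le> m) \<le>
    (\<Sum>S\<in>{S. S \<subseteq> {1..m} \<and> S \<noteq> {}}. zprob n weight_prob S)"
proof -
  let ?A = "{S. S \<subseteq> {1..m} \<and> S \<noteq> {}}"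
  let ?E = "\<lambda>S. {\<omega> \<in> space M. (\<Sum>i\<in>S. restrict (\<lambda>i. X i \<omega>) S i) = 0}"
  have fin: "finite ?A" by (rule finite_subset[of _ "Pow {1..m}"]) auto
  have S: "finite S" "S \<subseteq> {1..}" if "S \<in> ?A" for S using that by (auto intro: finite_subset)
  have ev: "?E S \<in> events" if "S \<in> ?A" for S
    by (rule prob_event(1)[OF S[OF that] w, of "\<lambda>f. (\<Sum>i\<in>S. f i) = 0"])
  have restr: "(\<Sum>i\<in>S. restrict g S i) = (\<Sum>i\<in>S. g i)" for S and g :: "nat \<Rightarrow> nat \<Rightarrow> bit"
    by (intro sum.cong) auto
  have "{\<omega> \<in> space M. first_dependence (\<lambda>i. X i \<omega>) \<le> m} \<subseteq> (\<Union>S\<in>?A. ?E S)"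
  proof
    fix \<omega> assume \<omega>: "\<omega> \<in> {\<omega> \<in> space M. first_dependence (\<lambda>i. X i \<omega>) \<le> m}"
    then obtain S where "S \<subseteq> {1..m}" "S \<noteq> {}" "(\<Sum>i\<in>S. X i \<omega>) = 0"
      using vanishing_sum_of_first_dependence[of "\<lambda>i. X i \<omega>" n m] X_in_cube by blast
    then show "\<omega> \<in> (\<Union>S\<in>?A. ?E S)" using \<omega> unfolding restr by blast
  qed
  then have "\<P>(\<omega> in M. first_dependence (\<lambda>i. X i \<omega>) \<le> m) \<le> prob (\<Union>S\<in>?A. ?E S)"
    using ev fin by (intro finite_measure_mono sets.finite_UN) auto
  also have "\<dots> \<le> (\<Sum>S\<in>?A. prob (?E S))"
    using ev fin by (intro finite_measure_subadditive_finite) auto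
  also have "\<dots> = (\<Sum>S\<in>?A. zprob n weight_prob S)"
  proof (intro sum.cong refl)
    fix S assume "S \<in> ?A"
    from prob_event(2)[OF S[OF this] w, of "\<lambda>f. (\<Sum>i\<in>S. f i) = 0"]
    show "prob (?E S) = zprob n weight_prob S" unfolding zprob_def .
  qed
  finally show ?thesis .
qed

text \<open>Converts the entropy factors of \<open>F_fun\<close> into the powers of the binomial
  theorem; at \<open>i = 0\<close> this relies on the convention for \<open>0^0\<close>.\<close>

lemma rpow_fraction_power:
  assumes "0 < n"
  shows "rpow (real i / real n) (real i / real n) ^ n = (real i / real n) ^ i"
proof (cases "i = 0")
  case False
  define x where "x = real i / real n"
  have x: "0 < x" "x * real n = real i" using False assms by (auto simp: x_def)
  have "rpow x x ^ n = (x powr x) powr real n"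
    using x(1) powr_realpow[of "x powr x" n] by (simp add: rpow_def)
  also have "\<dots> = x ^ i" unfolding powr_powr x(2) by (rule powr_realpow[OF x(1)])
  finally show ?thesis by (simp only: x_def)
qed (simp add: rpow_def)

lemma rpow_nonneg: "0 \<le> rpow x a"
  by (simp add: rpow_def)

lemma bias_eq:
  assumes "j \<le> n" "0 < n"
  shows "bias n j = 1 - 2 * (real (min j (n - j)) / real n)"
proof (cases "2 * j \<le> n")
  case True
  then have "2 * real j / real n \<le> 1" using assms by (simp add: pos_divide_le_eq)
  then show ?thesis using True by (simp add: bias_def min_def)
next
  case False
  then have "1 \<le> 2 * real j / real n" using assms by (simp add: pos_le_divide_eq)
  moreover have "real (n - j) / n = 1 - real j / n" using assms by (simp add: of_nat_diff diff_divide_distrib)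
  moreover have "min j (n - j) = n - j" using False by simp
  ultimately show ?thesis by (simp add: bias_def)
qed

lemma bias_le_1: "j \<le> n \<Longrightarrow> 0 < n \<Longrightarrow> bias n j \<le> 1"
  by (simp add: bias_eq)

text \<open>A crude bound (the minimum is \<open>exp (- 1 / e)\<close>) that keeps the denominator
  in \<open>F_fun\<close> away from zero, so that the supremum is over a bounded set.\<close>

lemma rpow_self_ge:
  assumes "0 \<le> \<gamma>"
  shows "exp (- 1) \<le> rpow \<gamma> \<gamma>"
proof (cases "\<gamma> = 0")
  case False
  then have g: "0 < \<gamma>" using assms by simp
  have "ln (1 / \<gamma>) \<le> 1 / \<gamma> - 1" using g by (intro ln_le_minus_one) simp
  then have "\<gamma> * ln (1 / \<gamma>) \<le> \<gamma> * (1 / \<gamma> - 1)" using g by (intro mult_left_mono) auto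
  also have "\<dots> = 1 - \<gamma>" using g by (simp add: algebra_simps)
  finally have "- 1 \<le> \<gamma> * ln \<gamma>" using g by (simp add: ln_div)
  then show ?thesis using g by (simp add: rpow_def powr_def)
qed (simp add: rpow_def)

context heavy_weights
begin

lemma entropy_bound_of_less_alpha_star:
  assumes \<alpha>: "0 < \<alpha>" "\<alpha> < alpha_star \<rho>" and \<gamma>: "0 \<le> \<gamma>" "\<gamma> \<le> 1 / 2"
  shows "(1 + \<rho> (1 - 2 * \<gamma>)) powr \<alpha> \<le> 2 * rpow \<gamma> \<gamma> * rpow (1 - \<gamma>) (1 - \<gamma>)"
proof -
  define f where "f \<gamma> = rpow (1 + \<rho> (1 - 2 * \<gamma>)) \<alpha> / (2 * rpow \<gamma> \<gamma> * rpow (1 - \<gamma>) (1 - \<gamma>))" for \<gamma>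
  have f0: "0 < 2 * rpow g g * rpow (1 - g) (1 - g)" if "0 \<le> g" "g \<le> 1 / 2" for g
    using rpow_self_ge[of g] rpow_self_ge[of "1 - g"] that exp_gt_zero[of "- 1 :: real"]
    by (intro mult_pos_pos) linarith+
  have bdd: "bdd_above (f ` {0..1/2})"
  proof (rule bdd_aboveI2)
    fix g :: real assume g: "g \<in> {0..1/2}"
    have "\<rho> (1 - 2 * g) \<le> \<rho> 1" "0 \<le> \<rho> (1 - 2 * g)" using g by (auto intro!: gen_mono[OF p] gen_nonneg[OF p])
    then have "rpow (1 + \<rho> (1 - 2 * g)) \<alpha> \<le> 2 powr \<alpha>"
      using \<alpha> gen_1[OF p] by (auto simp: rpow_def intro!: powr_mono2)
    moreover have "2 * exp (- 1) * exp (- 1) \<le> 2 * rpow g g * rpow (1 - g) (1 - g)"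
      using rpow_self_ge[of g] rpow_self_ge[of "1 - g"] g by (intro mult_mono) (auto simp: rpow_nonneg)
    ultimately show "f g \<le> 2 powr \<alpha> / (2 * exp (- 1) * exp (- 1))"
      unfolding f_def by (intro frac_le) auto
  qed
  \<comment> \<open>This value makes the supremum at least 1, so that a nonpositive logarithm does
    force it to be at most 1.\<close>
  have "f (1 / 2) = 1"
  proof -
    have "rpow (1 / 2) (1 / 2) * rpow (1 / 2) (1 / 2) = (1 / 2 :: real)"
      by (simp add: rpow_def powr_add[symmetric])
    then show ?thesis using \<alpha> by (simp add: f_def gen_0 rpow_def)
  qed
  then have "1 \<le> Sup (f ` {0..1/2})" using bdd by (metis atLeastAtMost_iff cSUP_upper divide_nonneg_nonneg order_refl zero_le_numeral zero_le_one)
  moreover have "ln (Sup (f ` {0..1/2})) \<le> 0"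
  proof (rule ccontr)
    assume "\<not> ?thesis"
    then have "\<alpha> \<in> {\<alpha>. 0 \<le> \<alpha> \<and> F_fun \<rho> \<alpha> > 0}" using \<alpha> by (simp add: F_fun_def f_def)
    then have "alpha_star \<rho> \<le> \<alpha>" unfolding alpha_star_def by (rule cInf_lower) (auto intro: bdd_belowI[of _ 0])
    then show False using \<alpha> by simp
  qed
  ultimately have "Sup (f ` {0..1/2}) \<le> 1" by simp
  moreover have "f \<gamma> \<le> Sup (f ` {0..1/2})" using bdd \<gamma> by (intro cSUP_upper) auto
  ultimately have "f \<gamma> \<le> 1" by linarith
  then have "rpow (1 + \<rho> (1 - 2 * \<gamma>)) \<alpha> \<le> 2 * rpow \<gamma> \<gamma> * rpow (1 - \<gamma>) (1 - \<gamma>)"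
    using f0[OF \<gamma>] by (simp add: f_def pos_divide_le_eq)
  then show ?thesis using \<alpha> by (simp add: rpow_def)
qed

lemma binomial_gen_power_le:
  assumes j: "j \<le> n" "0 < n" and \<eta>: "0 < \<eta>" "\<eta> < bias n j"
    and \<alpha>: "0 \<le> \<alpha>1" "\<alpha>1 \<le> \<alpha>2" "0 < \<alpha>2" "\<alpha>2 < alpha_star \<rho>" and m: "real m \<le> \<alpha>1 * n"
  shows "real (n choose j) * (1 + \<rho> (bias n j)) ^ m \<le> 2 ^ n * (1 + \<rho> \<eta>) powr (- ((\<alpha>2 - \<alpha>1) * n))"
proof -
  define i where "i = min j (n - j)"
  define \<gamma> where "\<gamma> = real i / real n"
  have i: "i \<le> n" "2 * i \<le> n" using j by (auto simp: i_def)
  have "2 * real i \<le> real n" using i by linarith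
  then have \<gamma>: "0 \<le> \<gamma>" "\<gamma> \<le> 1 / 2" using j by (auto simp: \<gamma>_def pos_divide_le_eq)
  have b: "bias n j = 1 - 2 * \<gamma>" using bias_eq[OF j] by (simp add: \<gamma>_def i_def)
  have ch: "n choose j = n choose i" using binomial_symmetric[OF j(1)] by (auto simp: i_def min_def)
  define c where "c = 1 + \<rho> (bias n j)"
  have c: "1 + \<rho> \<eta> \<le> c" "1 < 1 + \<rho> \<eta>"
    using gen_mono[OF p, of \<eta> "bias n j"] gen_pos[OF \<eta>(1)] \<eta> by (auto simp: c_def)
  have g1: "1 - \<gamma> = real (n - i) / real n" using i j by (simp add: \<gamma>_def of_nat_diff diff_divide_distrib)
  have "c ^ m = c powr real m" using c by (simp add: powr_realpow)
  also have "\<dots> \<le> c powr (\<alpha>1 * n)" using c m by (intro powr_mono) auto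
  also have "\<dots> = (c powr \<alpha>2) ^ n * c powr (- ((\<alpha>2 - \<alpha>1) * n))"
    using c by (simp add: powr_realpow[symmetric] powr_powr powr_add[symmetric] algebra_simps)
  also have "\<dots> \<le> (2 * rpow \<gamma> \<gamma> * rpow (1 - \<gamma>) (1 - \<gamma>)) ^ n * (1 + \<rho> \<eta>) powr (- ((\<alpha>2 - \<alpha>1) * n))"
    using entropy_bound_of_less_alpha_star[OF \<alpha>(3,4) \<gamma>] c \<alpha> j unfolding b[symmetric] c_def[symmetric]
    by (intro mult_mono power_mono powr_mono2') (auto simp: rpow_nonneg)
  also have "(2 * rpow \<gamma> \<gamma> * rpow (1 - \<gamma>) (1 - \<gamma>)) ^ n = 2 ^ n * (\<gamma> ^ i * (1 - \<gamma>) ^ (n - i))"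
  proof -
    have "rpow \<gamma> \<gamma> ^ n = \<gamma> ^ i" unfolding \<gamma>_def by (rule rpow_fraction_power[OF j(2)])
    moreover have "rpow (1 - \<gamma>) (1 - \<gamma>) ^ n = (1 - \<gamma>) ^ (n - i)"
      unfolding g1 by (rule rpow_fraction_power[OF j(2)])
    ultimately show ?thesis by (simp add: power_mult_distrib)
  qed
  finally have "real (n choose j) * c ^ m \<le>
      real (n choose i) * (2 ^ n * (\<gamma> ^ i * (1 - \<gamma>) ^ (n - i)) * (1 + \<rho> \<eta>) powr (- ((\<alpha>2 - \<alpha>1) * n)))"
    unfolding ch by (intro mult_left_mono) auto
  also have "\<dots> = (real (n choose i) * \<gamma> ^ i * (1 - \<gamma>) ^ (n - i)) * (2 ^ n * (1 + \<rho> \<eta>) powr (- ((\<alpha>2 - \<alpha>1) * n)))"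
    by (simp only: mult_ac)
  also have "\<dots> \<le> 1 * (2 ^ n * (1 + \<rho> \<eta>) powr (- ((\<alpha>2 - \<alpha>1) * n)))"
    using binomial_entropy_le[OF i(1)] \<gamma> by (intro mult_right_mono) auto
  finally show ?thesis by (simp add: c_def)
qed

text \<open>Split the characters \<open>Y\<close> by their bias. If it is at most \<eta>, every
  power is at most \<open>\<tau> ^ Suc L\<close> and there are at most \<open>2 ^ m\<close> subsets.
  Otherwise sum over all sizes: the binomial theorem gives \<open>(1 + y) ^ m\<close>, and averaging
  over \<open>Y\<close> leads to \<open>binomial_gen_power_le\<close>.\<close>

lemma large_dependencies_le:
  assumes q: "weight_probs r q" and n: "r \<le> n" "0 < n"
    and \<epsilon>: "(\<Sum>k\<le>r. \<bar>q k - p k\<bar>) + (real r)\<^sup>2 / n \<le> \<epsilon>" and \<eta>: "0 < \<eta>" "\<eta> < 1" "\<eta> + \<epsilon> \<le> \<tau>" "\<tau> \<le> 1"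
    and \<alpha>: "0 \<le> \<alpha>1" "\<alpha>1 \<le> \<alpha>2" "0 < \<alpha>2" "\<alpha>2 < alpha_star \<rho>" and m: "real m \<le> \<alpha>1 * n"
  shows "(\<Sum>S\<in>{S. S \<subseteq> {1..m} \<and> L < card S}. zprob n q S) \<le>
    2 ^ m * \<tau> ^ Suc L + (real n + 1) * ((1 + \<epsilon>) ^ m * (1 + \<rho> \<eta>) powr (- ((\<alpha>2 - \<alpha>1) * n)))"
proof -
  let ?A = "{S. S \<subseteq> {1..m} \<and> L < card S}" and ?B = "{s. s \<le> m \<and> L < s}"
  let ?w = "(1 + \<rho> \<eta>) powr (- ((\<alpha>2 - \<alpha>1) * n))"
  have "0 \<le> (\<Sum>k\<le>r. \<bar>q k - p k\<bar>) + (real r)\<^sup>2 / n" by (intro add_nonneg_nonneg sum_nonneg) auto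
  then have \<epsilon>0: "0 \<le> \<epsilon>" using \<epsilon> by linarith
  then have \<tau>0: "0 < \<tau>" using \<eta> by linarith
  define D where "D j = (if \<eta> < bias n j then (1 + \<rho> (bias n j)) ^ m * (1 + \<epsilon>) ^ m else 0)" for j
  have Yb: "(\<Sum>s\<in>?B. real (m choose s) * fourier n q Y ^ s) \<le> 2 ^ m * \<tau> ^ Suc L + D (card Y)"
    if Y: "Y \<in> Pow {..<n}" for Y
  proof -
    define y where "y = \<bar>fourier n q Y\<bar>"
    define b where "b = bias n (card Y)"
    have jn: "card Y \<le> n" using Y card_mono[of "{..<n}" Y] by auto
    have b: "0 \<le> b" "b \<le> 1" using bias_le_1[OF jn n(2)] by (auto simp: b_def bias_def)
    have "\<bar>gen r q b - \<rho> b\<bar> \<le> (\<Sum>k\<le>r. \<bar>q k - p k\<bar>)" using b by (intro gen_diff_le) auto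
    moreover have "y \<le> gen r q b + (real r)\<^sup>2 / n"
      unfolding y_def b_def using Y by (intro fourier_le[OF q n]) auto
    ultimately have y: "y \<le> \<rho> b + \<epsilon>" using \<epsilon> by linarith
    have y01: "0 \<le> y" "y \<le> 1" using fourier_le_1[OF q n(1)] by (auto simp: y_def)
    have "(\<Sum>s\<in>?B. real (m choose s) * fourier n q Y ^ s) \<le> (\<Sum>s\<in>?B. real (m choose s) * y ^ s)"
      unfolding y_def by (intro sum_mono mult_left_mono) (auto simp: power_abs[symmetric])
    also have "\<dots> \<le> 2 ^ m * \<tau> ^ Suc L + D (card Y)"
    proof (cases "\<eta> < b")
      case False
      have "\<rho> b \<le> \<rho> \<eta>" using False b by (intro gen_mono[OF p]) auto
      also have "\<dots> \<le> \<eta> ^ 3" using \<eta> by (intro gen_le_cube) auto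
      also have "\<dots> \<le> \<eta> ^ 1" using \<eta> by (intro power_decreasing) auto
      finally have y_le: "y \<le> \<tau>" using y \<eta> by simp
      have "y ^ s \<le> \<tau> ^ Suc L" if "s \<in> ?B" for s
      proof -
        have "y ^ s \<le> \<tau> ^ s" using y_le y01 by (intro power_mono) auto
        also have "\<dots> \<le> \<tau> ^ Suc L" using that \<tau>0 \<eta> by (intro power_decreasing) auto
        finally show ?thesis .
      qed
      then have "(\<Sum>s\<in>?B. real (m choose s) * y ^ s) \<le> (\<Sum>s\<in>?B. real (m choose s) * \<tau> ^ Suc L)"
        by (intro sum_mono mult_left_mono) auto
      also have "\<dots> \<le> (\<Sum>s\<le>m. real (m choose s) * \<tau> ^ Suc L)"
        using \<tau>0 by (intro sum_mono2) auto
      also have "\<dots> = real (\<Sum>s\<le>m. m choose s) * \<tau> ^ Suc L"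
        unfolding sum_distrib_right[symmetric] by (simp only: of_nat_sum)
      also have "\<dots> = 2 ^ m * \<tau> ^ Suc L" by (simp only: choose_row_sum of_nat_power of_nat_numeral)
      finally show ?thesis using False by (simp add: D_def b_def[symmetric])
    next
      case True
      have "(\<Sum>s\<in>?B. real (m choose s) * y ^ s) \<le> (\<Sum>s\<le>m. real (m choose s) * y ^ s)"
        using y01 by (intro sum_mono2) auto
      also have "\<dots> = (y + 1) ^ m" by (subst binomial_ring) simp
      also have "\<dots> \<le> ((1 + \<rho> b) * (1 + \<epsilon>)) ^ m"
      proof (intro power_mono)
        have "0 \<le> \<rho> b * \<epsilon>" using gen_nonneg[OF p b(1)] \<epsilon>0 by simp
        then show "y + 1 \<le> (1 + \<rho> b) * (1 + \<epsilon>)" using y by (simp add: algebra_simps)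
      qed (use y01 in auto)
      also have "\<dots> = D (card Y)" using True by (simp add: D_def b_def[symmetric] power_mult_distrib)
      also have "\<dots> \<le> 2 ^ m * \<tau> ^ Suc L + D (card Y)" using \<tau>0 by simp
      finally show ?thesis .
    qed
    finally show ?thesis .
  qed
  have fin: "finite S" if "S \<in> ?A" for S using that by (auto intro: finite_subset)
  have "(\<Sum>S\<in>?A. zprob n q S) = (\<Sum>S\<in>?A. \<Sum>Y\<in>Pow {..<n}. fourier n q Y ^ card S / 2 ^ n)"
  proof (intro sum.cong refl)
    fix S assume "S \<in> ?A"
    from zprob_fourier[OF fin[OF this]]
    show "zprob n q S = (\<Sum>Y\<in>Pow {..<n}. fourier n q Y ^ card S / 2 ^ n)"
      by (simp add: sum_divide_distrib)
  qed
  also have "\<dots> = (\<Sum>Y\<in>Pow {..<n}. \<Sum>S\<in>?A. fourier n q Y ^ card S / 2 ^ n)" by (rule sum.swap)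
  also have "\<dots> = (\<Sum>Y\<in>Pow {..<n}. (\<Sum>s\<in>?B. real (m choose s) * fourier n q Y ^ s)) / 2 ^ n"
    unfolding sum_divide_distrib
    using sum_subsets_by_card[where T = "{1..m}" and P = "\<lambda>s. L < s" and f = "\<lambda>s. fourier n q Y ^ s / 2 ^ n" for Y]
    by (intro sum.cong refl) simp
  also have "\<dots> \<le> (\<Sum>Y\<in>Pow {..<n}. 2 ^ m * \<tau> ^ Suc L + D (card Y)) / 2 ^ n"
    using Yb by (intro divide_right_mono sum_mono) auto
  also have "(\<Sum>Y\<in>Pow {..<n}. 2 ^ m * \<tau> ^ Suc L + D (card Y)) =
      2 ^ n * (2 ^ m * \<tau> ^ Suc L) + (\<Sum>j\<le>n. real (n choose j) * D j)"
  proof -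
    have "Pow {..<n} = {Y. Y \<subseteq> {..<n} \<and> True}" "{..n} = {j. j \<le> n \<and> True}" by auto
    then have "(\<Sum>Y\<in>Pow {..<n}. D (card Y)) = (\<Sum>j\<le>n. real (n choose j) * D j)"
      using sum_subsets_by_card[where T = "{..<n}" and P = "\<lambda>_. True" and f = D] by simp
    then show ?thesis by (simp add: sum.distrib card_Pow)
  qed
  also have "\<dots> \<le> 2 ^ n * (2 ^ m * \<tau> ^ Suc L) + (\<Sum>j\<le>n. 2 ^ n * ((1 + \<epsilon>) ^ m * ?w))"
  proof (intro add_left_mono sum_mono)
    fix j assume "j \<in> {..n}"
    then have j: "j \<le> n" by simp
    show "real (n choose j) * D j \<le> 2 ^ n * ((1 + \<epsilon>) ^ m * ?w)"
    proof (cases "\<eta> < bias n j")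
      case True
      have "real (n choose j) * D j = (real (n choose j) * (1 + \<rho> (bias n j)) ^ m) * (1 + \<epsilon>) ^ m"
        using True by (simp add: D_def)
      also have "\<dots> \<le> (2 ^ n * ?w) * (1 + \<epsilon>) ^ m"
        using binomial_gen_power_le[OF j n(2) \<eta>(1) True \<alpha> m] \<epsilon>0 by (intro mult_right_mono) auto
      finally show ?thesis by (simp only: mult_ac)
    next
      case False
      then show ?thesis using \<epsilon>0 by (simp add: D_def)
    qed
  qed
  also have "(\<Sum>j\<le>n. 2 ^ n * ((1 + \<epsilon>) ^ m * ?w)) = 2 ^ n * ((real n + 1) * ((1 + \<epsilon>) ^ m * ?w))"
    by (simp add: algebra_simps)
  finally show ?thesis by (simp add: divide_right_mono add_divide_distrib)
qed

lemma early_dependence_bound_tendsto: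
  fixes pn :: "nat \<Rightarrow> nat \<Rightarrow> real"
  assumes pn: "\<forall>\<^sub>F n in sequentially. weight_probs r (pn n) \<and> (\<forall>k<3. pn n k = 0)"
    and lim: "\<And>k. (\<lambda>n. pn n k) \<longlonglongrightarrow> p k"
    and \<alpha>: "0 < \<alpha>" "\<alpha> < alpha_star \<rho>"
  defines "m \<equiv> \<lambda>n. nat \<lfloor>\<alpha> * real n\<rfloor>"
  shows "\<exists>B. B \<longlonglongrightarrow> 0 \<and>
    (\<forall>\<^sub>F n in sequentially. (\<Sum>S\<in>{S. S \<subseteq> {1..m n} \<and> S \<noteq> {}}. zprob n (pn n) S) \<le> B n)"
proof -
  define \<alpha>2 where "\<alpha>2 = (\<alpha> + alpha_star \<rho>) / 2"
  have \<alpha>2: "\<alpha> < \<alpha>2" "\<alpha>2 < alpha_star \<rho>" "0 < \<alpha>2" using \<alpha> by (auto simp: \<alpha>2_def)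
  define K where "K = small_const r \<alpha>"
  have K: "0 \<le> K" using \<alpha> by (simp add: K_def small_const_def)
  \<comment> \<open>Chosen for the requirement of \<open>small_dependencies_le\<close> at sizes up
    to \<open>\<delta> * n\<close>; \<open>K + 1\<close> avoids a zero denominator.\<close>
  define \<delta> where "\<delta> = (1 / (2 * (K + 1)))\<^sup>2"
  have \<delta>: "0 < \<delta>" using K by (simp add: \<delta>_def)
  have K\<delta>: "K * sqrt \<delta> \<le> 1 / 2"
  proof -
    have sq: "sqrt \<delta> = 1 / (2 * (K + 1))" unfolding \<delta>_def real_sqrt_abs using K by simp
    show ?thesis unfolding sq using K by (simp add: field_simps)
  qed
  define L where "L n = nat \<lfloor>\<delta> * real n\<rfloor>" for n
  \<comment> \<open>Solves \<open>2 powr \<alpha> * \<tau> powr \<delta> = 1 / 2\<close>, so that on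
    larger subsets \<tau> beats their number by a factor \<open>2 powr (- n)\<close>.\<close>
  define \<tau> where "\<tau> = 2 powr (- ((\<alpha> + 1) / \<delta>))"
  have \<tau>: "0 < \<tau>" "\<tau> < 1"
  proof -
    have "\<tau> < 2 powr 0" unfolding \<tau>_def using \<alpha> \<delta> by (intro powr_less_mono) auto
    then show "\<tau> < 1" by simp
  qed (simp add: \<tau>_def)
  \<comment> \<open>The other half of \<tau> is room for the error \<open>e n\<close>.\<close>
  define \<eta> where "\<eta> = \<tau> / 2"
  have \<eta>: "0 < \<eta>" "\<eta> < 1" using \<tau> by (auto simp: \<eta>_def)
  define e where "e n = (\<Sum>k\<le>r. \<bar>pn n k - p k\<bar>) + (real r)\<^sup>2 / n" for n
  have "(\<lambda>n. (real r)\<^sup>2 / real n) \<longlonglongrightarrow> 0" by real_asymp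
  moreover have "(\<lambda>n. \<Sum>k\<le>r. \<bar>pn n k - p k\<bar>) \<longlonglongrightarrow> 0"
    using lim by (intro tendsto_null_sum tendsto_rabs_zero LIM_zero)
  ultimately have e: "e \<longlonglongrightarrow> 0" unfolding e_def[abs_def] using tendsto_add_zero by blast
  \<comment> \<open>Half of the available exponential rate; the other half pays for
    \<open>(1 + e n) ^ m n\<close>, which is at most \<open>exp (\<omega> * n)\<close> once
    \<open>e n < \<omega> / \<alpha>\<close>.\<close>
  define \<omega> where "\<omega> = (\<alpha>2 - \<alpha>) * ln (1 + \<rho> \<eta>) / 2"
  have \<omega>: "0 < \<omega>" unfolding \<omega>_def using \<alpha>2 gen_pos[OF \<eta>(1)] by (intro divide_pos_pos mult_pos_pos) auto
  define B where "B n = 4 * K / sqrt (real n) + (2 powr (- real n) + (real n + 1) * exp (- (\<omega> * real n)))" for n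
  have "(\<lambda>n. 4 * K / sqrt (real n)) \<longlonglongrightarrow> 0" by real_asymp
  moreover have "(\<lambda>n. 2 powr (- real n)) \<longlonglongrightarrow> 0" by real_asymp
  moreover have "(\<lambda>n. (real n + 1) * exp (- (\<omega> * real n))) \<longlonglongrightarrow> 0" using \<omega> by real_asymp
  ultimately have "B \<longlonglongrightarrow> 0" unfolding B_def[abs_def] by (intro tendsto_add_zero)
  moreover have "\<forall>\<^sub>F n in sequentially. (\<Sum>S\<in>{S. S \<subseteq> {1..m n} \<and> S \<noteq> {}}. zprob n (pn n) S) \<le> B n"
  proof -
    have "\<forall>\<^sub>F n in sequentially. e n < min (\<tau> / 2) (\<omega> / \<alpha>)"
      using e \<tau> \<omega> \<alpha> by (intro order_tendstoD(2)) auto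
    with pn eventually_ge_at_top[of r] eventually_gt_at_top[of 0] show ?thesis
    proof eventually_elim
      case (elim n)
      have w: "weight_probs r (pn n)" "\<And>k. k < 3 \<Longrightarrow> pn n k = 0" using elim by auto
      have mn: "real (m n) \<le> \<alpha> * real n" using \<alpha> by (simp add: m_def)
      have n0: "0 < real n" using elim by simp
      have Ln: "real (L n) \<le> \<delta> * real n" "\<delta> * real n \<le> real (Suc (L n))"
        using \<delta> by (auto simp: L_def) linarith
      let ?S = "{S. S \<subseteq> {1..m n} \<and> (1 \<le> card S \<and> card S \<le> L n)}" and ?T = "{S. S \<subseteq> {1..m n} \<and> L n < card S}"
      have split: "{S. S \<subseteq> {1..m n} \<and> S \<noteq> {}} = ?S \<union> ?T"
      proof (intro set_eqI iffI)
        fix S assume "S \<in> {S. S \<subseteq> {1..m n} \<and> S \<noteq> {}}"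
        then have "S \<subseteq> {1..m n}" "1 \<le> card S" by (auto simp: Suc_le_eq card_gt_0_iff intro: finite_subset)
        then show "S \<in> ?S \<union> ?T" by auto
      qed auto
      have "finite ?S" "finite ?T" by (auto intro: finite_subset[of _ "Pow {1..m n}"])
      then have "(\<Sum>S\<in>{S. S \<subseteq> {1..m n} \<and> S \<noteq> {}}. zprob n (pn n) S) =
          (\<Sum>S\<in>?S. zprob n (pn n) S) + (\<Sum>S\<in>?T. zprob n (pn n) S)"
        unfolding split by (intro sum.union_disjoint) auto
      also have "(\<Sum>S\<in>?S. zprob n (pn n) S) \<le> 4 * K / sqrt n"
        unfolding K_def
      proof (rule small_dependencies_le[OF w(1)])
        have "sqrt (real (L n) / n) \<le> sqrt \<delta>" using Ln n0 by (intro real_sqrt_le_mono) (simp add: pos_divide_le_eq)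
        then have "K * sqrt (real (L n) / n) \<le> K * sqrt \<delta>" using K by (intro mult_left_mono)
        then show "small_const r \<alpha> * sqrt (real (L n) / n) \<le> 1 / 2" using K\<delta> by (simp add: K_def)
      qed (use w elim mn \<alpha> in auto)
      also have "(\<Sum>S\<in>?T. zprob n (pn n) S) \<le>
          2 ^ m n * \<tau> ^ Suc (L n) + (real n + 1) * ((1 + e n) ^ m n * (1 + \<rho> \<eta>) powr (- ((\<alpha>2 - \<alpha>) * n)))"
      proof (rule large_dependencies_le[OF w(1)])
        show "(\<Sum>k\<le>r. \<bar>pn n k - p k\<bar>) + (real r)\<^sup>2 / n \<le> e n" by (simp add: e_def)
        show "\<eta> + e n \<le> \<tau>" using elim by (simp add: \<eta>_def)
      qed (use elim \<eta> \<tau> \<alpha> \<alpha>2 mn in auto)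
      also have "2 ^ m n * \<tau> ^ Suc (L n) \<le> 2 powr (- real n)"
      proof -
        have "2 ^ m n * \<tau> ^ Suc (L n) = 2 powr real (m n) * \<tau> powr real (Suc (L n))"
          using \<tau> by (simp only: powr_realpow zero_less_numeral)
        also have "\<dots> \<le> 2 powr (\<alpha> * n) * \<tau> powr (\<delta> * n)"
          using mn Ln \<tau> by (intro mult_mono powr_mono powr_mono') auto
        also have "\<dots> = 2 powr (\<alpha> * n + - ((\<alpha> + 1) / \<delta>) * (\<delta> * n))"
          unfolding \<tau>_def by (simp only: powr_powr powr_add)
        also have "\<alpha> * n + - ((\<alpha> + 1) / \<delta>) * (\<delta> * n) = - real n"
        proof -
          have c: "- ((\<alpha> + 1) / \<delta>) * (\<delta> * n) = - ((\<alpha> + 1) * n)" using \<delta> by simp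
          show ?thesis unfolding c by (simp add: algebra_simps)
        qed
        finally show ?thesis .
      qed
      also have "(1 + e n) ^ m n * (1 + \<rho> \<eta>) powr (- ((\<alpha>2 - \<alpha>) * n)) \<le> exp (- (\<omega> * real n))"
      proof -
        have e0: "0 \<le> e n" unfolding e_def by (intro add_nonneg_nonneg sum_nonneg) auto
        have "(1 + e n) ^ m n \<le> exp (e n) ^ m n" using e0 by (intro power_mono exp_ge_add_one_self) auto
        also have "\<dots> = exp (real (m n) * e n)" by (rule exp_of_nat_mult[symmetric])
        also have "\<dots> \<le> exp (\<omega> * n)"
        proof -
          have "real (m n) * e n \<le> (\<alpha> * n) * (\<omega> / \<alpha>)" using mn e0 elim \<alpha> by (intro mult_mono) auto
          then show ?thesis using \<alpha> by (simp add: mult.commute)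
        qed
        finally have a: "(1 + e n) ^ m n * (1 + \<rho> \<eta>) powr (- ((\<alpha>2 - \<alpha>) * n)) \<le>
            exp (\<omega> * n) * (1 + \<rho> \<eta>) powr (- ((\<alpha>2 - \<alpha>) * n))" by (intro mult_right_mono) auto
        have b: "(1 + \<rho> \<eta>) powr (- ((\<alpha>2 - \<alpha>) * n)) = exp (- (2 * \<omega> * n))"
          using gen_pos[OF \<eta>(1)] by (simp add: powr_def \<omega>_def)
        have c: "exp (\<omega> * n) * exp (- (2 * \<omega> * n)) = exp (- (\<omega> * real n))"
          by (simp add: exp_add[symmetric])
        show ?thesis using a unfolding b c .
      qed
      finally show ?case by (simp add: B_def mult_left_mono)
    qed
  qed
  ultimately show ?thesis by blast
qed

end

section \<open>The limit theorem\<close>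

lemma (in prob_space) prob_eq_cdf_diff:
  fixes V :: "'a \<Rightarrow> nat"
  assumes V: "V \<in> measurable M (count_space UNIV)"
  shows "\<P>(\<omega> in M. V \<omega> = k) =
    cdf (distr M borel (\<lambda>\<omega>. real (V \<omega>))) (real k + 1 / 2) - cdf (distr M borel (\<lambda>\<omega>. real (V \<omega>))) (real k - 1 / 2)"
proof -
  have rv: "(\<lambda>\<omega>. real (V \<omega>)) \<in> borel_measurable M" using V by (rule measurable_compose) simp
  have c: "cdf (distr M borel (\<lambda>\<omega>. real (V \<omega>))) x = \<P>(\<omega> in M. real (V \<omega>) \<le> x)" for x
    unfolding cdf_def using rv by (subst measure_distr) (auto intro!: arg_cong[of _ _ prob])
  have ev: "{\<omega> \<in> space M. real (V \<omega>) \<le> x} \<in> events" for x using rv by measurable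
  have "{\<omega> \<in> space M. V \<omega> = k} = {\<omega> \<in> space M. real (V \<omega>) \<le> real k + 1 / 2} - {\<omega> \<in> space M. real (V \<omega>) \<le> real k - 1 / 2}"
  proof (intro set_eqI iffI)
    fix \<omega> assume "\<omega> \<in> {\<omega> \<in> space M. real (V \<omega>) \<le> real k + 1 / 2} - {\<omega> \<in> space M. real (V \<omega>) \<le> real k - 1 / 2}"
    then have "\<omega> \<in> space M" "real (V \<omega>) \<le> real k + 1 / 2" "real k - 1 / 2 < real (V \<omega>)" by auto
    then show "\<omega> \<in> {\<omega> \<in> space M. V \<omega> = k}" by auto
  qed auto
  then show ?thesis
    unfolding c using ev by (simp add: finite_measure_Diff subset_eq)
qed

text \<open>The limit distribution function is continuous at half-integers, so weak convergence
  applies there, and the difference over \<open>k - 1/2\<close> and \<open>k + 1/2\<close> is the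
  point mass at \<open>k\<close>.\<close>

lemma prob_nat_tendsto:
  fixes V :: "'a \<Rightarrow> nat" and Vn :: "nat \<Rightarrow> 'b \<Rightarrow> nat"
  assumes Q: "prob_space Q" and V: "V \<in> measurable Q (count_space UNIV)"
    and N: "\<And>n. 1 \<le> n \<Longrightarrow> prob_space (N n)"
    and Vn: "\<And>n. 1 \<le> n \<Longrightarrow> Vn n \<in> measurable (N n) (count_space UNIV)"
    and conv: "weak_conv_m (\<lambda>n. distr (N n) borel (\<lambda>\<omega>. real (Vn n \<omega>))) (distr Q borel (\<lambda>\<omega>. real (V \<omega>)))"
  shows "(\<lambda>n. \<P>(\<omega> in N n. Vn n \<omega> = k)) \<longlonglongrightarrow> \<P>(\<omega> in Q. V \<omega> = k)"
proof -
  interpret Q: prob_space Q by fact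
  have rv: "(\<lambda>\<omega>. real (V \<omega>)) \<in> borel_measurable Q" using V by (rule measurable_compose) simp
  interpret D: real_distribution "distr Q borel (\<lambda>\<omega>. real (V \<omega>))"
    using rv by (rule Q.real_distribution_distr)
  have lim: "(\<lambda>n. cdf (distr (N n) borel (\<lambda>\<omega>. real (Vn n \<omega>))) x) \<longlonglongrightarrow> cdf (distr Q borel (\<lambda>\<omega>. real (V \<omega>))) x"
    if x: "\<And>j. real j \<noteq> x" for x
  proof -
    have "(\<lambda>\<omega>. real (V \<omega>)) -` {x} \<inter> space Q = {}" using x by auto
    then have "measure (distr Q borel (\<lambda>\<omega>. real (V \<omega>))) {x} = 0"
      using rv by (simp add: measure_distr)
    then have "isCont (cdf (distr Q borel (\<lambda>\<omega>. real (V \<omega>)))) x" by (simp add: D.isCont_cdf)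
    then show ?thesis using conv by (simp add: weak_conv_m_def weak_conv_def)
  qed
  have "real j \<noteq> real k + 1 / 2" "real j \<noteq> real k - 1 / 2" for j
  proof -
    have "2 * int j \<noteq> 2 * int k + 1" "2 * int j \<noteq> 2 * int k - 1" by presburger+
    then show "real j \<noteq> real k + 1 / 2" "real j \<noteq> real k - 1 / 2" by linarith+
  qed
  then have "(\<lambda>n. cdf (distr (N n) borel (\<lambda>\<omega>. real (Vn n \<omega>))) (real k + 1 / 2) -
      cdf (distr (N n) borel (\<lambda>\<omega>. real (Vn n \<omega>))) (real k - 1 / 2)) \<longlonglongrightarrow> \<P>(\<omega> in Q. V \<omega> = k)"
    unfolding Q.prob_eq_cdf_diff[OF V] by (intro tendsto_diff lim)
  then show ?thesis
  proof (rule Lim_transform_eventually)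
    show "\<forall>\<^sub>F n in sequentially. cdf (distr (N n) borel (\<lambda>\<omega>. real (Vn n \<omega>))) (real k + 1 / 2) -
        cdf (distr (N n) borel (\<lambda>\<omega>. real (Vn n \<omega>))) (real k - 1 / 2) = \<P>(\<omega> in N n. Vn n \<omega> = k)"
      using eventually_ge_at_top[of 1]
      by eventually_elim (rule prob_space.prob_eq_cdf_diff[OF N Vn, symmetric])
  qed
qed

lemma (in prob_space) sum_prob_le:
  fixes V :: "'a \<Rightarrow> nat"
  assumes V: "V \<in> measurable M (count_space UNIV)"
  shows "(\<Sum>k\<le>r. \<P>(\<omega> in M. V \<omega> = k)) = \<P>(\<omega> in M. V \<omega> \<le> r)"
proof -
  have ev: "{\<omega> \<in> space M. V \<omega> = k} \<in> events" for k using V by measurable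
  have "prob (\<Union>k\<in>{..r}. {\<omega> \<in> space M. V \<omega> = k}) = (\<Sum>k\<le>r. prob {\<omega> \<in> space M. V \<omega> = k})"
    using ev by (intro finite_measure_finite_Union) (auto simp: disjoint_family_on_def)
  moreover have "(\<Union>k\<in>{..r}. {\<omega> \<in> space M. V \<omega> = k}) = {\<omega> \<in> space M. V \<omega> \<le> r}" by auto
  ultimately show ?thesis by simp
qed

lemma (in prob_space) prob_eq_0_of_prob_1:
  fixes V :: "'a \<Rightarrow> nat"
  assumes V: "V \<in> measurable M (count_space UNIV)" and P: "\<P>(\<omega> in M. P (V \<omega>)) = 1" "\<not> P k"
  shows "\<P>(\<omega> in M. V \<omega> = k) = 0"
proof -
  have ev: "{\<omega> \<in> space M. A (V \<omega>)} \<in> events" for A using V by measurable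
  have "\<P>(\<omega> in M. P (V \<omega>)) + \<P>(\<omega> in M. V \<omega> = k) = prob ({\<omega> \<in> space M. P (V \<omega>)} \<union> {\<omega> \<in> space M. V \<omega> = k})"
    using ev P(2) by (intro finite_measure_Union[symmetric]) auto
  also have "\<dots> \<le> 1" by (rule prob_le_1)
  finally show ?thesis using P(1) measure_nonneg[of M "{\<omega> \<in> space M. V \<omega> = k}"] by linarith
qed

lemma (in prob_space) weight_probs_bounded:
  fixes V :: "'a \<Rightarrow> nat"
  assumes V: "V \<in> measurable M (count_space UNIV)" and r: "\<P>(\<omega> in M. real (V \<omega>) \<le> r1) = 1"
  shows "weight_probs (nat \<lfloor>r1\<rfloor>) (\<lambda>k. \<P>(\<omega> in M. V \<omega> = k))"
proof -
  have ev: "{\<omega> \<in> space M. A (V \<omega>)} \<in> events" for A using V by measurable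
  have k: "real k \<le> r1 \<Longrightarrow> k \<le> nat \<lfloor>r1\<rfloor>" for k by (rule le_nat_floor)
  have "1 \<le> \<P>(\<omega> in M. V \<omega> \<le> nat \<lfloor>r1\<rfloor>)"
    unfolding r[symmetric] using k ev by (intro finite_measure_mono) auto
  then have "(\<Sum>k\<le>nat \<lfloor>r1\<rfloor>. \<P>(\<omega> in M. V \<omega> = k)) = 1"
    unfolding sum_prob_le[OF V] using prob_le_1 by (metis antisym)
  moreover have "\<P>(\<omega> in M. V \<omega> = k) = 0" if "nat \<lfloor>r1\<rfloor> < k" for k
    using prob_eq_0_of_prob_1[OF V r, of k] k[of k] that by auto
  ultimately show ?thesis by (simp add: weight_probs_def)
qed

lemma pgf_eq_gen:
  assumes Q: "prob_space Q" and W: "W \<in> measurable Q (count_space UNIV)"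
    and p: "weight_probs r (\<lambda>k. \<P>(\<omega> in Q. W \<omega> = k))"
  shows "pgf Q W = gen r (\<lambda>k. \<P>(\<omega> in Q. W \<omega> = k))"
proof
  fix s
  interpret prob_space Q by fact
  have ev: "{\<omega> \<in> space Q. W \<omega> = k} \<in> events" for k using W by measurable
  have "\<P>(\<omega> in Q. W \<omega> \<le> r) = 1" using p sum_prob_le[OF W, of r] by (simp add: weight_probs_def)
  moreover have "{\<omega> \<in> space Q. W \<omega> \<le> r} \<in> events" using W by measurable
  ultimately have AE: "AE \<omega> in Q. W \<omega> \<le> r" by (simp add: prob_Collect_eq_1)
  have "pgf Q W s = (\<integral>\<omega>. (\<Sum>k\<le>r. s ^ k * indicator {\<omega> \<in> space Q. W \<omega> = k} \<omega>) \<partial>Q)"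
    unfolding pgf_def
  proof (rule integral_cong_AE)
    show "(\<lambda>\<omega>. s ^ W \<omega>) \<in> borel_measurable Q" using W by (rule measurable_compose) simp
    show "(\<lambda>\<omega>. \<Sum>k\<le>r. s ^ k * indicator {\<omega> \<in> space Q. W \<omega> = k} \<omega>) \<in> borel_measurable Q"
      using ev by measurable
    show "AE \<omega> in Q. s ^ W \<omega> = (\<Sum>k\<le>r. s ^ k * indicator {\<omega> \<in> space Q. W \<omega> = k} \<omega>)"
      using AE AE_space
    proof eventually_elim
      case (elim \<omega>)
      have "(\<Sum>k\<le>r. s ^ k * indicator {\<omega> \<in> space Q. W \<omega> = k} \<omega>) = (\<Sum>k\<le>r. if k = W \<omega> then s ^ k else 0)"
        using elim by (intro sum.cong) (auto simp: indicator_def)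
      then show ?case using elim by simp
    qed
  qed
  also have "\<dots> = (\<Sum>k\<le>r. s ^ k * prob {\<omega> \<in> space Q. W \<omega> = k})"
    using ev by (subst Bochner_Integration.integral_sum) (auto simp: emeasure_eq_measure)
  finally show "pgf Q W s = gen r (\<lambda>k. \<P>(\<omega> in Q. W \<omega> = k)) s"
    by (simp add: gen_def mult.commute)
qed

theorem theorem2p3:
  fixes Q :: "'c measure" and W :: "'c \<Rightarrow> nat"
    and N :: "nat \<Rightarrow> 'b measure" and Wn :: "nat \<Rightarrow> 'b \<Rightarrow> nat"
    and M :: "nat \<Rightarrow> 'a measure" and X :: "nat \<Rightarrow> nat \<Rightarrow> 'a \<Rightarrow> nat \<Rightarrow> bit"
    and r\<^sub>1 :: real
  assumes "prob_space Q"
    and "W \<in> measurable Q (count_space UNIV)"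
    and "\<And>n. 1 \<le> n \<Longrightarrow> prob_space (N n)"
    and "\<And>n. 1 \<le> n \<Longrightarrow> Wn n \<in> measurable (N n) (count_space {1..n})"
    and "weak_conv_m (\<lambda>n. distr (N n) borel (\<lambda>\<omega>. real (Wn n \<omega>))) (distr Q borel (\<lambda>\<omega>. real (W \<omega>)))"
    and "\<And>n. 1 \<le> n \<Longrightarrow> random_bit_vectors (M n) (N n) n (Wn n) (X n)"
    and "\<And>n. 1 \<le> n \<Longrightarrow> \<P>(\<omega> in N n. real (Wn n \<omega>) \<le> r\<^sub>1) = 1"
    and "\<forall>\<^sub>F n in sequentially. \<P>(\<omega> in N n. Wn n \<omega> \<ge> 3) = 1"
  shows "alpha_star (pgf Q W) \<le> alpha_lower (pgf Q W) \<and> alpha_lower (pgf Q W) \<le> 1 \<and>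
    (\<forall>\<epsilon>>0. (\<lambda>n. \<P>(\<omega> in M n.
        (alpha_star (pgf Q W) - \<epsilon>) * real n \<le> real (first_dependence (\<lambda>m. X n m \<omega>)) \<and>
        real (first_dependence (\<lambda>m. X n m \<omega>)) \<le> (alpha_lower (pgf Q W) + \<epsilon>) * real n))
      \<longlonglongrightarrow> 1)"
proof -
  define r where "r = nat \<lfloor>r\<^sub>1\<rfloor>"
  define pn where "pn n k = \<P>(\<omega> in N n. Wn n \<omega> = k)" for n k
  define p where "p k = \<P>(\<omega> in Q. W \<omega> = k)" for k
  have Wm: "Wn n \<in> measurable (N n) (count_space UNIV)" if "1 \<le> n" for n
    using assms(4)[OF that] by (rule measurable_compose) simp
  have lim: "(\<lambda>n. pn n k) \<longlonglongrightarrow> p k" for k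
    unfolding pn_def p_def by (rule prob_nat_tendsto[OF assms(1,2,3) Wm assms(5)])
  have wp: "weight_probs r (pn n)" if "1 \<le> n" for n
    unfolding r_def pn_def
    by (rule prob_space.weight_probs_bounded[OF assms(3)[OF that] Wm[OF that] assms(7)[OF that]])
  have pn_ev: "\<forall>\<^sub>F n in sequentially. weight_probs r (pn n) \<and> (\<forall>k<3. pn n k = 0)"
    using assms(8) eventually_ge_at_top[of 1]
  proof eventually_elim
    case (elim n)
    have "pn n k = 0" if "k < 3" for k
      unfolding pn_def using prob_space.prob_eq_0_of_prob_1[OF assms(3) Wm elim(1), of k] elim that by auto
    then show ?case using wp elim by auto
  qed
  then have pn_ev': "\<forall>\<^sub>F n in sequentially. weight_probs r (pn n)" by eventually_elim auto
  have p0: "p k = 0" if "\<forall>\<^sub>F n in sequentially. pn n k = 0" for k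
    using LIMSEQ_unique[OF lim[of k] tendsto_eventually[OF that]] .
  have "p k = 0" if "r < k" for k
    using pn_ev' by (intro p0, eventually_elim) (use that in \<open>auto simp: weight_probs_def\<close>)
  moreover have "(\<Sum>k\<le>r. p k) = 1"
  proof (rule LIMSEQ_unique)
    show "(\<lambda>n. \<Sum>k\<le>r. pn n k) \<longlonglongrightarrow> (\<Sum>k\<le>r. p k)" using lim by (intro tendsto_sum)
    show "(\<lambda>n. \<Sum>k\<le>r. pn n k) \<longlonglongrightarrow> 1"
      using pn_ev' by (intro tendsto_eventually, eventually_elim) (auto simp: weight_probs_def)
  qed
  ultimately have wp_p: "weight_probs r p" by (auto simp: weight_probs_def p_def)
  have p3: "p k = 0" if "k < 3" for k
    using pn_ev by (intro p0, eventually_elim) (use that in auto)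
  interpret heavy_weights r p by unfold_locales (use wp_p p3 in auto)
  have \<rho>: "pgf Q W = \<rho>"
    using pgf_eq_gen[OF assms(1,2), of r] wp_p unfolding p_def[abs_def] by simp
  define T where "T n \<omega> = first_dependence (\<lambda>m. X n m \<omega>)" for n \<omega>
  have ev: "{\<omega> \<in> space (M n). P (T n \<omega>)} \<in> sets (M n)" if n: "1 \<le> n" for n P
  proof -
    interpret random_bit_vectors "M n" "N n" n "Wn n" "X n" using assms(6)[OF n] .
    have "T n \<in> measurable (M n) (count_space UNIV)"
      unfolding T_def[abs_def] by (rule first_dependence_measurable[OF Wm[OF n]])
    then show ?thesis by measurable
  qed
  have prob_M: "prob_space (M n)" if "1 \<le> n" for n
    using assms(6)[OF that] by (simp add: random_bit_vectors_def)
  have mono: "\<P>(\<omega> in M n. P (T n \<omega>)) \<le> \<P>(\<omega> in M n. P' (T n \<omega>))"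
    if "1 \<le> n" "\<And>t. P t \<Longrightarrow> P' t" for n P P'
  proof -
    interpret prob_space "M n" using prob_M that by simp
    show ?thesis using that ev by (intro finite_measure_mono) auto
  qed
  have late: "(\<lambda>n. \<P>(\<omega> in M n. (alpha_lower \<rho> + \<epsilon>) * real n < real (T n \<omega>))) \<longlonglongrightarrow> 0"
    if \<epsilon>: "0 < \<epsilon>" for \<epsilon>
  proof -
    obtain \<alpha> x where \<alpha>: "0 < \<alpha>" "\<alpha> < alpha_lower \<rho> + \<epsilon>" "0 < x" "x < 1" "0 < bethe \<alpha> x"
      using ex_positive_bethe[OF \<epsilon>] by auto
    note b = late_dependence_bound_tendsto[OF pn_ev' lim \<alpha>(1,3,4,5)]
    show ?thesis
    proof (rule tendsto_sandwich[OF _ _ tendsto_const b(2)])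
      show "\<forall>\<^sub>F n in sequentially. \<P>(\<omega> in M n. (alpha_lower \<rho> + \<epsilon>) * real n < real (T n \<omega>)) \<le>
          real (nat \<lfloor>\<alpha> * real n\<rfloor>) / (real (nat \<lfloor>\<alpha> * real n\<rfloor>) -
            (mstep 1 (cube n) (law n (pn n)) ^^ nat \<lfloor>\<alpha> * real n\<rfloor>) rk {})\<^sup>2"
        using b(1) eventually_ge_at_top[of 1] eventually_ge_at_top[of r]
      proof eventually_elim
        case (elim n)
        interpret random_bit_vectors "M n" "N n" n "Wn n" "X n" using assms(6) elim by simp
        have "real (nat \<lfloor>\<alpha> * real n\<rfloor>) \<le> \<alpha> * real n" using \<alpha> by simp
        also have "\<dots> \<le> (alpha_lower \<rho> + \<epsilon>) * real n" using \<alpha> by (intro mult_right_mono) auto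
        finally have "\<P>(\<omega> in M n. (alpha_lower \<rho> + \<epsilon>) * real n < real (T n \<omega>)) \<le>
            \<P>(\<omega> in M n. nat \<lfloor>\<alpha> * real n\<rfloor> < T n \<omega>)"
          using elim by (intro mono) (linarith | simp)+
        also have "\<dots> \<le> real (nat \<lfloor>\<alpha> * real n\<rfloor>) / (real (nat \<lfloor>\<alpha> * real n\<rfloor>) -
            (mstep 1 (cube n) (law n (pn n)) ^^ nat \<lfloor>\<alpha> * real n\<rfloor>) rk {})\<^sup>2"
          unfolding T_def
          by (rule prob_late_dependence_le[where r = r])
            (use elim wp[of n] Wm[of n] in \<open>auto simp: pn_def[abs_def]\<close>)
        finally show ?case .
      qed
    qed simp
  qed
  have early: "(\<lambda>n. \<P>(\<omega> in M n. real (T n \<omega>) < (alpha_star \<rho> - \<epsilon>) * real n)) \<longlonglongrightarrow> 0" if "0 < \<epsilon>" for \<epsilon>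
  proof (cases "0 < alpha_star \<rho> - \<epsilon>")
    case False
    \<comment> \<open>Here the event is empty, as a dependence time is never negative.\<close>
    have "\<not> real t < (alpha_star \<rho> - \<epsilon>) * real n" for t n :: nat
      using False mult_nonpos_nonneg[of "alpha_star \<rho> - \<epsilon>" "real n"] by (simp add: not_less)
    then show ?thesis by simp
  next
    case True
    define \<alpha> where "\<alpha> = alpha_star \<rho> - \<epsilon>"
    have \<alpha>: "0 < \<alpha>" "\<alpha> < alpha_star \<rho>" using True that by (auto simp: \<alpha>_def)
    obtain B where B: "B \<longlonglongrightarrow> 0" and le: "\<forall>\<^sub>F n in sequentially.
        (\<Sum>S\<in>{S. S \<subseteq> {1..nat \<lfloor>\<alpha> * real n\<rfloor>} \<and> S \<noteq> {}}. zprob n (pn n) S) \<le> B n"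
      using early_dependence_bound_tendsto[OF pn_ev lim \<alpha>] by auto
    show ?thesis unfolding \<alpha>_def[symmetric]
    proof (rule tendsto_sandwich[OF _ _ tendsto_const B])
      show "\<forall>\<^sub>F n in sequentially. \<P>(\<omega> in M n. real (T n \<omega>) < \<alpha> * real n) \<le> B n"
        using le eventually_ge_at_top[of 1]
      proof eventually_elim
        case (elim n)
        interpret random_bit_vectors "M n" "N n" n "Wn n" "X n" using assms(6) elim by simp
        have "\<P>(\<omega> in M n. real (T n \<omega>) < \<alpha> * real n) \<le> \<P>(\<omega> in M n. T n \<omega> \<le> nat \<lfloor>\<alpha> * real n\<rfloor>)"
          using elim by (intro mono le_nat_floor) auto
        also have "\<dots> \<le> (\<Sum>S\<in>{S. S \<subseteq> {1..nat \<lfloor>\<alpha> * real n\<rfloor>} \<and> S \<noteq> {}}. zprob n (pn n) S)"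
          unfolding T_def pn_def[abs_def] using elim by (intro prob_early_dependence_le Wm) auto
        finally show ?case using elim by linarith
      qed
    qed simp
  qed
  \<comment> \<open>A union bound used twice: with the event of the theorem as \<open>P\<close> for
    the limit, and with \<open>P\<close> false for the inequality of the thresholds.\<close>
  have both: "1 \<le> \<P>(\<omega> in M n. P (T n \<omega>)) + (\<P>(\<omega> in M n. P1 (T n \<omega>)) + \<P>(\<omega> in M n. P2 (T n \<omega>)))"
    if n: "1 \<le> n" and P: "\<And>t. P t \<or> P1 t \<or> P2 t" for n and P P1 P2 :: "nat \<Rightarrow> bool"
  proof -
    interpret prob_space "M n" using prob_M n by simp
    let ?E = "\<lambda>P. {\<omega> \<in> space (M n). P (T n \<omega>)}"
    have "space (M n) = ?E P \<union> (?E P1 \<union> ?E P2)" using P by auto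
    then have "1 = prob (?E P \<union> (?E P1 \<union> ?E P2))" using prob_space by simp
    also have "\<dots> \<le> prob (?E P) + prob (?E P1 \<union> ?E P2)"
      using ev[OF n] by (intro measure_Un_le) auto
    also have "prob (?E P1 \<union> ?E P2) \<le> prob (?E P1) + prob (?E P2)"
      using ev[OF n] by (intro measure_Un_le) auto
    finally show ?thesis by simp
  qed
  have "alpha_star \<rho> \<le> alpha_lower \<rho>"
  proof (rule ccontr)
    assume "\<not> ?thesis"
    \<comment> \<open>A third of the supposed gap: the two tail events then overlap and cover
      everything, although the probability of each tends to zero.\<close>
    define \<epsilon> where "\<epsilon> = (alpha_star \<rho> - alpha_lower \<rho>) / 3"
    have \<epsilon>: "0 < \<epsilon>" "alpha_lower \<rho> + \<epsilon> < alpha_star \<rho> - \<epsilon>"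
      using \<open>\<not> alpha_star \<rho> \<le> alpha_lower \<rho>\<close> by (auto simp: \<epsilon>_def field_simps)
    have "(\<lambda>n. \<P>(\<omega> in M n. False) + (\<P>(\<omega> in M n. (alpha_lower \<rho> + \<epsilon>) * real n < real (T n \<omega>)) +
        \<P>(\<omega> in M n. real (T n \<omega>) < (alpha_star \<rho> - \<epsilon>) * real n))) \<longlonglongrightarrow> 0 + (0 + 0)"
      using late[OF \<epsilon>(1)] early[OF \<epsilon>(1)] by (intro tendsto_add) auto
    moreover have "\<forall>\<^sub>F n in sequentially. 1 \<le> \<P>(\<omega> in M n. False) + (\<P>(\<omega> in M n. (alpha_lower \<rho> + \<epsilon>) * real n < real (T n \<omega>)) +
        \<P>(\<omega> in M n. real (T n \<omega>) < (alpha_star \<rho> - \<epsilon>) * real n))"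
      using eventually_ge_at_top[of 1]
    proof eventually_elim
      case (elim n)
      have "(alpha_lower \<rho> + \<epsilon>) * real n < (alpha_star \<rho> - \<epsilon>) * real n"
        using \<epsilon>(2) elim by (intro mult_strict_right_mono) auto
      then have "False \<or> (alpha_lower \<rho> + \<epsilon>) * real n < real t \<or> real t < (alpha_star \<rho> - \<epsilon>) * real n" for t :: nat
        by linarith
      from both[OF elim, of "\<lambda>_. False" "\<lambda>t. (alpha_lower \<rho> + \<epsilon>) * real n < real t"
          "\<lambda>t. real t < (alpha_star \<rho> - \<epsilon>) * real n", OF this]
      show ?case .
    qed
    ultimately have "(1 :: real) \<le> 0 + (0 + 0)" by (rule tendsto_lowerbound) simp
    then show False by simp
  qed
  moreover have "(\<lambda>n. \<P>(\<omega> in M n. (alpha_star \<rho> - \<epsilon>) * real n \<le> real (T n \<omega>) \<and>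
      real (T n \<omega>) \<le> (alpha_lower \<rho> + \<epsilon>) * real n)) \<longlonglongrightarrow> 1" (is "?f \<longlonglongrightarrow> 1") if \<epsilon>: "0 < \<epsilon>" for \<epsilon>
  proof (rule tendsto_sandwich)
    let ?l = "\<lambda>n. 1 - (\<P>(\<omega> in M n. (alpha_lower \<rho> + \<epsilon>) * real n < real (T n \<omega>)) +
        \<P>(\<omega> in M n. real (T n \<omega>) < (alpha_star \<rho> - \<epsilon>) * real n))"
    have "?l \<longlonglongrightarrow> 1 - (0 + 0)" using late[OF \<epsilon>] early[OF \<epsilon>] by (intro tendsto_intros)
    then show "?l \<longlonglongrightarrow> 1" by simp
    show "\<forall>\<^sub>F n in sequentially. ?l n \<le> ?f n"
      using eventually_ge_at_top[of 1]
    proof eventually_elim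
      case (elim n)
      have "((alpha_star \<rho> - \<epsilon>) * real n \<le> real t \<and> real t \<le> (alpha_lower \<rho> + \<epsilon>) * real n) \<or>
          (alpha_lower \<rho> + \<epsilon>) * real n < real t \<or> real t < (alpha_star \<rho> - \<epsilon>) * real n" for t :: nat
        by linarith
      from both[OF elim, of "\<lambda>t. (alpha_star \<rho> - \<epsilon>) * real n \<le> real t \<and> real t \<le> (alpha_lower \<rho> + \<epsilon>) * real n"
          "\<lambda>t. (alpha_lower \<rho> + \<epsilon>) * real n < real t" "\<lambda>t. real t < (alpha_star \<rho> - \<epsilon>) * real n", OF this]
      show ?case by simp
    qed
    show "\<forall>\<^sub>F n in sequentially. ?f n \<le> 1"
      using eventually_ge_at_top[of 1] by eventually_elim (simp add: prob_space.prob_le_1[OF prob_M])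
  qed simp
  ultimately show ?thesis unfolding \<rho> using alpha_lower_le_1 by (simp add: T_def)
qed

end
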